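(* The forking relation in $T^{\neg\mathrm{StFk}}$ is unstable: there is an indiscernible sequence $\{(a_i,b_i)\}_{i<\omega}$ of tuples in a sufficiently saturated model of $T^{\neg\mathrm{StFk}}$ such that, for all $i,j<\omega$, $a_i$ is not forking-independent from $b_j$ over $\emptyset$ if and only if $i<j$.
   Context: Bipartite graphs and rings. A bipartite graph is $A=I_A\sqcup J_A$ with edge relation $E_A$ between $I_A$ and $J_A$; the partition is part of the structure and is inherited by induced subgraphs. $R_A$ is the associative unital $\mathbb{Q}$-algebra generated by symbols $X_v$ ($v\in A$) subject to the relations: $X_iX_{i'}=X_{i'}X_i$ for $i,i'\in I_A$; $X_jX_{j'}=X_{j'}X_j$ for $j,j'\in J_A$; and for $i\in I_A,j\in J_A$, $X_iX_j=X_jX_i$ if $E_A(i,j)$ and $X_iX_j=-X_jX_i$ if $\neg E_A(i,j)$. $R_A$ is a domain and has a division ring of fractions $Q_A$ (a division ring containing $R_A$ in which every element has the form $rs^{-1}$ with $r,s\in R_A$, $s\neq0$), unique up to unique isomorphism over $R_A$. Modules are left modules. Language and theory. $\mathcal{L}$ has sorts $\Gamma,V$; unary predicates $I,J$ on $\Gamma$; a binary relation $E$ on $\Gamma$; a binary function $+:V\times V\to V$; unary functions $q\cdot-:V\to V$ for $q\in\mathbb{Q}$; and a function $\cdot:\Gamma\times V\to V$. A $Q_A$-module $M$ is considered as the $\mathcal{L}$-structure $(A,M)$ with $\Gamma=A$ (with $I=I_A,J=J_A,E=E_A$), $V=M$ (with its addition and scalar multiplication by $\mathbb{Q}$), and $v\cdot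 m=X_vm$. Let $G$ be the random bipartite graph and $M$ a $Q_G$-module of infinite dimension (no finite set spans $M$ over $Q_G$). $T^{\neg\mathrm{StFk}}$ is the complete $\mathcal{L}$-theory of $(G,M)$. Forking-independence of $a$ from $b$ over $\emptyset$ means that $\mathrm{tp}(a/b)$ does not fork over $\emptyset$. *)

theory Defs
  imports Complex_Main "HOL-Library.Poly_Mapping" "HOL-Library.Countable_Set"
begin

section \<open>Bipartite graphs\<close>

record 'a bigraph =
  left :: "'a set"
  right :: "'a set"
  edge :: "'a \<Rightarrow> 'a \<Rightarrow> bool"

definition verts :: "'a bigraph \<Rightarrow> 'a set" where
  "verts A = left A \<union> right A"

text \<open>The edge relation is oriented from the left part to the right part; it is not symmetrized.\<close>

definition bipartite :: "'a bigraph \<Rightarrow> bool" where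
  "bipartite A \<longleftrightarrow> left A \<inter> right A = {} \<and>
     (\<forall>x y. edge A x y \<longrightarrow> x \<in> left A \<and> y \<in> right A)"

text \<open>The random bipartite graph (the Fraisse limit of the finite bipartite graphs with named
  parts), given by its extension axioms. Both parts are then nonempty (take \<open>U = W = {}\<close>)
  and in fact infinite.\<close>

definition random_bipartite :: "'a bigraph \<Rightarrow> bool" where
  "random_bipartite A \<longleftrightarrow> bipartite A \<and> countable (verts A) \<and>
     (\<forall>U W. finite U \<and> finite W \<and> U \<subseteq> right A \<and> W \<subseteq> right A \<and> U \<inter> W = {} \<longrightarrow>
        (\<exists>x\<in>left A. (\<forall>u\<in>U. edge A x u) \<and> (\<forall>w\<in>W. \<not> edge A x w))) \<and>
     (\<forall>U W. finite U \<and> finite W \<and> U \<subseteq> left A \<and> W \<subseteq> left A \<and> U \<inter> W = {} \<longrightarrow>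
        (\<exists>y\<in>right A. (\<forall>u\<in>U. edge A u y) \<and> (\<forall>w\<in>W. \<not> edge A w y)))"

section \<open>The algebra of a bipartite graph and its division ring of fractions\<close>

text \<open>Words form the free monoid, written additively, so that \<open>'a word \<Rightarrow>\<^sub>0 rat\<close> with the
  convolution product of \<^theory>\<open>HOL-Library.Poly_Mapping\<close> is the free associative unital algebra
  over the rationals on the symbols \<open>'a\<close>.\<close>

datatype 'a word = Word (letters: "'a list")

instantiation word :: (type) monoid_add
begin

definition zero_word :: "'a word" where "zero_word = Word []"

definition plus_word :: "'a word \<Rightarrow> 'a word \<Rightarrow> 'a word" where
  "plus_word u w = Word (letters u @ letters w)"

instance
  by standard (simp_all add: zero_word_def plus_word_def)

end

type_synonym 'a free_algebra = "'a word \<Rightarrow>\<^sub>0 rat"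

definition gen :: "'a \<Rightarrow> 'a free_algebra" where
  "gen v = Poly_Mapping.single (Word [v]) 1"

definition free_algebra_on :: "'a set \<Rightarrow> 'a free_algebra set" where
  "free_algebra_on S = {p. \<forall>w\<in>Poly_Mapping.keys p. set (letters w) \<subseteq> S}"

text \<open>The two-sided ideal of \<open>free_algebra_on (verts A)\<close> generated by the defining relations, so
  that \<open>R\<^sub>A\<close> is \<open>free_algebra_on (verts A)\<close> modulo \<open>relation_ideal A\<close>.\<close>

inductive_set relation_ideal :: "'a bigraph \<Rightarrow> 'a free_algebra set" for A :: "'a bigraph" where
  comm_left: "i \<in> left A \<Longrightarrow> i' \<in> left A \<Longrightarrow> gen i * gen i' - gen i' * gen i \<in> relation_ideal A"
| comm_right: "j \<in> right A \<Longrightarrow> j' \<in> right A \<Longrightarrow> gen j * gen j' - gen j' * gen j \<in> relation_ideal A"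
| comm_edge: "i \<in> left A \<Longrightarrow> j \<in> right A \<Longrightarrow> edge A i j \<Longrightarrow>
    gen i * gen j - gen j * gen i \<in> relation_ideal A"
| anticomm_nonedge: "i \<in> left A \<Longrightarrow> j \<in> right A \<Longrightarrow> \<not> edge A i j \<Longrightarrow>
    gen i * gen j + gen j * gen i \<in> relation_ideal A"
| zero: "0 \<in> relation_ideal A"
| add: "p \<in> relation_ideal A \<Longrightarrow> q \<in> relation_ideal A \<Longrightarrow> p + q \<in> relation_ideal A"
| mult: "p \<in> relation_ideal A \<Longrightarrow> r \<in> free_algebra_on (verts A) \<Longrightarrow>
    s \<in> free_algebra_on (verts A) \<Longrightarrow> r * p * s \<in> relation_ideal A"

text \<open>The library's \<open>of_rat\<close> needs a commutative field, hence this variant.\<close>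

definition rat_embed :: "rat \<Rightarrow> 'q::{division_ring,ring_char_0}" where
  "rat_embed q = of_int (fst (quotient_of q)) / of_int (snd (quotient_of q))"

definition eval_free :: "('a \<Rightarrow> 'q::{division_ring,ring_char_0}) \<Rightarrow> 'a free_algebra \<Rightarrow> 'q" where
  "eval_free X p = (\<Sum>w\<in>Poly_Mapping.keys p.
     rat_embed (Poly_Mapping.lookup p w) * prod_list (map X (letters w)))"

text \<open>The type \<open>'q\<close> together with the images \<open>X v\<close> of the generators is a division ring of fractions
  \<open>Q\<^sub>A\<close> of \<open>R\<^sub>A\<close>: the first conjunct says that evaluation at \<open>X\<close> induces a well-defined embedding
  of \<open>R\<^sub>A\<close> into \<open>'q\<close>, the second that every element is a right fraction over its image.\<close>

definition division_ring_of_fractions ::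
  "'a bigraph \<Rightarrow> ('a \<Rightarrow> 'q::{division_ring,ring_char_0}) \<Rightarrow> bool" where
  "division_ring_of_fractions A X \<longleftrightarrow>
     (\<forall>p\<in>free_algebra_on (verts A). eval_free X p = 0 \<longleftrightarrow> p \<in> relation_ideal A) \<and>
     (\<forall>x. \<exists>r\<in>free_algebra_on (verts A). \<exists>s\<in>free_algebra_on (verts A).
        eval_free X s \<noteq> 0 \<and> x = eval_free X r * inverse (eval_free X s))"

text \<open>The library's modules are over commutative rings only.\<close>

locale left_module =
  fixes scale :: "'q::ring_1 \<Rightarrow> 'm::ab_group_add \<Rightarrow> 'm"
  assumes scale_right_distrib: "scale a (x + y) = scale a x + scale a y"
    and scale_left_distrib: "scale (a + b) x = scale a x + scale b x"
    and scale_scale: "scale a (scale b x) = scale (a * b) x"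
    and scale_one: "scale 1 x = x"

definition finitely_spanned :: "('q::ring_1 \<Rightarrow> 'm::ab_group_add \<Rightarrow> 'm) \<Rightarrow> bool" where
  "finitely_spanned scale \<longleftrightarrow>
     (\<exists>S. finite S \<and> (\<forall>m. \<exists>c. m = (\<Sum>s\<in>S. scale (c s) s)))"

section \<open>The two-sorted language\<close>

text \<open>Variables of either sort are de Bruijn indices, counted separately for the two sorts. The only
  terms of the sort \<open>\<Gamma>\<close> are variables.\<close>

datatype trm = Var nat | Plus trm trm | Scale rat trm | Act nat trm

datatype form =
    EqG nat nat
  | EqV trm trm
  | InI nat
  | InJ nat
  | Edge nat nat
  | Neg form
  | Conj form form
  | ExG form
  | ExV form

record ('g, 'v) lstr =
  gam :: "'g set"
  vec :: "'v set"
  predI :: "'g \<Rightarrow> bool"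
  predJ :: "'g \<Rightarrow> bool"
  relE :: "'g \<Rightarrow> 'g \<Rightarrow> bool"
  plusV :: "'v \<Rightarrow> 'v \<Rightarrow> 'v"
  ratV :: "rat \<Rightarrow> 'v \<Rightarrow> 'v"
  actV :: "'g \<Rightarrow> 'v \<Rightarrow> 'v"

definition lstructure :: "('g, 'v) lstr \<Rightarrow> bool" where
  "lstructure N \<longleftrightarrow> gam N \<noteq> {} \<and> vec N \<noteq> {} \<and>
     (\<forall>x\<in>vec N. \<forall>y\<in>vec N. plusV N x y \<in> vec N) \<and>
     (\<forall>q. \<forall>x\<in>vec N. ratV N q x \<in> vec N) \<and>
     (\<forall>g\<in>gam N. \<forall>x\<in>vec N. actV N g x \<in> vec N)"

text \<open>A finite tuple of elements is listed with its \<open>\<Gamma>\<close>-entries first; its shape records the number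
  of entries of each sort.\<close>

type_synonym ('g, 'v) tuple = "'g list \<times> 'v list"

definition shape :: "('g, 'v) tuple \<Rightarrow> nat \<times> nat" where
  "shape t = (length (fst t), length (snd t))"

definition tapp :: "('g, 'v) tuple \<Rightarrow> ('g, 'v) tuple \<Rightarrow> ('g, 'v) tuple"  (infixr "\<frown>" 65) where
  "s \<frown> t = (fst s @ fst t, snd s @ snd t)"

definition tconcat :: "('g, 'v) tuple list \<Rightarrow> ('g, 'v) tuple" where
  "tconcat ts = (concat (map fst ts), concat (map snd ts))"

definition tuples :: "'g set \<times> 'v set \<Rightarrow> ('g, 'v) tuple set" where
  "tuples B = lists (fst B) \<times> lists (snd B)"

definition entries :: "('g, 'v) tuple \<Rightarrow> 'g set \<times> 'v set" where
  "entries t = (set (fst t), set (snd t))"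

definition carriers :: "('g, 'v) lstr \<Rightarrow> 'g set \<times> 'v set" where
  "carriers N = (gam N, vec N)"

text \<open>\<open>scoped \<phi> (m, n)\<close>: the free variables of \<open>\<phi>\<close> are among the first \<open>m\<close> of sort \<open>\<Gamma>\<close> and the
  first \<open>n\<close> of sort \<open>V\<close>.\<close>

primrec scoped_trm :: "trm \<Rightarrow> nat \<times> nat \<Rightarrow> bool" where
  "scoped_trm (Var k) s \<longleftrightarrow> k < snd s"
| "scoped_trm (Plus t u) s \<longleftrightarrow> scoped_trm t s \<and> scoped_trm u s"
| "scoped_trm (Scale q t) s \<longleftrightarrow> scoped_trm t s"
| "scoped_trm (Act k t) s \<longleftrightarrow> k < fst s \<and> scoped_trm t s"

primrec scoped :: "form \<Rightarrow> nat \<times> nat \<Rightarrow> bool" where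
  "scoped (EqG k l) s \<longleftrightarrow> k < fst s \<and> l < fst s"
| "scoped (EqV t u) s \<longleftrightarrow> scoped_trm t s \<and> scoped_trm u s"
| "scoped (InI k) s \<longleftrightarrow> k < fst s"
| "scoped (InJ k) s \<longleftrightarrow> k < fst s"
| "scoped (Edge k l) s \<longleftrightarrow> k < fst s \<and> l < fst s"
| "scoped (Neg \<phi>) s \<longleftrightarrow> scoped \<phi> s"
| "scoped (Conj \<phi> \<psi>) s \<longleftrightarrow> scoped \<phi> s \<and> scoped \<psi> s"
| "scoped (ExG \<phi>) s \<longleftrightarrow> scoped \<phi> (Suc (fst s), snd s)"
| "scoped (ExV \<phi>) s \<longleftrightarrow> scoped \<phi> (fst s, Suc (snd s))"

primrec tval :: "('g, 'v) lstr \<Rightarrow> trm \<Rightarrow> ('g, 'v) tuple \<Rightarrow> 'v" where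
  "tval N (Var k) e = snd e ! k"
| "tval N (Plus t u) e = plusV N (tval N t e) (tval N u e)"
| "tval N (Scale q t) e = ratV N q (tval N t e)"
| "tval N (Act k t) e = actV N (fst e ! k) (tval N t e)"

primrec sat :: "('g, 'v) lstr \<Rightarrow> form \<Rightarrow> ('g, 'v) tuple \<Rightarrow> bool" where
  "sat N (EqG k l) e \<longleftrightarrow> fst e ! k = fst e ! l"
| "sat N (EqV t u) e \<longleftrightarrow> tval N t e = tval N u e"
| "sat N (InI k) e \<longleftrightarrow> predI N (fst e ! k)"
| "sat N (InJ k) e \<longleftrightarrow> predJ N (fst e ! k)"
| "sat N (Edge k l) e \<longleftrightarrow> relE N (fst e ! k) (fst e ! l)"
| "sat N (Neg \<phi>) e \<longleftrightarrow> \<not> sat N \<phi> e"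
| "sat N (Conj \<phi> \<psi>) e \<longleftrightarrow> sat N \<phi> e \<and> sat N \<psi> e"
| "sat N (ExG \<phi>) e \<longleftrightarrow> (\<exists>g\<in>gam N. sat N \<phi> (g # fst e, snd e))"
| "sat N (ExV \<phi>) e \<longleftrightarrow> (\<exists>x\<in>vec N. sat N \<phi> (fst e, x # snd e))"

definition complete_theory :: "('g, 'v) lstr \<Rightarrow> form set" where
  "complete_theory N = {\<phi>. scoped \<phi> (0, 0) \<and> sat N \<phi> ([], [])}"

definition is_model :: "('g, 'v) lstr \<Rightarrow> form set \<Rightarrow> bool" where
  "is_model N T \<longleftrightarrow> lstructure N \<and> (\<forall>\<phi>\<in>T. sat N \<phi> ([], []))"

text \<open>The structure \<open>(A, M)\<close> of a \<open>Q\<^sub>A\<close>-module \<open>M\<close>, the type \<open>'m\<close> with the given scalar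
  multiplication.\<close>

definition module_structure ::
  "'a bigraph \<Rightarrow> ('a \<Rightarrow> 'q::{division_ring,ring_char_0}) \<Rightarrow> ('q \<Rightarrow> 'm::ab_group_add \<Rightarrow> 'm)
    \<Rightarrow> ('a, 'm) lstr" where
  "module_structure A X scale =
     \<lparr>gam = verts A, vec = UNIV,
      predI = (\<lambda>v. v \<in> left A), predJ = (\<lambda>v. v \<in> right A), relE = edge A,
      plusV = (+), ratV = (\<lambda>q. scale (rat_embed q)), actV = (\<lambda>v. scale (X v))\<rparr>"

section \<open>Types, saturation, indiscernibility, forking\<close>

definition same_type ::
  "('g, 'v) lstr \<Rightarrow> 'g set \<times> 'v set \<Rightarrow> ('g, 'v) tuple \<Rightarrow> ('g, 'v) tuple \<Rightarrow> bool" where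
  "same_type N B x y \<longleftrightarrow> shape x = shape y \<and>
     (\<forall>b\<in>tuples B. \<forall>\<phi>. scoped \<phi> (shape (x \<frown> b)) \<longrightarrow> (sat N \<phi> (x \<frown> b) \<longleftrightarrow> sat N \<phi> (y \<frown> b)))"

text \<open>A formula \<open>\<phi>(x, b)\<close> with parameters is the pair \<open>(\<phi>, b)\<close>; the variables \<open>x\<close>, of a given
  shape, come before those for which \<open>b\<close> is substituted.\<close>

definition formula_over ::
  "'g set \<times> 'v set \<Rightarrow> nat \<times> nat \<Rightarrow> form \<times> ('g, 'v) tuple \<Rightarrow> bool" where
  "formula_over B s = (\<lambda>(\<phi>, b). b \<in> tuples B \<and>
     scoped \<phi> (fst s + length (fst b), snd s + length (snd b)))"

definition realizes ::
  "('g, 'v) lstr \<Rightarrow> nat \<times> nat \<Rightarrow> (form \<times> ('g, 'v) tuple) set \<Rightarrow> ('g, 'v) tuple \<Rightarrow> bool" where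
  "realizes N s p x \<longleftrightarrow> x \<in> tuples (carriers N) \<and> shape x = s \<and> (\<forall>(\<phi>, b)\<in>p. sat N \<phi> (x \<frown> b))"

definition aleph1_saturated :: "('g, 'v) lstr \<Rightarrow> bool" where
  "aleph1_saturated N \<longleftrightarrow>
     (\<forall>B s p. fst B \<subseteq> gam N \<and> snd B \<subseteq> vec N \<and> countable (fst B) \<and> countable (snd B) \<and>
        (\<forall>f\<in>p. formula_over B s f) \<and>
        (\<forall>p0. finite p0 \<and> p0 \<subseteq> p \<longrightarrow> (\<exists>x. realizes N s p0 x)) \<longrightarrow>
        (\<exists>x. realizes N s p x))"

text \<open>Indiscernibility over the empty set.\<close>

definition indiscernible :: "('g, 'v) lstr \<Rightarrow> (nat \<Rightarrow> ('g, 'v) tuple) \<Rightarrow> bool" where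
  "indiscernible N c \<longleftrightarrow>
     (\<forall>i. c i \<in> tuples (carriers N)) \<and> (\<forall>i j. shape (c i) = shape (c j)) \<and>
     (\<forall>is js. length is = length js \<and> sorted_wrt (<) is \<and> sorted_wrt (<) js \<longrightarrow>
        same_type N ({}, {}) (tconcat (map c is)) (tconcat (map c js)))"

text \<open>Dividing and forking are computed inside the ambient model \<open>N\<close>. This is the usual notion when
  \<open>N\<close> is aleph-1-saturated and the sets \<open>B\<close> and \<open>C\<close> are countable.
  In \<open>divides\<close>, \<open>s\<close> is the shape of the variables \<open>x\<close> in \<open>\<phi>(x, b)\<close>.\<close>

definition divides ::
  "('g, 'v) lstr \<Rightarrow> 'g set \<times> 'v set \<Rightarrow> nat \<times> nat \<Rightarrow> form \<times> ('g, 'v) tuple \<Rightarrow> bool" where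
  "divides N C s = (\<lambda>(\<phi>, b). \<exists>k. \<exists>b' :: nat \<Rightarrow> ('g, 'v) tuple.
     (\<forall>i. b' i \<in> tuples (carriers N) \<and> same_type N C (b' i) b) \<and>
     (\<forall>K. finite K \<and> card K = k \<longrightarrow> \<not> (\<exists>x. realizes N s ((\<lambda>i. (\<phi>, b' i)) ` K) x)))"

text \<open>\<open>forks N a B C\<close>: the type of \<open>a\<close> over \<open>B\<close> forks over \<open>C\<close>, that is, it implies a finite
  disjunction of formulas each of which divides over \<open>C\<close>.\<close>

definition forks ::
  "('g, 'v) lstr \<Rightarrow> ('g, 'v) tuple \<Rightarrow> 'g set \<times> 'v set \<Rightarrow> 'g set \<times> 'v set \<Rightarrow> bool" where
  "forks N a B C \<longleftrightarrow> (\<exists>F. finite F \<and>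
     (\<forall>f\<in>F. formula_over (carriers N) (shape a) f \<and> divides N C (shape a) f) \<and>
     (\<forall>x\<in>tuples (carriers N). same_type N B x a \<longrightarrow> (\<exists>(\<phi>, c)\<in>F. sat N \<phi> (x \<frown> c))))"

text \<open>Forking-independence over the empty set.\<close>

definition forking_independent ::
  "('g, 'v) lstr \<Rightarrow> ('g, 'v) tuple \<Rightarrow> ('g, 'v) tuple \<Rightarrow> bool" where
  "forking_independent N a b \<longleftrightarrow> \<not> forks N a (entries b) ({}, {})"

end

theory Submission
  imports Defs
begin

text \<open>A tuple \<open>a = (x, u\<^sub>1, u\<^sub>2)\<close> and a tuple \<open>b = (y, w\<^sub>1, w\<^sub>2)\<close> are built from four fixed independent
  vectors by \<open>u\<^sub>1 = e\<^sub>1 - x e\<^sub>0\<close>, \<open>u\<^sub>2 = e\<^sub>3 - x e\<^sub>2\<close>, \<open>w\<^sub>1 = e\<^sub>2 - y e\<^sub>0\<close>, \<open>w\<^sub>2 = e\<^sub>3 - y e\<^sub>1\<close>. Then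
  \<open>(u\<^sub>2 - y u\<^sub>1) - (w\<^sub>2 - x w\<^sub>1) = (y x - x y) e\<^sub>0\<close>. If \<open>E x y\<close> holds, then \<open>x\<close> and \<open>y\<close> commute, and the
  resulting formula \<open>u\<^sub>2 - y u\<^sub>1 = w\<^sub>2 - x w\<^sub>1\<close> divides over the empty set, since two instances
  of it with independent \<open>(w\<^sub>1, w\<^sub>2)\<close> and the same \<open>y\<close> are inconsistent. Otherwise \<open>x\<close> and \<open>y\<close>
  anticommute, the four vectors \<open>u\<^sub>1, u\<^sub>2, w\<^sub>1, w\<^sub>2\<close> are independent, and a realization of \<open>tp(a/b)\<close> that is
  generic over any given parameters shows that the type does not fork. Vertices \<open>x\<^sub>k, y\<^sub>l\<close> spanning
  a half graph give the sequence.

  Types are controlled by a back-and-forth argument: over a basis that is independent over the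
  division ring generated by all vertices, the type of a tuple is determined by the isomorphism
  type of finitely many vertices and by the noncommutative polynomials expressing its vectors.\<close>

section \<open>Evaluation of the free algebra\<close>

text \<open>The four fixed vectors are the corners of a square. The vectors
  \<open>u\<^sub>1\<close>, \<open>u\<^sub>2\<close> measure how far e_1 is from x e_0 and e_3 from
  x e_2; \<open>w\<^sub>1\<close>, \<open>w\<^sub>2\<close> do the same for e_2 and y e_0, and for
  e_3 and y e_1. Each tuple sees one pair of parallel sides; comparing the two ways around the
  square produces the commutator of x and y.

  The obstacle is that no division ring is given that acts on a saturated model: its graph may be
  uncountable, and only terms act. All coefficients are therefore computed in the fixed ring Q_G, on
  a copy of G with vertex set \<open>nat\<close>, and the vertices of the model are named by
  embeddings of that copy. This is consistent because the vanishing of a coefficient depends only on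
  the finite isomorphism type of the vertices in it. Inverses of scalars are not terms, so fractions
  enter only through clearing denominators.

  For non-forking, a generic vertex and generic vectors can be chosen over any k conjugates of the
  parameters at once, whatever their position relative to each other, so dividing is refuted without
  passing to indiscernible sequences.\<close>

lemma rat_embed_Fract:
  assumes "b \<noteq> 0"
  shows "rat_embed (Fract a b) = (of_int a / of_int b :: 'q::{division_ring,ring_char_0})"
proof -
  obtain p q where pq: "quotient_of (Fract a b) = (p, q)" by fastforce
  have q: "q \<noteq> 0" using quotient_of_denom_pos[OF pq] by simp
  have "Fract a b = Fract p q" using quotient_of_div[OF pq] by (simp add: Fract_of_int_quotient)
  then have "a * q = p * b" using assms q by (simp add: eq_rat)
  then have e: "of_int a * of_int q = (of_int p * of_int b :: 'q)" by (metis of_int_mult)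
  have "of_int p / of_int q = (of_int a / of_int b :: 'q)"
  proof -
    have "(of_int p / of_int q :: 'q) * of_int q = of_int p"
      using q by (simp add: divide_inverse mult.assoc)
    moreover have "(of_int a / of_int b :: 'q) * of_int q = of_int p"
    proof -
      have "(of_int a / of_int b :: 'q) * of_int q = of_int a * (inverse (of_int b) * of_int q)"
        by (simp add: divide_inverse mult.assoc)
      also have "inverse (of_int b) * of_int q = (of_int q * inverse (of_int b) :: 'q)"
      proof -
        have "of_int b * (of_int q :: 'q) = of_int q * of_int b" by (rule mult_of_int_commute)
        then show ?thesis using assms by (metis (no_types) inverse_zero mult_zero_left mult_zero_right
              mult.assoc left_inverse right_inverse mult.right_neutral mult_1_left)
      qed
      also have "of_int a * \<dots> = (of_int p :: 'q)" using e assms by (simp flip: mult.assoc) (simp add: mult.assoc)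
      finally show ?thesis .
    qed
    ultimately show ?thesis using q by (metis mult_right_cancel of_int_0_eq_iff)
  qed
  then show ?thesis by (simp add: rat_embed_def pq)
qed

lemma rat_embed_of_int [simp]: "rat_embed (of_int a) = of_int a"
  using rat_embed_Fract[of 1 a] by (simp add: of_int_rat)

lemma rat_embed_0 [simp]: "rat_embed 0 = 0" using rat_embed_of_int[of 0] by simp
lemma rat_embed_1 [simp]: "rat_embed 1 = 1" using rat_embed_of_int[of 1] by simp

lemma commutes_inverse:
  fixes a b :: "'q::division_ring"
  assumes "a * b = b * a"
  shows "a * inverse b = inverse b * a"
proof (cases "b = 0")
  case False
  have "inverse b * (a * b) * inverse b = inverse b * (b * a) * inverse b" using assms by simp
  then show ?thesis using False
    by (metis (no_types) mult.assoc left_inverse right_inverse mult.right_neutral mult_1_left)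
qed simp

lemma rat_embed_commute: "rat_embed q * (x :: 'q::{division_ring,ring_char_0}) = x * rat_embed q"
proof -
  have "inverse (of_int b) * x = x * inverse (of_int b)" for b
    using commutes_inverse[OF mult_of_int_commute[of b x, symmetric]] by simp
  then show ?thesis unfolding rat_embed_def divide_inverse
    by (metis mult.assoc mult_of_int_commute)
qed

lemma rat_embed_mult: "rat_embed (p * q) = (rat_embed p * rat_embed q :: 'q::{division_ring,ring_char_0})"
proof -
  obtain a b where p: "p = Fract a b" "b \<noteq> 0" by (cases p) auto
  obtain c d where q: "q = Fract c d" "d \<noteq> 0" by (cases q) auto
  have i: "inverse (of_int (b * d)) = (inverse (of_int b) * inverse (of_int d) :: 'q)"
    using p q by (metis mult.commute nonzero_inverse_mult_distrib of_int_0_eq_iff of_int_mult)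
  have c: "inverse (of_int b) * of_int c = (of_int c * inverse (of_int b) :: 'q)"
    using commutes_inverse[OF mult_of_int_commute[of b, symmetric]] by metis
  have "rat_embed (p * q) = (of_int a * of_int c * (inverse (of_int b) * inverse (of_int d)) :: 'q)"
    using p q i by (simp only: mult_rat rat_embed_Fract[of "b * d"] mult_eq_0_iff simp_thms divide_inverse of_int_mult)
  also have "\<dots> = of_int a * inverse (of_int b) * (of_int c * inverse (of_int d))"
    by (metis c mult.assoc)
  finally show ?thesis using p q by (simp add: rat_embed_Fract divide_inverse)
qed

lemma rat_embed_add: "rat_embed (p + q) = (rat_embed p + rat_embed q :: 'q::{division_ring,ring_char_0})"
proof -
  obtain a b where p: "p = Fract a b" "b \<noteq> 0" by (cases p) auto
  obtain c d where q: "q = Fract c d" "d \<noteq> 0" by (cases q) auto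
  have "rat_embed (p + q) * of_int (b * d) = (of_int (a * d + c * b) :: 'q)"
  proof -
    have "b * d \<noteq> 0" using p q by simp
    then show ?thesis using p q
      by (simp only: add_rat rat_embed_Fract[of "b * d"] divide_inverse
          mult.assoc left_inverse of_int_eq_0_iff simp_thms mult_1_right)
  qed
  moreover have "rat_embed p * of_int (b * d) = (of_int (a * d) :: 'q)"
  proof -
    have "rat_embed p * of_int b = (of_int a :: 'q)"
      using p by (simp add: rat_embed_Fract divide_inverse mult.assoc)
    then show ?thesis by (metis mult.assoc of_int_mult)
  qed
  moreover have "rat_embed q * of_int (b * d) = (of_int (c * b) :: 'q)"
  proof -
    have "rat_embed q * of_int d = (of_int c :: 'q)"
      using q by (simp add: rat_embed_Fract divide_inverse mult.assoc)
    then show ?thesis by (metis mult.assoc mult.commute of_int_mult)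
  qed
  ultimately have "rat_embed (p + q) * of_int (b * d) = ((rat_embed p + rat_embed q) * of_int (b * d) :: 'q)"
    by (metis distrib_right of_int_add)
  then show ?thesis using p q by (metis mult_right_cancel mult_eq_0_iff of_int_0_eq_iff)
qed

lemma rat_embed_minus_one [simp]: "rat_embed (-1) = -1"
  using rat_embed_of_int[of "-1"] by simp

lemma free_algebra_induct [case_names zero add single]:
  assumes "P 0" "\<And>p q. P p \<Longrightarrow> P q \<Longrightarrow> P (p + q)" "\<And>w c. P (Poly_Mapping.single w c)"
  shows "P (p :: 'a \<Rightarrow>\<^sub>0 'b::comm_monoid_add)"
proof -
  have "P (\<Sum>w\<in>W. Poly_Mapping.single w (Poly_Mapping.lookup p w))" if "finite W" for W
    using that by (induction W) (auto intro: assms)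
  moreover have "p = (\<Sum>w\<in>Poly_Mapping.keys p. Poly_Mapping.single w (Poly_Mapping.lookup p w))"
    by (rule poly_mapping_eqI)
      (auto simp: lookup_sum lookup_single when_def in_keys_iff sum.delta)
  ultimately show ?thesis by (metis finite_keys)
qed

lemma eval_free_superset:
  assumes "finite W" "Poly_Mapping.keys p \<subseteq> W"
  shows "eval_free X p = (\<Sum>w\<in>W. rat_embed (Poly_Mapping.lookup p w) * prod_list (map X (letters w)))"
  unfolding eval_free_def
  by (rule sum.mono_neutral_left) (use assms in \<open>auto simp: in_keys_iff\<close>)

lemma eval_free_0 [simp]: "eval_free X 0 = 0" by (simp add: eval_free_def)

lemma eval_free_add: "eval_free X (p + q) = eval_free X p + eval_free X q"
proof -
  let ?W = "Poly_Mapping.keys p \<union> Poly_Mapping.keys q"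
  have "Poly_Mapping.keys (p + q) \<subseteq> ?W" by (rule keys_add)
  then show ?thesis
    by (simp add: eval_free_superset[of ?W] lookup_add rat_embed_add distrib_right sum.distrib)
qed

lemma eval_free_single:
  "eval_free X (Poly_Mapping.single w c) = rat_embed c * prod_list (map X (letters w))"
  by (cases "c = 0") (simp_all add: eval_free_def)

lemma eval_free_mult: "eval_free X (p * q) = eval_free X p * eval_free X q"
proof (induction p rule: free_algebra_induct)
  case (single w c)
  show ?case
  proof (induction q rule: free_algebra_induct)
    case (single u d)
    have "rat_embed d * prod_list (map X (letters w)) = prod_list (map X (letters w)) * rat_embed d"
      by (rule rat_embed_commute)
    then show ?case
      by (simp add: mult_single eval_free_single rat_embed_mult plus_word_def)
         (metis mult.assoc)
  qed (simp_all add: distrib_left eval_free_add)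
qed (simp_all add: distrib_right eval_free_add)

lemma eval_free_minus: "eval_free X (- p) = - eval_free X p"
  using eval_free_add[of X p "- p"] by (simp add: eq_neg_iff_add_eq_0 add.commute)

lemma eval_free_diff: "eval_free X (p - q) = eval_free X p - eval_free X q"
  using eval_free_add[of X p "- q"] by (simp add: eval_free_minus)

lemma eval_free_gen [simp]: "eval_free X (gen v) = X v"
  by (simp add: gen_def eval_free_single)

text \<open>The universal property of R_A: an assignment of the generators that satisfies the
  defining relations factors through the quotient. It is applied to assignments other than
  \<open>X\<close>, among them ones that send most vertices to 0.\<close>

lemma eval_free_relation_ideal:
  assumes "p \<in> relation_ideal A"
    and "\<And>i i'. i \<in> left A \<Longrightarrow> i' \<in> left A \<Longrightarrow> X i * X i' = X i' * X i"
    and "\<And>j j'. j \<in> right A \<Longrightarrow> j' \<in> right A \<Longrightarrow> X j * X j' = X j' * X j"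
    and "\<And>i j. i \<in> left A \<Longrightarrow> j \<in> right A \<Longrightarrow> edge A i j \<Longrightarrow> X i * X j = X j * X i"
    and "\<And>i j. i \<in> left A \<Longrightarrow> j \<in> right A \<Longrightarrow> \<not> edge A i j \<Longrightarrow> X i * X j = - (X j * X i)"
  shows "eval_free X p = 0"
  using assms(1)
proof induction
  case (comm_left i i')
  then show ?case using assms(2)[of i i'] by (simp add: eval_free_diff eval_free_mult)
next
  case (comm_right j j')
  then show ?case using assms(3)[of j j'] by (simp add: eval_free_diff eval_free_mult)
next
  case (comm_edge i j)
  then show ?case using assms(4)[of i j] by (simp add: eval_free_diff eval_free_mult)
next
  case (anticomm_nonedge i j)
  then show ?case using assms(5)[of i j] by (simp add: eval_free_add eval_free_mult)
qed (simp_all add: eval_free_add eval_free_mult)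

lemma free_algebra_on_0 [simp]: "0 \<in> free_algebra_on S" by (simp add: free_algebra_on_def)

lemma free_algebra_on_add: "p \<in> free_algebra_on S \<Longrightarrow> q \<in> free_algebra_on S \<Longrightarrow> p + q \<in> free_algebra_on S"
  unfolding free_algebra_on_def using keys_add[of p q] by blast

lemma free_algebra_on_single: "set (letters w) \<subseteq> S \<Longrightarrow> Poly_Mapping.single w c \<in> free_algebra_on S"
  by (simp add: free_algebra_on_def)

lemma free_algebra_on_gen: "v \<in> S \<Longrightarrow> gen v \<in> free_algebra_on S"
  by (simp add: gen_def free_algebra_on_single)

lemma free_algebra_on_mult: "p \<in> free_algebra_on S \<Longrightarrow> q \<in> free_algebra_on S \<Longrightarrow> p * q \<in> free_algebra_on S"
  unfolding free_algebra_on_def using keys_mult[of p q] by (fastforce simp: plus_word_def)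

lemma free_algebra_on_uminus: "p \<in> free_algebra_on S \<Longrightarrow> - p \<in> free_algebra_on S"
  by (auto simp: free_algebra_on_def in_keys_iff)

lemma free_algebra_on_diff: "p \<in> free_algebra_on S \<Longrightarrow> q \<in> free_algebra_on S \<Longrightarrow> p - q \<in> free_algebra_on S"
  using free_algebra_on_add[of p S "- q"] free_algebra_on_uminus[of q S] by simp

section \<open>Reversal of words\<close>

text \<open>The hypothesis on Q_A provides right fractions only, whereas relations in a left module
  are multiplied from the left and call for left denominators. Reversal converts one kind into the
  other.\<close>

definition rev_word :: "'a word \<Rightarrow> 'a word" where
  "rev_word w = Word (rev (letters w))"

lemma rev_word_rev_word [simp]: "rev_word (rev_word w) = w"
  by (simp add: rev_word_def)

lemma inj_rev_word: "inj rev_word" by (metis injI rev_word_rev_word)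

definition rev_poly :: "'a free_algebra \<Rightarrow> 'a free_algebra" where
  "rev_poly p = Poly_Mapping.map_key rev_word p"

lemma lookup_rev_poly: "Poly_Mapping.lookup (rev_poly p) w = Poly_Mapping.lookup p (rev_word w)"
  unfolding rev_poly_def by (simp add: map_key.rep_eq[OF inj_rev_word])

lemma rev_poly_rev_poly [simp]: "rev_poly (rev_poly p) = p"
  by (rule poly_mapping_eqI) (simp add: lookup_rev_poly)

lemma rev_poly_0 [simp]: "rev_poly 0 = 0"
  by (rule poly_mapping_eqI) (simp add: lookup_rev_poly)

lemma rev_poly_add: "rev_poly (p + q) = rev_poly p + rev_poly q"
  by (rule poly_mapping_eqI) (simp add: lookup_rev_poly lookup_add)

lemma rev_poly_diff: "rev_poly (p - q) = rev_poly p - rev_poly q"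
  by (rule poly_mapping_eqI) (simp add: lookup_rev_poly lookup_minus)

lemma rev_poly_single: "rev_poly (Poly_Mapping.single w c) = Poly_Mapping.single (rev_word w) c"
  by (rule poly_mapping_eqI) (auto simp: lookup_rev_poly lookup_single when_def)

lemma rev_poly_gen [simp]: "rev_poly (gen v) = gen v"
  by (simp add: gen_def rev_poly_single rev_word_def)

lemma rev_poly_mult: "rev_poly (p * q) = rev_poly q * rev_poly p"
proof (induction p rule: free_algebra_induct)
  case (single w c)
  show ?case
    by (induction q rule: free_algebra_induct)
      (simp_all add: distrib_left distrib_right rev_poly_add rev_poly_single mult_single
        rev_word_def plus_word_def mult.commute)
qed (simp_all add: distrib_left distrib_right rev_poly_add)

lemma rev_poly_free_algebra_on: "p \<in> free_algebra_on S \<Longrightarrow> rev_poly p \<in> free_algebra_on S"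
  unfolding free_algebra_on_def
proof (clarify, goal_cases)
  case (1 w x)
  then have "rev_word w \<in> Poly_Mapping.keys p" by (simp add: in_keys_iff lookup_rev_poly)
  with 1 have "set (letters (rev_word w)) \<subseteq> S" by blast
  with 1 show ?case by (auto simp: rev_word_def)
qed

lemma relation_ideal_uminus: "p \<in> relation_ideal A \<Longrightarrow> - p \<in> relation_ideal A"
proof -
  assume "p \<in> relation_ideal A"
  moreover have "(-1 :: 'a free_algebra) \<in> free_algebra_on (verts A)" "1 \<in> free_algebra_on (verts A)"
    by (auto simp: free_algebra_on_def zero_word_def simp flip: single_one)
  ultimately have "-1 * p * 1 \<in> relation_ideal A" by (rule relation_ideal.mult)
  then show ?thesis by simp
qed

text \<open>Reversal sends a commutator to its negative and an anticommutator to itself, so it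
  induces an anti-automorphism of R_A.\<close>

lemma rev_poly_relation_ideal: "p \<in> relation_ideal A \<Longrightarrow> rev_poly p \<in> relation_ideal A"
proof (induction rule: relation_ideal.induct)
  case (comm_edge i j)
  have "- (gen i * gen j - gen j * gen i) \<in> relation_ideal A"
    by (intro relation_ideal_uminus relation_ideal.comm_edge comm_edge)
  then show ?case by (simp add: rev_poly_diff rev_poly_mult)
next
  case (anticomm_nonedge i j)
  then show ?case using relation_ideal.anticomm_nonedge
    by (simp add: rev_poly_add rev_poly_mult add.commute)
qed (auto simp: rev_poly_diff rev_poly_mult rev_poly_add simp flip: mult.assoc
    intro: relation_ideal.intros rev_poly_free_algebra_on)

section \<open>Partial embeddings of bipartite graphs\<close>

text \<open>\<open>random_bipartite\<close> without countability: the graph of a saturated model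
  satisfies these axioms too, but may be uncountable.\<close>

definition extension_axioms :: "'a bigraph \<Rightarrow> bool" where
  "extension_axioms A \<longleftrightarrow> bipartite A \<and>
     (\<forall>U W. finite U \<and> finite W \<and> U \<subseteq> right A \<and> W \<subseteq> right A \<and> U \<inter> W = {} \<longrightarrow>
        (\<exists>x\<in>left A. (\<forall>u\<in>U. edge A x u) \<and> (\<forall>w\<in>W. \<not> edge A x w))) \<and>
     (\<forall>U W. finite U \<and> finite W \<and> U \<subseteq> left A \<and> W \<subseteq> left A \<and> U \<inter> W = {} \<longrightarrow>
        (\<exists>y\<in>right A. (\<forall>u\<in>U. edge A u y) \<and> (\<forall>w\<in>W. \<not> edge A w y)))"

definition partial_embedding :: "'a bigraph \<Rightarrow> 'b bigraph \<Rightarrow> ('a \<Rightarrow> 'b) \<Rightarrow> 'a set \<Rightarrow> bool" where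
  "partial_embedding A B f F \<longleftrightarrow> F \<subseteq> verts A \<and> inj_on f F \<and>
     (\<forall>x\<in>F. (x \<in> left A \<longleftrightarrow> f x \<in> left B) \<and> (x \<in> right A \<longleftrightarrow> f x \<in> right B)) \<and>
     (\<forall>x\<in>F. \<forall>y\<in>F. edge A x y \<longleftrightarrow> edge B (f x) (f y))"

text \<open>Exchanging the parts turns statements about left vertices into statements about right
  vertices, in spite of the orientation of \<open>edge\<close>.\<close>

definition opposite :: "'a bigraph \<Rightarrow> 'a bigraph" where
  "opposite A = \<lparr>left = right A, right = left A, edge = (\<lambda>x y. edge A y x)\<rparr>"

lemma opposite_simps [simp]:
  "left (opposite A) = right A" "right (opposite A) = left A" "edge (opposite A) x y = edge A y x"
  "verts (opposite A) = verts A"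
  by (auto simp: opposite_def verts_def)

lemma bipartite_opposite [simp]: "bipartite (opposite A) \<longleftrightarrow> bipartite A"
  unfolding bipartite_def by auto

lemma extension_axioms_opposite [simp]: "extension_axioms (opposite A) \<longleftrightarrow> extension_axioms A"
  unfolding extension_axioms_def by auto

lemma partial_embedding_opposite [simp]:
  "partial_embedding (opposite A) (opposite B) f F \<longleftrightarrow> partial_embedding A B f F"
  unfolding partial_embedding_def by auto

text \<open>The witness \<open>x\<close> is kept out of \<open>Z\<close> by a right vertex
  \<open>y\<close> that is adjacent to every left vertex of \<open>Z\<close> but not to
  \<open>x\<close>. Such a \<open>y\<close> must not lie in \<open>U\<close>; this is ensured by an
  auxiliary \<open>x0\<close> adjacent to all of \<open>U\<close> but not to \<open>y\<close>. In
  turn \<open>x0\<close> avoids \<open>Z\<close> because it has a neighbour \<open>y0\<close> that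
  no left vertex of \<open>Z\<close> is adjacent to.\<close>

lemma extension_avoiding_left:
  assumes A: "extension_axioms A" and fin: "finite U" "finite W" "finite Z"
    and sub: "U \<subseteq> right A" "W \<subseteq> right A" "U \<inter> W = {}"
  shows "\<exists>x\<in>left A - Z. (\<forall>u\<in>U. edge A x u) \<and> (\<forall>w\<in>W. \<not> edge A x w)"
proof -
  let ?Z = "Z \<inter> left A"
  have L: "\<And>U W. finite U \<Longrightarrow> finite W \<Longrightarrow> U \<subseteq> right A \<Longrightarrow> W \<subseteq> right A \<Longrightarrow> U \<inter> W = {} \<Longrightarrow>
        \<exists>x\<in>left A. (\<forall>u\<in>U. edge A x u) \<and> (\<forall>w\<in>W. \<not> edge A x w)"
    and R: "\<And>U W. finite U \<Longrightarrow> finite W \<Longrightarrow> U \<subseteq> left A \<Longrightarrow> W \<subseteq> left A \<Longrightarrow> U \<inter> W = {} \<Longrightarrow>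
        \<exists>y\<in>right A. (\<forall>u\<in>U. edge A u y) \<and> (\<forall>w\<in>W. \<not> edge A w y)"
    using A unfolding extension_axioms_def by blast+
  obtain y0 where y0: "y0 \<in> right A" "\<forall>z\<in>?Z. \<not> edge A z y0"
    using R[of "{}" ?Z] fin by auto
  obtain x0 where x0: "x0 \<in> left A" "\<forall>u\<in>insert y0 (U \<union> W). edge A x0 u"
    using L[of "insert y0 (U \<union> W)" "{}"] fin sub y0 by auto
  have "x0 \<notin> Z" using x0 y0 by auto
  then obtain y where y: "y \<in> right A" "\<forall>z\<in>?Z. edge A z y" "\<not> edge A x0 y"
    using R[of ?Z "{x0}"] fin x0 by auto
  have "y \<notin> U" using y x0 by auto
  then obtain x where "x \<in> left A" "\<forall>u\<in>U. edge A x u" "\<forall>w\<in>insert y W. \<not> edge A x w"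
    using L[of U "insert y W"] fin sub y by auto
  then show ?thesis using y by (intro bexI[of _ x]) auto
qed

lemma partial_embeddingD:
  assumes "partial_embedding A B f F"
  shows "x \<in> F \<Longrightarrow> x \<in> left A \<longleftrightarrow> f x \<in> left B" "x \<in> F \<Longrightarrow> x \<in> right A \<longleftrightarrow> f x \<in> right B"
    "x \<in> F \<Longrightarrow> y \<in> F \<Longrightarrow> edge A x y \<longleftrightarrow> edge B (f x) (f y)" "x \<in> F \<Longrightarrow> x \<in> verts A"
    "x \<in> F \<Longrightarrow> f x \<in> verts B" "x \<in> F \<Longrightarrow> y \<in> F \<Longrightarrow> f x = f y \<longleftrightarrow> x = y"
  using assms unfolding partial_embedding_def verts_def by (auto dest: inj_onD)

lemma partial_embedding_subset:
  "partial_embedding A B f F \<Longrightarrow> F' \<subseteq> F \<Longrightarrow> partial_embedding A B f F'"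
  unfolding partial_embedding_def by (meson inj_on_subset subset_iff)

lemma partial_embedding_cong:
  assumes "\<And>x. x \<in> F \<Longrightarrow> f x = g x" "partial_embedding A B f F"
  shows "partial_embedding A B g F"
  using assms(2) inj_on_cong[of F f g] unfolding partial_embedding_def by (simp add: assms(1))

lemma partial_embedding_compose:
  assumes "partial_embedding A B f F" "partial_embedding B C g (f ` F)"
  shows "partial_embedding A C (g \<circ> f) F"
  using assms unfolding partial_embedding_def by (auto intro: comp_inj_on)

lemma partial_embedding_inverse:
  assumes "partial_embedding A B f F"
  shows "partial_embedding B A (inv_into F f) (f ` F)"
  using assms unfolding partial_embedding_def verts_def
  by (auto intro: inj_on_inv_into simp: inv_into_f_f)

lemma partial_embedding_factor:
  assumes "partial_embedding A C h T" "partial_embedding B C g S" "j ` T \<subseteq> S"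
    and "\<And>x. x \<in> T \<Longrightarrow> g (j x) = h x"
  shows "partial_embedding A B j T"
proof -
  have "inj_on j T"
    using assms by (intro inj_onI) (metis inj_onD partial_embedding_def)
  moreover have "j x \<in> S" if "x \<in> T" for x using assms that by auto
  moreover note h = partial_embeddingD[OF assms(1)] and g = partial_embeddingD[OF assms(2)]
  ultimately show ?thesis unfolding partial_embedding_def
  proof (intro conjI ballI)
    show "T \<subseteq> verts A" using h by blast
  qed (simp_all add: h g assms(4))
qed

lemma partial_embedding_extend_left:
  assumes f: "partial_embedding A B f F" and fin: "finite F"
    and A: "bipartite A" and B: "extension_axioms B" and x: "x \<in> left A" "x \<notin> F"
  shows "\<exists>b. partial_embedding A B (f(x := b)) (insert x F)"
proof -
  have bB: "bipartite B" using B by (simp add: extension_axioms_def)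
  let ?U = "f ` {u \<in> F \<inter> right A. edge A x u}" and ?W = "f ` {u \<in> F \<inter> right A. \<not> edge A x u}"
  have inj: "inj_on f F" using f by (simp add: partial_embedding_def)
  have "?U \<inter> ?W = {}" using inj by (auto simp: inj_on_def)
  moreover have "?U \<subseteq> right B" "?W \<subseteq> right B" using f by (auto simp: partial_embedding_def)
  ultimately obtain b where b: "b \<in> left B" "b \<notin> f ` F" "\<forall>u\<in>?U. edge B b u" "\<forall>w\<in>?W. \<not> edge B b w"
    using extension_avoiding_left[OF B, of ?U ?W "f ` F"] fin by auto
  have e1: "edge A x y \<longleftrightarrow> edge B b (f y)" if "y \<in> F" for y
  proof (cases "y \<in> right A")
    case True then show ?thesis using b that by auto
  next
    case False
    then have "f y \<notin> right B" using f that by (auto simp: partial_embedding_def)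
    then show ?thesis using False A bB by (auto simp: bipartite_def)
  qed
  have e2: "\<not> edge A y x" "\<not> edge B z b" for y z
    using A bB x b by (auto simp: bipartite_def)
  have "partial_embedding A B (f(x := b)) (insert x F)"
    unfolding partial_embedding_def
  proof (intro conjI ballI)
    show "insert x F \<subseteq> verts A" using f x by (auto simp: partial_embedding_def verts_def)
    show "inj_on (f(x := b)) (insert x F)" using inj b x by (auto simp: inj_on_def)
  next
    fix y assume "y \<in> insert x F"
    then show "(y \<in> left A) = ((f(x := b)) y \<in> left B)" "(y \<in> right A) = ((f(x := b)) y \<in> right B)"
      using f x b A bB by (auto simp: partial_embedding_def bipartite_def)
  next
    fix y z assume "y \<in> insert x F" "z \<in> insert x F"
    then show "edge A y z = edge B ((f(x := b)) y) ((f(x := b)) z)"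
      using e1 e2 f x by (auto simp: partial_embedding_def)
  qed
  then show ?thesis ..
qed

lemma partial_embedding_extend:
  assumes f: "partial_embedding A B f F" and fin: "finite F"
    and A: "bipartite A" and B: "extension_axioms B" and x: "x \<in> verts A"
  shows "\<exists>g. partial_embedding A B g (insert x F) \<and> (\<forall>y\<in>F. g y = f y)"
proof (cases "x \<in> F")
  case True
  then show ?thesis using f by (intro exI[of _ f]) (simp add: insert_absorb)
next
  case False
  have "\<exists>b. partial_embedding A B (f(x := b)) (insert x F)"
  proof (cases "x \<in> left A")
    case True
    show ?thesis by (rule partial_embedding_extend_left[OF f fin A B True False])
  next
    case f: False
    then have "x \<in> left (opposite A)" using x by (auto simp: verts_def)
    from partial_embedding_extend_left[of "opposite A" "opposite B", OF _ fin _ _ this False]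
    show ?thesis using assms by simp
  qed
  then show ?thesis using False by (metis fun_upd_other)
qed

text \<open>A forth construction with one vertex of \<open>A\<close> per stage. Surjectivity is not
  asked for, so \<open>B\<close> may be uncountable.\<close>

lemma embedding_extend:
  fixes A :: "nat bigraph"
  assumes f: "partial_embedding A B f F" and fin: "finite F"
    and A: "bipartite A" "verts A = UNIV" and B: "extension_axioms B"
  shows "\<exists>g. partial_embedding A B g UNIV \<and> (\<forall>y\<in>F. g y = f y)"
proof -
  have "\<exists>h. \<forall>n. (partial_embedding A B (h n) (F \<union> {..<n}) \<and> (n = 0 \<longrightarrow> h n = f)) \<and>
          (\<forall>x\<in>F \<union> {..<n}. h (Suc n) x = h n x)"
  proof (rule dependent_nat_choice)
    show "\<exists>h. partial_embedding A B h (F \<union> {..<0}) \<and> (0 = (0::nat) \<longrightarrow> h = f)" using f by auto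
  next
    fix h n assume h: "partial_embedding A B h (F \<union> {..<n}) \<and> (n = 0 \<longrightarrow> h = f)"
    have "F \<union> {..<Suc n} = insert n (F \<union> {..<n})" by (auto simp: lessThan_Suc)
    then show "\<exists>h'. (partial_embedding A B h' (F \<union> {..<Suc n}) \<and> (Suc n = 0 \<longrightarrow> h' = f)) \<and>
        (\<forall>x\<in>F \<union> {..<n}. h' x = h x)"
      using partial_embedding_extend[of A B h "F \<union> {..<n}" n] h fin A B by auto
  qed
  then obtain h where h0: "h 0 = f" and h: "\<And>n. partial_embedding A B (h n) (F \<union> {..<n})"
    and hS: "\<And>n x. x \<in> F \<union> {..<n} \<Longrightarrow> h (Suc n) x = h n x" by metis
  have hm: "h (m + k) x = h m x" if "x \<in> F \<union> {..<m}" for m k x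
    using that by (induction k) (auto simp: hS)
  \<comment> \<open>At stage \<open>Suc x\<close> the vertex \<open>x\<close> is certain to be in
    the domain, and later stages keep its value.\<close>
  define g where "g x = h (Suc x) x" for x
  have F: "g x = f x" if "x \<in> F" for x
    using hm[of x 0 "Suc x"] that h0 by (simp add: g_def)
  have g: "g x = h m x" if "x < m" for x m
    using hm[of x "Suc x" "m - Suc x"] that by (simp add: g_def)
  have part: "partial_embedding A B g {..<m}" for m
    by (rule partial_embedding_cong[of _ "h m"])
      (use g partial_embedding_subset[OF h] in auto)
  have "partial_embedding A B g UNIV"
  proof -
    have "(x \<in> left A \<longleftrightarrow> g x \<in> left B) \<and> (x \<in> right A \<longleftrightarrow> g x \<in> right B) \<and>
        (edge A x y \<longleftrightarrow> edge B (g x) (g y)) \<and> (g x = g y \<longrightarrow> x = y)" for x y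
    proof -
      have "x \<in> {..<Suc (max x y)}" "y \<in> {..<Suc (max x y)}" by auto
      then show ?thesis using part[of "Suc (max x y)"]
        unfolding partial_embedding_def inj_on_def by blast
    qed
    then show ?thesis using A unfolding partial_embedding_def inj_on_def by blast
  qed
  then show ?thesis using F by blast
qed

text \<open>The inverse of \<open>f\<close> on \<open>S\<close> is extended to \<open>x\<close> as a
  map from \<open>B\<close> to \<open>A\<close>, which uses that \<open>A\<close> is generic as
  well. Inverting once more gives a finite map from \<open>A\<close> to \<open>B\<close> with
  \<open>x\<close> in its range, and this extends to all of \<open>A\<close>.\<close>

lemma embedding_reach:
  fixes A :: "nat bigraph"
  assumes f: "partial_embedding A B f UNIV" and fin: "finite S"
    and A: "extension_axioms A" "verts A = UNIV" and B: "extension_axioms B" and x: "x \<in> verts B"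
  shows "\<exists>g j. partial_embedding A B g UNIV \<and> (\<forall>y\<in>S. g y = f y) \<and> g j = x"
proof (cases "x \<in> f ` S")
  case True
  then show ?thesis using f by auto
next
  case False
  have S: "partial_embedding A B f S" using f partial_embedding_subset by blast
  have bi: "bipartite A" "bipartite B" using A B by (auto simp: extension_axioms_def)
  obtain k where k: "partial_embedding B A k (insert x (f ` S))" "\<forall>y\<in>f ` S. k y = inv_into S f y"
    using partial_embedding_extend[OF partial_embedding_inverse[OF S] _ bi(2) A(1) x] fin by blast
  let ?T = "insert x (f ` S)"
  have inj: "inj_on k ?T" using k(1) unfolding partial_embedding_def by blast
  have "inj_on f S" using S by (simp add: partial_embedding_def)
  then have kf: "k (f y) = y" if "y \<in> S" for y using k that by (simp add: inv_into_f_f)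
  obtain g where g: "partial_embedding A B g UNIV" "\<forall>y\<in>k ` ?T. g y = inv_into ?T k y"
    using embedding_extend[OF partial_embedding_inverse[OF k(1)] _ bi(1) A(2) B] fin by auto
  have gk: "g (k y) = y" if "y \<in> ?T" for y
  proof -
    have "k y \<in> k ` ?T" using that by blast
    then show ?thesis using g(2) inv_into_f_f[OF inj that] by metis
  qed
  have "g y = f y" if "y \<in> S" for y using gk[of "f y"] kf[OF that] that by simp
  then show ?thesis using g gk[of x] by blast
qed

lemma embedding_absorb:
  fixes A :: "nat bigraph"
  assumes f: "partial_embedding A B f UNIV" and S: "finite S" and T: "finite T"
    and A: "extension_axioms A" "verts A = UNIV" and B: "extension_axioms B"
    and h: "\<And>i. i \<in> T \<Longrightarrow> h i \<in> verts B"
  shows "\<exists>g j. partial_embedding A B g UNIV \<and> (\<forall>y\<in>S. g y = f y) \<and> (\<forall>i\<in>T. g (j i) = h i)"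
  using T h
proof (induction T)
  case empty
  then show ?case using f by auto
next
  case (insert t T)
  then obtain g j where g: "partial_embedding A B g UNIV" "\<forall>y\<in>S. g y = f y" "\<forall>i\<in>T. g (j i) = h i"
    by auto
  obtain g' k where g': "partial_embedding A B g' UNIV" "\<forall>y\<in>S \<union> j ` T. g' y = g y" "g' k = h t"
    using embedding_reach[OF g(1) _ A B, of "S \<union> j ` T" "h t"] S insert by auto
  have "\<forall>i\<in>insert t T. g' ((j(t := k)) i) = h i" using g' g insert.hyps by auto
  then show ?case using g g' by (metis UnI1)
qed

section \<open>Graphs on the natural numbers\<close>

definition pullback :: "('b \<Rightarrow> 'a) \<Rightarrow> 'a bigraph \<Rightarrow> 'b bigraph" where
  "pullback \<gamma> A = \<lparr>left = {i. \<gamma> i \<in> left A}, right = {i. \<gamma> i \<in> right A},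
     edge = (\<lambda>i j. edge A (\<gamma> i) (\<gamma> j))\<rparr>"

lemma pullback_embedding:
  assumes "bij_betw \<gamma> UNIV (verts A)"
  shows "verts (pullback \<gamma> A) = UNIV" "partial_embedding (pullback \<gamma> A) A \<gamma> UNIV"
  using assms unfolding partial_embedding_def bij_betw_def pullback_def verts_def by auto

lemma pullback_extension_axioms:
  assumes \<gamma>: "bij_betw \<gamma> UNIV (verts A)" and A: "extension_axioms A"
  shows "extension_axioms (pullback \<gamma> A)"
proof -
  have left: "\<exists>x\<in>left (pullback \<gamma> B). (\<forall>u\<in>U. edge (pullback \<gamma> B) x u) \<and> (\<forall>w\<in>W. \<not> edge (pullback \<gamma> B) x w)"
    if B: "extension_axioms B" "bij_betw \<gamma> UNIV (verts B)"
      and UW: "finite U" "finite W" "U \<subseteq> right (pullback \<gamma> B)" "W \<subseteq> right (pullback \<gamma> B)" "U \<inter> W = {}"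
    for B U W
  proof -
    have "\<gamma> ` U \<inter> \<gamma> ` W = {}" using UW B by (simp add: bij_betw_def flip: image_Int)
    moreover have "\<gamma> ` U \<subseteq> right B" "\<gamma> ` W \<subseteq> right B" using UW by (auto simp: pullback_def)
    ultimately obtain x where x: "x \<in> left B" "\<forall>u\<in>\<gamma> ` U. edge B x u" "\<forall>u\<in>\<gamma> ` W. \<not> edge B x u"
      using B UW unfolding extension_axioms_def by (metis finite_imageI)
    moreover obtain i where "x = \<gamma> i" using x B(2) unfolding bij_betw_def verts_def by blast
    ultimately show ?thesis by (auto simp: pullback_def)
  qed
  have opp: "pullback \<gamma> (opposite A) = opposite (pullback \<gamma> A)"
    by (simp add: pullback_def opposite_def)
  have "bipartite (pullback \<gamma> A)" using A by (auto simp: extension_axioms_def bipartite_def pullback_def)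
  moreover note left[OF A \<gamma>] left[of "opposite A", unfolded opp] A \<gamma>
  ultimately show ?thesis unfolding extension_axioms_def[of "pullback \<gamma> A"] by auto
qed

lemma extension_axioms_infinite:
  assumes A: "extension_axioms A"
  shows "infinite (verts A)"
proof
  assume "finite (verts A)"
  then show False using extension_avoiding_left[OF A, of "{}" "{}" "verts A"] by (auto simp: verts_def)
qed

lemma random_bipartite_enumeration:
  assumes "random_bipartite A"
  obtains \<gamma> :: "nat \<Rightarrow> 'a" where "bij_betw \<gamma> UNIV (verts A)" "extension_axioms A"
proof -
  have A: "extension_axioms A" "countable (verts A)"
    using assms by (auto simp: random_bipartite_def extension_axioms_def)
  then have "bij_betw (from_nat_into (verts A)) UNIV (verts A)"
    by (intro bij_betw_from_nat_into extension_axioms_infinite)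
  then show thesis using that A by blast
qed

text \<open>Vertex \<open>2 * k\<close> is x_k and vertex \<open>2 * l + 1\<close> is y_l, so the
  edge condition between them reads k < l.\<close>

definition half_graph :: "nat bigraph" where
  "half_graph = \<lparr>left = {n. even n}, right = {n. odd n},
     edge = (\<lambda>m n. even m \<and> odd n \<and> m div 2 < n div 2)\<rparr>"

lemma half_graph: "bipartite half_graph" "verts half_graph = UNIV"
  by (auto simp: half_graph_def bipartite_def verts_def)

section \<open>Terms, coefficients and formulas\<close>

text \<open>\<open>tval\<close> with the finite tuple replaced by two total assignments: variables
  need no bound, and substitution becomes composition.\<close>

primrec tv :: "('g, 'v) lstr \<Rightarrow> trm \<Rightarrow> (nat \<Rightarrow> 'g) \<Rightarrow> (nat \<Rightarrow> 'v) \<Rightarrow> 'v" where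
  "tv N (Var k) a v = v k"
| "tv N (Plus t u) a v = plusV N (tv N t a v) (tv N u a v)"
| "tv N (Scale q t) a v = ratV N q (tv N t a v)"
| "tv N (Act k t) a v = actV N (a k) (tv N t a v)"

primrec gset :: "trm \<Rightarrow> nat set" where
  "gset (Var k) = {}"
| "gset (Plus t u) = gset t \<union> gset u"
| "gset (Scale q t) = gset t"
| "gset (Act k t) = insert k (gset t)"

primrec vset :: "trm \<Rightarrow> nat set" where
  "vset (Var k) = {k}"
| "vset (Plus t u) = vset t \<union> vset u"
| "vset (Scale q t) = vset t"
| "vset (Act k t) = vset t"

primrec tsub :: "(nat \<Rightarrow> trm) \<Rightarrow> trm \<Rightarrow> trm" where
  "tsub \<sigma> (Var k) = \<sigma> k"
| "tsub \<sigma> (Plus t u) = Plus (tsub \<sigma> t) (tsub \<sigma> u)"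
| "tsub \<sigma> (Scale q t) = Scale q (tsub \<sigma> t)"
| "tsub \<sigma> (Act k t) = Act k (tsub \<sigma> t)"

primrec tren :: "(nat \<Rightarrow> nat) \<Rightarrow> trm \<Rightarrow> trm" where
  "tren j (Var k) = Var k"
| "tren j (Plus t u) = Plus (tren j t) (tren j u)"
| "tren j (Scale q t) = Scale q (tren j t)"
| "tren j (Act k t) = Act (j k) (tren j t)"

text \<open>A term in \<open>v\<^sub>0, v\<^sub>1, \<dots>\<close> is a linear combination of these vectors; \<open>coef Y t k\<close> is the
  coefficient of \<open>v\<^sub>k\<close> when the vertex variable \<open>i\<close> acts by \<open>Y i\<close>.\<close>

primrec coef :: "(nat \<Rightarrow> 'q::{division_ring,ring_char_0}) \<Rightarrow> trm \<Rightarrow> nat \<Rightarrow> 'q" where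
  "coef Y (Var l) k = (if k = l then 1 else 0)"
| "coef Y (Plus t u) k = coef Y t k + coef Y u k"
| "coef Y (Scale q t) k = rat_embed q * coef Y t k"
| "coef Y (Act i t) k = Y i * coef Y t k"

lemma tval_eq_tv: "tval N t e = tv N t ((!) (fst e)) ((!) (snd e))"
  by (induction t) auto

lemma finite_gset [simp]: "finite (gset t)" by (induction t) auto
lemma finite_vset [simp]: "finite (vset t)" by (induction t) auto

lemma vset_nonempty: "vset t \<noteq> {}" by (induction t) auto

lemma scoped_trm_iff: "scoped_trm t s \<longleftrightarrow> gset t \<subseteq> {..<fst s} \<and> vset t \<subseteq> {..<snd s}"
  by (induction t) auto

lemma tv_cong:
  "(\<And>i. i \<in> gset t \<Longrightarrow> a i = b i) \<Longrightarrow> (\<And>k. k \<in> vset t \<Longrightarrow> v k = w k) \<Longrightarrow> tv N t a v = tv N t b w"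
  by (induction t) auto

lemma tv_closed:
  "lstructure N \<Longrightarrow> (\<And>i. i \<in> gset t \<Longrightarrow> a i \<in> gam N) \<Longrightarrow> (\<And>k. k \<in> vset t \<Longrightarrow> v k \<in> vec N) \<Longrightarrow>
    tv N t a v \<in> vec N"
  by (induction t) (auto simp: lstructure_def)

lemma tv_tsub: "tv N (tsub \<sigma> t) a v = tv N t a (\<lambda>k. tv N (\<sigma> k) a v)"
  by (induction t) auto

lemma tv_tren: "tv N (tren j t) a v = tv N t (a \<circ> j) v"
  by (induction t) auto

lemma gset_tsub: "gset (tsub \<sigma> t) = gset t \<union> (\<Union>k\<in>vset t. gset (\<sigma> k))" by (induction t) auto
lemma vset_tsub: "vset (tsub \<sigma> t) = (\<Union>k\<in>vset t. vset (\<sigma> k))" by (induction t) auto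
lemma gset_tren [simp]: "gset (tren j t) = j ` gset t" by (induction t) auto
lemma vset_tren [simp]: "vset (tren j t) = vset t" by (induction t) auto

lemma coef_cong: "(\<And>i. i \<in> gset t \<Longrightarrow> Y i = Z i) \<Longrightarrow> coef Y t k = coef Z t k"
  by (induction t) auto

lemma coef_tren [simp]: "coef Y (tren j t) k = coef (Y \<circ> j) t k"
  by (induction t) auto

lemma coef_eq_0: "k \<notin> vset t \<Longrightarrow> coef Y t k = 0"
  by (induction t) auto

text \<open>Substitution multiplies the row of coefficients of \<open>t\<close> from the right by
  the matrix of coefficients of the \<open>\<sigma> l\<close>.\<close>

lemma coef_tsub:
  "vset t \<subseteq> {..<n} \<Longrightarrow> coef Y (tsub \<sigma> t) k = (\<Sum>l<n. coef Y t l * coef Y (\<sigma> l) k)"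
proof (induction t)
  case (Var l)
  then have "(\<Sum>m<n. coef Y (Var l) m * coef Y (\<sigma> m) k) = (\<Sum>m<n. if m = l then coef Y (\<sigma> l) k else 0)"
    by (intro sum.cong) auto
  then show ?case using Var by simp
qed (simp_all add: distrib_right sum.distrib sum_distrib_left mult.assoc)

text \<open>A lift of \<open>coef\<close> to the free algebra. The vanishing of a coefficient
  becomes membership in the relation ideal, which does not mention the division ring.\<close>

primrec term_poly :: "(nat \<Rightarrow> 'a) \<Rightarrow> trm \<Rightarrow> nat \<Rightarrow> 'a free_algebra" where
  "term_poly \<beta> (Var l) k = (if k = l then 1 else 0)"
| "term_poly \<beta> (Plus t u) k = term_poly \<beta> t k + term_poly \<beta> u k"
| "term_poly \<beta> (Scale q t) k = Poly_Mapping.single (Word []) q * term_poly \<beta> t k"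
| "term_poly \<beta> (Act i t) k = gen (\<beta> i) * term_poly \<beta> t k"

lemma eval_free_1 [simp]: "eval_free X 1 = 1"
  unfolding single_one[symmetric] eval_free_single by (simp add: zero_word_def)

lemma eval_free_term_poly: "eval_free X (term_poly \<beta> t k) = coef (X \<circ> \<beta>) t k"
  by (induction t) (auto simp: eval_free_add eval_free_mult eval_free_single)

lemma free_algebra_on_1 [simp]: "1 \<in> free_algebra_on S"
  unfolding single_one[symmetric] by (rule free_algebra_on_single) (simp add: zero_word_def)

lemma term_poly_free_algebra_on: "\<beta> ` gset t \<subseteq> S \<Longrightarrow> term_poly \<beta> t k \<in> free_algebra_on S"
  by (induction t)
    (auto intro!: free_algebra_on_add free_algebra_on_mult free_algebra_on_gen free_algebra_on_single)

section \<open>Conjunctions, quantifier blocks, transfer and atomic diagrams\<close>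

definition top_form :: form where "top_form = Neg (ExG (Neg (EqG 0 0)))"

text \<open>The base \<open>top_form\<close> is scoped in every context, so conjunctions of
  sentences, even empty ones, are sentences.\<close>

definition conjs :: "form list \<Rightarrow> form" where "conjs fs = foldr Conj fs top_form"

lemma sat_conjs [simp]: "sat N (conjs fs) e \<longleftrightarrow> (\<forall>f\<in>set fs. sat N f e)"
  by (induction fs) (auto simp: conjs_def top_form_def)

lemma scoped_conjs [simp]: "scoped (conjs fs) s \<longleftrightarrow> (\<forall>f\<in>set fs. scoped f s)"
  by (induction fs) (auto simp: conjs_def top_form_def)

lemma scoped_ExGs [simp]: "scoped ((ExG ^^ m) \<phi>) s \<longleftrightarrow> scoped \<phi> (m + fst s, snd s)"
  by (induction m arbitrary: s) auto

lemma scoped_ExVs [simp]: "scoped ((ExV ^^ m) \<phi>) s \<longleftrightarrow> scoped \<phi> (fst s, m + snd s)"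
  by (induction m arbitrary: s) auto

lemma sat_ExGs:
  "sat N ((ExG ^^ m) \<phi>) e \<longleftrightarrow>
    (\<exists>gs. length gs = m \<and> set gs \<subseteq> gam N \<and> sat N \<phi> (gs @ fst e, snd e))"
proof (induction m arbitrary: e)
  case (Suc m)
  show ?case
  proof
    assume "sat N ((ExG ^^ Suc m) \<phi>) e"
    then obtain g gs where "g \<in> gam N" "length gs = m" "set gs \<subseteq> gam N"
      "sat N \<phi> (gs @ g # fst e, snd e)" by (auto simp: Suc.IH)
    \<comment> \<open>Each quantifier prepends its witness, so the witness of the outermost one ends
      the block.\<close>
    then show "\<exists>gs. length gs = Suc m \<and> set gs \<subseteq> gam N \<and> sat N \<phi> (gs @ fst e, snd e)"
      by (intro exI[of _ "gs @ [g]"]) auto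
  next
    assume "\<exists>gs. length gs = Suc m \<and> set gs \<subseteq> gam N \<and> sat N \<phi> (gs @ fst e, snd e)"
    then obtain gs where gs: "length gs = Suc m" "set gs \<subseteq> gam N" "sat N \<phi> (gs @ fst e, snd e)"
      by blast
    then obtain hs g where "gs = hs @ [g]" by (metis length_Suc_conv_rev)
    with gs show "sat N ((ExG ^^ Suc m) \<phi>) e"
      by (auto simp: Suc.IH intro!: bexI[of _ g] exI[of _ hs])
  qed
qed simp

lemma sat_ExVs:
  "sat N ((ExV ^^ m) \<phi>) e \<longleftrightarrow>
    (\<exists>vs. length vs = m \<and> set vs \<subseteq> vec N \<and> sat N \<phi> (fst e, vs @ snd e))"
proof (induction m arbitrary: e)
  case (Suc m)
  show ?case
  proof
    assume "sat N ((ExV ^^ Suc m) \<phi>) e"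
    then obtain g gs where "g \<in> vec N" "length gs = m" "set gs \<subseteq> vec N"
      "sat N \<phi> (fst e, gs @ g # snd e)" by (auto simp: Suc.IH)
    then show "\<exists>gs. length gs = Suc m \<and> set gs \<subseteq> vec N \<and> sat N \<phi> (fst e, gs @ snd e)"
      by (intro exI[of _ "gs @ [g]"]) auto
  next
    assume "\<exists>gs. length gs = Suc m \<and> set gs \<subseteq> vec N \<and> sat N \<phi> (fst e, gs @ snd e)"
    then obtain gs where gs: "length gs = Suc m" "set gs \<subseteq> vec N" "sat N \<phi> (fst e, gs @ snd e)"
      by blast
    then obtain hs g where "gs = hs @ [g]" by (metis length_Suc_conv_rev)
    with gs show "sat N ((ExV ^^ Suc m) \<phi>) e"
      by (auto simp: Suc.IH intro!: bexI[of _ g] exI[of _ hs])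
  qed
qed simp

lemma transfer:
  assumes "is_model N (complete_theory M)" "scoped \<phi> (m, n)"
    and "\<And>gs vs. length gs = m \<Longrightarrow> set gs \<subseteq> gam M \<Longrightarrow> length vs = n \<Longrightarrow> set vs \<subseteq> vec M \<Longrightarrow>
      sat M \<phi> (gs, vs)"
    and "length gs = m" "set gs \<subseteq> gam N" "length vs = n" "set vs \<subseteq> vec N"
  shows "sat N \<phi> (gs, vs)"
proof -
  let ?\<sigma> = "Neg ((ExG ^^ m) ((ExV ^^ n) (Neg \<phi>)))"
  have "?\<sigma> \<in> complete_theory M"
    using assms(2,3) by (auto simp: complete_theory_def sat_ExGs sat_ExVs)
  then have "sat N ?\<sigma> ([], [])" using assms(1) unfolding is_model_def by blast
  then show ?thesis using assms(4-) by (auto simp: sat_ExGs sat_ExVs)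
qed

text \<open>Edges are cut down to the carrier because the relations of an \<open>lstr\<close> are
  unconstrained outside of it.\<close>

definition graph_of :: "('g, 'v) lstr \<Rightarrow> 'g bigraph" where
  "graph_of N = \<lparr>left = {g\<in>gam N. predI N g}, right = {g\<in>gam N. predJ N g},
     edge = (\<lambda>x y. x \<in> gam N \<and> y \<in> gam N \<and> relE N x y)\<rparr>"

lemma graph_of_module_structure: "bipartite G \<Longrightarrow> graph_of (module_structure G X scale) = G"
  by (auto simp: graph_of_def module_structure_def verts_def bipartite_def
      intro!: bigraph.equality ext)

text \<open>The atomic diagram of the vertices below \<open>m\<close> in the language of bipartite
  graphs; it makes a finite isomorphism type expressible by one formula.\<close>

definition diagram :: "nat bigraph \<Rightarrow> nat \<Rightarrow> form" where
  "diagram A m = conjs (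
     map (\<lambda>i. if i \<in> left A then InI i else Neg (InI i)) [0..<m] @
     map (\<lambda>i. if i \<in> right A then InJ i else Neg (InJ i)) [0..<m] @
     map (\<lambda>(i, j). if edge A i j then Edge i j else Neg (Edge i j)) (List.product [0..<m] [0..<m]) @
     map (\<lambda>(i, j). if i = j then top_form else Neg (EqG i j)) (List.product [0..<m] [0..<m]))"

lemma scoped_diagram: "m \<le> fst s \<Longrightarrow> scoped (diagram A m) s"
  by (auto simp: diagram_def top_form_def)

lemma sat_diagram:
  assumes "verts A = UNIV" "\<And>i. i < m \<Longrightarrow> fst e ! i \<in> gam N"
  shows "sat N (diagram A m) e \<longleftrightarrow> partial_embedding A (graph_of N) ((!) (fst e)) {..<m}"
proof -
  have top: "sat N top_form e" by (simp add: top_form_def)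
  have "sat N (diagram A m) e \<longleftrightarrow>
     (\<forall>i<m. i \<in> left A \<longleftrightarrow> predI N (fst e ! i)) \<and> (\<forall>i<m. i \<in> right A \<longleftrightarrow> predJ N (fst e ! i)) \<and>
     (\<forall>i<m. \<forall>j<m. edge A i j \<longleftrightarrow> relE N (fst e ! i) (fst e ! j)) \<and>
     (\<forall>i<m. \<forall>j<m. i \<noteq> j \<longrightarrow> fst e ! i \<noteq> fst e ! j)"
    unfolding diagram_def using top
    by (auto simp: ball_Un split: if_splits) (metis atLeastLessThan_iff le0)+
  also have "\<dots> \<longleftrightarrow> partial_embedding A (graph_of N) ((!) (fst e)) {..<m}"
    using assms unfolding partial_embedding_def graph_of_def inj_on_def by auto
  finally show ?thesis .
qed

section \<open>The division ring of fractions\<close>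

context left_module
begin

lemma scale_zero_left [simp]: "scale 0 x = 0"
  using scale_left_distrib[of 0 0 x] by simp

lemma scale_zero_right [simp]: "scale a 0 = 0"
  using scale_right_distrib[of a 0 0] by simp

lemma scale_sum: "scale a (sum f A) = (\<Sum>x\<in>A. scale a (f x))"
  by (induction A rule: infinite_finite_induct) (simp_all add: scale_right_distrib)

lemma scale_minus_left: "scale (- a) x = - scale a x"
  using scale_left_distrib[of "- a" a x] by (simp add: eq_neg_iff_add_eq_0)

end

locale fractions =
  fixes G :: "'a bigraph"
    and X :: "'a \<Rightarrow> 'q::{division_ring,ring_char_0}"
    and \<gamma> :: "nat \<Rightarrow> 'a"
  assumes ext: "extension_axioms G"
    and enum: "bij_betw \<gamma> UNIV (verts G)"
    and frac: "division_ring_of_fractions G X"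
begin

text \<open>Vertex variables of terms are natural numbers. With the graph moved to
  \<open>nat\<close>, the variable \<open>i\<close> is at the same time a vertex of
  \<open>A\<close>, and \<open>coef Y t\<close> gives each term canonical coefficients in
  Q_G.\<close>

definition A :: "nat bigraph" where "A = pullback \<gamma> G"

definition Y :: "nat \<Rightarrow> 'q" where "Y = X \<circ> \<gamma>"

lemma A: "extension_axioms A" "verts A = UNIV" "bipartite A" "partial_embedding A G \<gamma> UNIV"
  unfolding A_def using ext enum
  by (auto simp: pullback_extension_axioms pullback_embedding)
     (use pullback_extension_axioms[OF enum ext] in \<open>simp add: extension_axioms_def\<close>)

lemma bipartite_G: "bipartite G" using ext by (simp add: extension_axioms_def)

lemma eval_free_eq_0_iff:
  "p \<in> free_algebra_on (verts G) \<Longrightarrow> eval_free X p = 0 \<longleftrightarrow> p \<in> relation_ideal G"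
  using frac by (simp add: division_ring_of_fractions_def)

lemma X_relations:
  "i \<in> left G \<Longrightarrow> i' \<in> left G \<Longrightarrow> X i * X i' = X i' * X i"
  "j \<in> right G \<Longrightarrow> j' \<in> right G \<Longrightarrow> X j * X j' = X j' * X j"
  "i \<in> left G \<Longrightarrow> j \<in> right G \<Longrightarrow> edge G i j \<Longrightarrow> X i * X j = X j * X i"
  "i \<in> left G \<Longrightarrow> j \<in> right G \<Longrightarrow> \<not> edge G i j \<Longrightarrow> X i * X j = - (X j * X i)"
proof -
  have 0: "eval_free X p = 0" if "p \<in> relation_ideal G" "p \<in> free_algebra_on (verts G)" for p
    using that eval_free_eq_0_iff by blast
  note r = relation_ideal.comm_left relation_ideal.comm_right relation_ideal.comm_edge
    relation_ideal.anticomm_nonedge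
  have g: "gen v \<in> free_algebra_on (verts G)" if "v \<in> left G \<or> v \<in> right G" for v
    using that by (intro free_algebra_on_gen) (auto simp: verts_def)
  note f = free_algebra_on_add free_algebra_on_diff free_algebra_on_mult g
  show "i \<in> left G \<Longrightarrow> i' \<in> left G \<Longrightarrow> X i * X i' = X i' * X i"
    using 0[OF r(1)[where i = i and i' = i']] by (simp add: f eval_free_diff eval_free_mult)
  show "j \<in> right G \<Longrightarrow> j' \<in> right G \<Longrightarrow> X j * X j' = X j' * X j"
    using 0[OF r(2)[where j = j and j' = j']] by (simp add: f eval_free_diff eval_free_mult)
  show "i \<in> left G \<Longrightarrow> j \<in> right G \<Longrightarrow> edge G i j \<Longrightarrow> X i * X j = X j * X i"
    using 0[OF r(3)[where i = i and j = j]] by (simp add: f eval_free_diff eval_free_mult)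
  show "i \<in> left G \<Longrightarrow> j \<in> right G \<Longrightarrow> \<not> edge G i j \<Longrightarrow> X i * X j = - (X j * X i)"
    using 0[OF r(4)[where i = i and j = j]] by (simp add: f eval_free_add eval_free_mult eq_neg_iff_add_eq_0)
qed

text \<open>The map to the rationals with value 1 at \<open>v\<close> and 0 elsewhere satisfies the
  relations: only anticommutation could fail, and it involves two distinct vertices. Hence
  \<open>gen v\<close> is not in the ideal.\<close>

lemma X_nonzero:
  assumes "v \<in> verts G"
  shows "X v \<noteq> 0"
proof
  assume "X v = 0"
  then have "gen v \<in> relation_ideal G"
    using eval_free_eq_0_iff[OF free_algebra_on_gen[OF assms]] by simp
  then have "eval_free (\<lambda>u. if u = v then 1 else 0 :: rat) (gen v) = 0"
    by (rule eval_free_relation_ideal) (use bipartite_G in \<open>auto simp: bipartite_def\<close>)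
  then show False by simp
qed

lemma Y_nonzero: "Y i \<noteq> 0"
  using X_nonzero enum by (auto simp: Y_def bij_betw_def)

lemma Y_relations:
  "i \<in> left A \<Longrightarrow> j \<in> right A \<Longrightarrow> edge A i j \<Longrightarrow> Y i * Y j = Y j * Y i"
  "i \<in> left A \<Longrightarrow> j \<in> right A \<Longrightarrow> \<not> edge A i j \<Longrightarrow> Y i * Y j = - (Y j * Y i)"
  using X_relations by (auto simp: Y_def A_def pullback_def)

text \<open>Sending the vertices outside of \<open>\<beta> ` S\<close> to \<open>0\<close> respects the defining relations; hence whether
  a coefficient vanishes depends only on the isomorphism type of the vertices in it.\<close>

lemma coef_homogeneous:
  assumes \<beta>: "partial_embedding A G \<beta> S" and \<beta>': "partial_embedding A G \<beta>' S"
    and t: "gset t \<subseteq> S" and 0: "coef (X \<circ> \<beta>) t k = 0"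
  shows "coef (X \<circ> \<beta>') t k = 0"
proof -
  define Z where "Z z = (if z \<in> \<beta> ` S then X (\<beta>' (inv_into S \<beta> z)) else 0)" for z
  note b = partial_embeddingD[OF \<beta>] and b' = partial_embeddingD[OF \<beta>']
  have inj: "inj_on \<beta> S" using \<beta> by (simp add: partial_embedding_def)
  have Z: "Z (\<beta> i) = X (\<beta>' i)" if "i \<in> S" for i using inj that by (simp add: inv_into_f_f Z_def)
  have Z0: "Z z = 0" if "z \<notin> \<beta> ` S" for z using that by (simp add: Z_def)
  have move: "\<beta> i \<in> left G \<Longrightarrow> \<beta>' i \<in> left G" "\<beta> i \<in> right G \<Longrightarrow> \<beta>' i \<in> right G" if "i \<in> S" for i
    using b(1,2)[OF that] b'(1,2)[OF that] by simp_all
  have edge: "edge G (\<beta> i) (\<beta> i') \<longleftrightarrow> edge G (\<beta>' i) (\<beta>' i')" if "i \<in> S" "i' \<in> S" for i i'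
    using b(3)[OF that] b'(3)[OF that] by simp
  let ?p = "term_poly \<beta> t k"
  have "?p \<in> free_algebra_on (verts G)"
    using t b(5) by (intro term_poly_free_algebra_on) auto
  moreover have "eval_free X ?p = 0" using 0 by (simp add: eval_free_term_poly)
  ultimately have "?p \<in> relation_ideal G" using eval_free_eq_0_iff by blast
  then have "eval_free Z ?p = 0"
  proof (rule eval_free_relation_ideal)
    fix i i' assume i: "i \<in> left G" "i' \<in> left G"
    show "Z i * Z i' = Z i' * Z i"
    proof (cases "i \<in> \<beta> ` S \<and> i' \<in> \<beta> ` S")
      case True
      then obtain a a' where a: "i = \<beta> a" "i' = \<beta> a'" "a \<in> S" "a' \<in> S" by blast
      with i show ?thesis by (simp only: Z) (rule X_relations(1); rule move)
    qed (auto simp: Z0)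
  next
    fix i i' assume i: "i \<in> right G" "i' \<in> right G"
    show "Z i * Z i' = Z i' * Z i"
    proof (cases "i \<in> \<beta> ` S \<and> i' \<in> \<beta> ` S")
      case True
      then obtain a a' where a: "i = \<beta> a" "i' = \<beta> a'" "a \<in> S" "a' \<in> S" by blast
      with i show ?thesis by (simp only: Z) (rule X_relations(2); rule move)
    qed (auto simp: Z0)
  next
    fix i i' assume i: "i \<in> left G" "i' \<in> right G" "edge G i i'"
    show "Z i * Z i' = Z i' * Z i"
    proof (cases "i \<in> \<beta> ` S \<and> i' \<in> \<beta> ` S")
      case True
      then obtain a a' where a: "i = \<beta> a" "i' = \<beta> a'" "a \<in> S" "a' \<in> S" by blast
      with i show ?thesis by (simp only: Z edge) (rule X_relations(3); simp add: move)
    qed (auto simp: Z0)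
  next
    fix i i' assume i: "i \<in> left G" "i' \<in> right G" "\<not> edge G i i'"
    show "Z i * Z i' = - (Z i' * Z i)"
    proof (cases "i \<in> \<beta> ` S \<and> i' \<in> \<beta> ` S")
      case True
      then obtain a a' where a: "i = \<beta> a" "i' = \<beta> a'" "a \<in> S" "a' \<in> S" by blast
      with i show ?thesis by (simp only: Z edge) (rule X_relations(4); simp add: move)
    qed (auto simp: Z0)
  qed
  then have "coef (Z \<circ> \<beta>) t k = 0" by (simp only: eval_free_term_poly)
  moreover have "coef (Z \<circ> \<beta>) t k = coef (X \<circ> \<beta>') t k"
    by (rule coef_cong) (use t Z in auto)
  ultimately show ?thesis by simp
qed

lemma coef_homogeneous_A:
  assumes "partial_embedding A A j S" "gset t \<subseteq> S"
  shows "coef (Y \<circ> j) t k = 0 \<longleftrightarrow> coef Y t k = 0"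
proof -
  have \<gamma>: "partial_embedding A G \<gamma> S" using A(4) partial_embedding_subset by blast
  have "partial_embedding A G \<gamma> (j ` S)" using A(4) partial_embedding_subset by blast
  then have "partial_embedding A G (\<gamma> \<circ> j) S" by (rule partial_embedding_compose[OF assms(1)])
  with \<gamma> show ?thesis using coef_homogeneous assms(2) unfolding Y_def comp_assoc by blast
qed

section \<open>Terms with prescribed coefficients and common denominators\<close>

definition P :: "'q set" where "P = eval_free X ` free_algebra_on (verts G)"

lemma P_closed:
  "0 \<in> P" "1 \<in> P" "x \<in> P \<Longrightarrow> y \<in> P \<Longrightarrow> x + y \<in> P" "x \<in> P \<Longrightarrow> y \<in> P \<Longrightarrow> x * y \<in> P" "x \<in> P \<Longrightarrow> - x \<in> P"
proof -
  show "0 \<in> P" unfolding P_def by (metis eval_free_0 free_algebra_on_0 imageI)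
  show "1 \<in> P" unfolding P_def by (metis eval_free_1 free_algebra_on_1 imageI)
  show "x \<in> P \<Longrightarrow> y \<in> P \<Longrightarrow> x + y \<in> P" unfolding P_def
    by (auto simp flip: eval_free_add intro!: imageI free_algebra_on_add)
  show "x \<in> P \<Longrightarrow> y \<in> P \<Longrightarrow> x * y \<in> P" unfolding P_def
    by (auto simp flip: eval_free_mult intro!: imageI free_algebra_on_mult)
  show "x \<in> P \<Longrightarrow> - x \<in> P" unfolding P_def
    by (auto simp flip: eval_free_minus intro!: imageI free_algebra_on_uminus)
qed

lemma word_term:
  assumes "set l \<subseteq> verts G"
  obtains t where "vset t = {m}" "\<And>k. coef Y t k = (if k = m then prod_list (map X l) else 0)"
  using assms
proof (induction l arbitrary: thesis)
  case Nil
  show ?case by (rule Nil.prems(1)[of "Var m"]) auto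
next
  case (Cons a l)
  then obtain t where t: "vset t = {m}" "\<And>k. coef Y t k = (if k = m then prod_list (map X l) else 0)"
    by auto
  have "a \<in> range \<gamma>" using Cons.prems(2) enum by (simp add: bij_betw_def)
  then obtain i where "Y i = X a" by (auto simp: Y_def)
  then show ?case by (intro Cons.prems(1)[of "Act i t"]) (auto simp: t)
qed

text \<open>\<open>P\<close> is the image of R_G in Q_G, and its elements act through terms.
  Inverses in general do not, which is why denominators have to be cleared.\<close>

lemma P_term1:
  assumes "x \<in> P"
  obtains t where "vset t = {m}" "\<And>k. coef Y t k = (if k = m then x else 0)"
proof -
  obtain p where p: "p \<in> free_algebra_on (verts G)" "x = eval_free X p"
    using assms by (auto simp: P_def)
  have "\<exists>t. vset t = {m} \<and> (\<forall>k. coef Y t k = (if k = m then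
      (\<Sum>w\<in>W. rat_embed (Poly_Mapping.lookup p w) * prod_list (map X (letters w))) else 0))"
    if "finite W" "W \<subseteq> Poly_Mapping.keys p" for W
    using that
  proof (induction W)
    case empty
    show ?case by (rule exI[of _ "Scale 0 (Var m)"]) auto
  next
    case (insert w W)
    then obtain t where t: "vset t = {m}" "\<And>k. coef Y t k = (if k = m then
      (\<Sum>w\<in>W. rat_embed (Poly_Mapping.lookup p w) * prod_list (map X (letters w))) else 0)" by auto
    have "set (letters w) \<subseteq> verts G" using p insert by (auto simp: free_algebra_on_def)
    then obtain u where u: "vset u = {m}"
      "\<And>k. coef Y u k = (if k = m then prod_list (map X (letters w)) else 0)"
      using word_term by metis
    show ?case using insert.hyps
      by (intro exI[of _ "Plus (Scale (Poly_Mapping.lookup p w) u) t"]) (auto simp: t u)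
  qed
  from this[OF finite_keys subset_refl] show thesis using that p by (auto simp: eval_free_def)
qed

text \<open>The condition \<open>0 < n\<close> reflects that every term contains a vector variable:
  over no variables there is no term, not even one for the zero vector.\<close>

lemma P_term:
  assumes "0 < n" "\<And>k. k < n \<Longrightarrow> x k \<in> P"
  obtains t where "vset t \<subseteq> {..<n}" "\<And>k. coef Y t k = (if k < n then x k else 0)"
  using assms
proof (induction n arbitrary: thesis)
  case 0 then show ?case by simp
next
  case (Suc n)
  obtain u where u: "vset u = {n}" "\<And>k. coef Y u k = (if k = n then x n else 0)"
    using P_term1[of "x n" n] Suc.prems(3) by auto
  show ?case
  proof (cases "n = 0")
    case True
    then show ?thesis using u by (intro Suc.prems(1)[of u]) auto
  next
    case False
    then obtain t where "vset t \<subseteq> {..<n}" "\<And>k. coef Y t k = (if k < n then x k else 0)"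
      using Suc.IH Suc.prems(3) by (metis less_SucI neq0_conv)
    then show ?thesis using u by (intro Suc.prems(1)[of "Plus t u"]) auto
  qed
qed

lemma right_denominator:
  obtains s where "s \<in> P" "s \<noteq> 0" "x * s \<in> P"
proof -
  obtain r s where "r \<in> free_algebra_on (verts G)" "s \<in> free_algebra_on (verts G)"
    "eval_free X s \<noteq> 0" "x = eval_free X r * inverse (eval_free X s)"
    using frac unfolding division_ring_of_fractions_def by blast
  then show thesis using that[of "eval_free X s"] by (auto simp: P_def mult.assoc)
qed

text \<open>Reversing words is an anti-automorphism of \<open>R\<^sub>G\<close>, so left fractions exist as well.\<close>

lemma left_denominator:
  obtains s where "s \<in> P" "s \<noteq> 0" "s * x \<in> P"
proof (cases "x = 0")
  case True
  then show thesis using that[of 1] P_closed by simp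
next
  case False
  obtain a b where ab: "a \<in> free_algebra_on (verts G)" "b \<in> free_algebra_on (verts G)"
    "eval_free X b \<noteq> 0" "x = eval_free X a * inverse (eval_free X b)"
    using frac unfolding division_ring_of_fractions_def by blast
  have rev0: "eval_free X (rev_poly p) = 0 \<longleftrightarrow> eval_free X p = 0" if "p \<in> free_algebra_on (verts G)" for p
    using that rev_poly_relation_ideal[of p G] rev_poly_relation_ideal[of "rev_poly p" G]
      rev_poly_free_algebra_on[OF that] eval_free_eq_0_iff by auto
  \<comment> \<open>A left fraction of the reversed elements is written as a right fraction.
    Cross-multiplied, this is an identity in R_G, and reversing that identity yields a left
    denominator of \<open>x\<close>.\<close>
  let ?y = "inverse (eval_free X (rev_poly b)) * eval_free X (rev_poly a)"
  have b0: "eval_free X (rev_poly b) \<noteq> 0" using rev0 ab by simp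
  obtain s r where sr: "s \<in> free_algebra_on (verts G)" "r \<in> free_algebra_on (verts G)"
    "eval_free X s \<noteq> 0" "?y * eval_free X s = eval_free X r"
    using right_denominator[of ?y] unfolding P_def by blast
  have "eval_free X (rev_poly a) * eval_free X s = eval_free X (rev_poly b) * (?y * eval_free X s)"
    using b0 by (simp flip: mult.assoc)
  then have "eval_free X (rev_poly a * s - rev_poly b * r) = 0"
    using sr by (simp add: eval_free_diff eval_free_mult)
  moreover have "rev_poly a * s - rev_poly b * r \<in> free_algebra_on (verts G)"
    using ab sr by (intro free_algebra_on_diff free_algebra_on_mult rev_poly_free_algebra_on)
  ultimately have "eval_free X (rev_poly (rev_poly a * s - rev_poly b * r)) = 0"
    using rev0 by blast
  then have "eval_free X (rev_poly s) * eval_free X a = eval_free X (rev_poly r) * eval_free X b"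
    by (simp add: rev_poly_diff rev_poly_mult eval_free_diff eval_free_mult)
  then have "eval_free X (rev_poly s) * x = eval_free X (rev_poly r)"
    using ab by (simp flip: mult.assoc) (simp add: mult.assoc)
  then show thesis using that[of "eval_free X (rev_poly s)"] sr rev0[of s] rev_poly_free_algebra_on
    unfolding P_def by (metis imageI)
qed

lemma right_common_denominator:
  obtains s where "s \<in> P" "s \<noteq> 0" "\<And>k. k < (n::nat) \<Longrightarrow> x k * s \<in> P"
proof (induction n arbitrary: thesis)
  case 0
  then show ?case using P_closed by auto
next
  case (Suc n)
  obtain s where s: "s \<in> P" "s \<noteq> 0" "\<And>k. k < n \<Longrightarrow> x k * s \<in> P" using Suc.IH by blast
  obtain s' where s': "s' \<in> P" "s' \<noteq> 0" "(x n * s) * s' \<in> P" using right_denominator by blast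
  show ?case
  proof (rule Suc.prems[of "s * s'"])
    fix k assume "k < Suc n"
    then show "x k * (s * s') \<in> P"
      using s s' P_closed(4)[of "x k * s" s'] by (cases "k = n") (auto simp: mult.assoc)
  qed (use s s' P_closed in auto)
qed

lemma left_common_denominator:
  obtains s where "s \<in> P" "s \<noteq> 0" "\<And>k. k < (n::nat) \<Longrightarrow> s * x k \<in> P"
proof (induction n arbitrary: thesis)
  case 0
  then show ?case using P_closed by auto
next
  case (Suc n)
  obtain s where s: "s \<in> P" "s \<noteq> 0" "\<And>k. k < n \<Longrightarrow> s * x k \<in> P" using Suc.IH by blast
  obtain s' where s': "s' \<in> P" "s' \<noteq> 0" "s' * (s * x n) \<in> P" using left_denominator by blast
  show ?case
  proof (rule Suc.prems[of "s' * s"])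
    fix k assume "k < Suc n"
    then show "s' * s * x k \<in> P"
      using s s' P_closed(4)[of s' "s * x k"] by (cases "k = n") (auto simp: mult.assoc)
  qed (use s s' P_closed in auto)
qed

end

section \<open>Transfer from the module to its elementary equivalents\<close>

locale model = fractions G X \<gamma> + left_module scale
  for G :: "'a bigraph" and X :: "'a \<Rightarrow> 'q::{division_ring,ring_char_0}" and \<gamma> :: "nat \<Rightarrow> 'a"
    and scale :: "'q \<Rightarrow> 'm::ab_group_add \<Rightarrow> 'm" +
  fixes N :: "('g, 'v) lstr"
  assumes infinite_dim: "\<not> finitely_spanned scale"
    and model: "is_model N (complete_theory (module_structure G X scale))"
    and saturated: "aleph1_saturated N"
begin

abbreviation M :: "('a, 'm) lstr" where "M \<equiv> module_structure G X scale"

lemma M_simps [simp]: "gam M = verts G" "vec M = UNIV" "plusV M = (+)"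
  "ratV M = (\<lambda>q. scale (rat_embed q))" "actV M = (\<lambda>v. scale (X v))" "predI M = (\<lambda>v. v \<in> left G)"
  "predJ M = (\<lambda>v. v \<in> right G)" "relE M = edge G"
  by (simp_all add: module_structure_def)

lemma tv_M: "vset t \<subseteq> {..<n} \<Longrightarrow> tv M t \<beta> v = (\<Sum>k<n. scale (coef (X \<circ> \<beta>) t k) (v k))"
proof (induction t)
  case (Var l)
  have "(\<Sum>k<n. scale (coef (X \<circ> \<beta>) (Var l) k) (v k)) = (\<Sum>k<n. if k = l then v l else 0)"
    by (intro sum.cong) (auto simp: scale_one)
  then show ?case using Var by simp
qed (simp_all add: scale_sum scale_scale scale_left_distrib sum.distrib)

lemma N: "lstructure N" using model by (simp add: is_model_def)

definition B :: "'g bigraph" where "B = graph_of N"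

lemma B_simps: "left B = {g\<in>gam N. predI N g}" "right B = {g\<in>gam N. predJ N g}"
  "edge B x y \<longleftrightarrow> x \<in> gam N \<and> y \<in> gam N \<and> relE N x y"
  by (simp_all add: B_def graph_of_def)

lemma transfer1: "scoped \<phi> (1, 0) \<Longrightarrow> (\<And>g. g \<in> verts G \<Longrightarrow> sat M \<phi> ([g], [])) \<Longrightarrow> g \<in> gam N \<Longrightarrow> sat N \<phi> ([g], [])"
  by (rule transfer[OF model, of \<phi> 1 0]) (auto simp: length_Suc_conv)

lemma transfer2: "scoped \<phi> (2, 0) \<Longrightarrow> (\<And>g h. g \<in> verts G \<Longrightarrow> h \<in> verts G \<Longrightarrow> sat M \<phi> ([g, h], [])) \<Longrightarrow>
    g \<in> gam N \<Longrightarrow> h \<in> gam N \<Longrightarrow> sat N \<phi> ([g, h], [])"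
  by (rule transfer[OF model, of \<phi> 2 0]) (auto simp: length_Suc_conv numeral_2_eq_2)

lemma N_parts: "g \<in> gam N \<Longrightarrow> predI N g \<longleftrightarrow> \<not> predJ N g"
  using transfer1[of "Neg (Conj (InI 0) (InJ 0))" g] transfer1[of "Neg (Conj (Neg (InI 0)) (Neg (InJ 0)))" g]
    bipartite_G by (auto simp: bipartite_def verts_def)

lemma N_edge: "g \<in> gam N \<Longrightarrow> h \<in> gam N \<Longrightarrow> relE N g h \<Longrightarrow> predI N g \<and> predJ N h"
  using transfer2[of "Neg (Conj (Edge 0 1) (Neg (Conj (InI 0) (InJ 1))))" g h] bipartite_G
  by (auto simp: bipartite_def)

lemma verts_B: "verts B = gam N"
  using N_parts by (auto simp: verts_def B_simps)

lemma bipartite_B: "bipartite B"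
  using N_parts N_edge by (auto simp: bipartite_def B_simps)

text \<open>One argument for both extension axioms: \<open>p\<close> is the part of the new vertex,
  \<open>p'\<close> that of the given ones, and \<open>d\<close> the edge between them in its proper
  orientation. The axioms form a scheme with one sentence for each pair of lengths; disjointness
  goes into the premise.\<close>

lemma N_extension:
  assumes I: "(p, p', d) = (InI, InJ, \<lambda>i. Edge 0 i) \<or> (p, p', d) = (InJ, InI, \<lambda>i. Edge i 0)"
    and len: "length us = m" "length ws = n" and sub: "set us \<subseteq> gam N" "set ws \<subseteq> gam N"
    and dis: "set us \<inter> set ws = {}" and p': "\<forall>i<m + n. sat N (p' i) (us @ ws, [])"
  shows "\<exists>g\<in>gam N. sat N (p 0) ([g], []) \<and> (\<forall>i<m. sat N (d (Suc i)) (g # us @ ws, [])) \<and>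
    (\<forall>i<n. \<not> sat N (d (Suc (m + i))) (g # us @ ws, []))"
proof -
  let ?pre = "conjs (map p' [0..<m + n] @
      map (\<lambda>(i, j). Neg (EqG i (m + j))) (List.product [0..<m] [0..<n]))"
  let ?post = "conjs (p 0 # map (\<lambda>i. d (Suc i)) [0..<m] @ map (\<lambda>i. Neg (d (Suc (m + i)))) [0..<n])"
  let ?\<phi> = "Neg (Conj ?pre (Neg (ExG ?post)))"
  have "sat N ?\<phi> (us @ ws, [])"
  proof (rule transfer[OF model, of ?\<phi> "m + n" 0])
    show "scoped ?\<phi> (m + n, 0)" using I by auto
  next
    fix gs :: "'a list" and vs :: "'m list"
    assume gs: "length gs = m + n" "set gs \<subseteq> gam M" and "length vs = 0"
    let ?U = "(!) gs ` {..<m}" and ?W = "(\<lambda>j. gs ! (m + j)) ` {..<n}"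
    show "sat M ?\<phi> (gs, vs)"
      unfolding sat.simps(6,7) not_not
    proof (intro notI, elim conjE)
      assume pre: "sat M ?pre (gs, vs)" and no: "\<not> sat M (ExG ?post) (gs, vs)"
      have "gs ! i \<noteq> gs ! (m + j)" if "i < m" "j < n" for i j
        using bspec[OF pre[unfolded sat_conjs], of "Neg (EqG i (m + j))"] that by force
      then have dis: "?U \<inter> ?W = {}" by auto
      have U: "i < m + n \<Longrightarrow> sat M (p' i) (gs, vs)" for i using pre by (auto simp: ball_Un)
      from I show False
      proof
        assume "(p, p', d) = (InI, InJ, \<lambda>i. Edge 0 i)"
        then have p: "p = InI" "p' = InJ" "d = (\<lambda>i. Edge 0 i)" by auto
        have "?U \<subseteq> right G" "?W \<subseteq> right G" using U by (auto simp: p)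
        then obtain x where "x \<in> left G" "\<forall>u\<in>?U. edge G x u" "\<forall>w\<in>?W. \<not> edge G x w"
          using ext dis unfolding extension_axioms_def by (metis finite_imageI finite_lessThan)
        then show False using no by (auto simp: p verts_def)
      next
        assume "(p, p', d) = (InJ, InI, \<lambda>i. Edge i 0)"
        then have p: "p = InJ" "p' = InI" "d = (\<lambda>i. Edge i 0)" by auto
        have "?U \<subseteq> left G" "?W \<subseteq> left G" using U by (auto simp: p)
        then obtain x where "x \<in> right G" "\<forall>u\<in>?U. edge G u x" "\<forall>w\<in>?W. \<not> edge G w x"
          using ext dis unfolding extension_axioms_def by (metis finite_imageI finite_lessThan)
        then show False using no by (auto simp: p verts_def)
      qed
    qed
  qed (use len sub in auto)
  moreover have "sat N ?pre (us @ ws, [])"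
    using p' dis len by (auto simp: nth_append) (metis disjoint_iff nth_mem)
  ultimately have "sat N (ExG ?post) (us @ ws, [])" by simp
  then show ?thesis using I by (auto simp: ball_Un)
qed

lemma B_extension: "extension_axioms B"
  unfolding extension_axioms_def
proof (intro conjI allI impI)
  show "bipartite B" by (rule bipartite_B)
next
  fix U W assume UW: "finite U \<and> finite W \<and> U \<subseteq> right B \<and> W \<subseteq> right B \<and> U \<inter> W = {}"
  then obtain us ws where l: "U = set us" "W = set ws" by (metis finite_list)
  have "(us @ ws) ! i \<in> right B" if "i < length us + length ws" for i
    using nth_mem[of i "us @ ws"] that UW unfolding l by auto
  then have "\<forall>i<length us + length ws. sat N (InJ i) (us @ ws, [])" by (simp add: B_simps)
  then obtain g where "g \<in> gam N" "predI N g" "\<forall>i<length us. relE N g (us ! i)"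
     "\<forall>i<length ws. \<not> relE N g (ws ! i)"
    using N_extension[of InI InJ "\<lambda>i. Edge 0 i" us "length us" ws "length ws"] UW
    unfolding l by (auto simp: nth_append B_simps)
  then show "\<exists>x\<in>left B. (\<forall>u\<in>U. edge B x u) \<and> (\<forall>w\<in>W. \<not> edge B x w)"
    using UW unfolding l by (intro bexI[of _ g]) (auto simp: B_simps in_set_conv_nth)
next
  fix U W assume UW: "finite U \<and> finite W \<and> U \<subseteq> left B \<and> W \<subseteq> left B \<and> U \<inter> W = {}"
  then obtain us ws where l: "U = set us" "W = set ws" by (metis finite_list)
  have "(us @ ws) ! i \<in> left B" if "i < length us + length ws" for i
    using nth_mem[of i "us @ ws"] that UW unfolding l by auto
  then have "\<forall>i<length us + length ws. sat N (InI i) (us @ ws, [])" by (simp add: B_simps)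
  then obtain g where "g \<in> gam N" "predJ N g" "\<forall>i<length us. relE N (us ! i) g"
     "\<forall>i<length ws. \<not> relE N (ws ! i) g"
    using N_extension[of InJ InI "\<lambda>i. Edge i 0" us "length us" ws "length ws"] UW
    unfolding l by (auto simp: nth_append B_simps)
  then show "\<exists>x\<in>right B. (\<forall>u\<in>U. edge B u x) \<and> (\<forall>w\<in>W. \<not> edge B w x)"
    using UW unfolding l by (intro bexI[of _ g]) (auto simp: B_simps in_set_conv_nth)
qed

text \<open>An embedding of \<open>A\<close> serves as a frame that names countably many vertices of
  \<open>N\<close>. Every finite partial embedding of \<open>A\<close> into \<open>B\<close> is part
  of one (\<open>emb_extend\<close>).\<close>

definition emb :: "(nat \<Rightarrow> 'g) \<Rightarrow> bool" where "emb \<alpha> \<longleftrightarrow> partial_embedding A B \<alpha> UNIV"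

lemma emb_extend:
  assumes "partial_embedding A B f F" "finite F"
  obtains \<alpha> where "emb \<alpha>" "\<And>i. i \<in> F \<Longrightarrow> \<alpha> i = f i"
  using embedding_extend[OF assms A(3,2) B_extension] unfolding emb_def by blast

lemma emb_in_gam: "emb \<alpha> \<Longrightarrow> \<alpha> i \<in> gam N"
  unfolding emb_def using partial_embeddingD(5) verts_B by fastforce

lemma tval_map:
  assumes "gset t \<subseteq> {..<m}" "vset t \<subseteq> {..<n}"
  shows "tval L t (map \<alpha> [0..<m], map v [0..<n]) = tv L t \<alpha> v"
  unfolding tval_eq_tv by (rule tv_cong) (use assms in auto)

text \<open>Only the first \<open>m\<close> vertices occur in the formula, and their isomorphism
  type is itself a formula; with \<open>diagram A m\<close> as a guard, the statement about
  embeddings becomes first order.\<close>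

lemma transfer_emb:
  assumes "scoped \<phi> (m, n)"
    and "\<And>\<beta> v. partial_embedding A G \<beta> {..<m} \<Longrightarrow> sat M \<phi> (map \<beta> [0..<m], map v [0..<n])"
    and "emb \<alpha>" "\<And>k. k < n \<Longrightarrow> v k \<in> vec N"
  shows "sat N \<phi> (map \<alpha> [0..<m], map v [0..<n])"
proof -
  let ?\<phi> = "Neg (Conj (diagram A m) (Neg \<phi>))"
  have "sat N ?\<phi> (map \<alpha> [0..<m], map v [0..<n])"
  proof (rule transfer[OF model, of ?\<phi> m n])
    show "scoped ?\<phi> (m, n)" using assms(1) by (simp add: scoped_diagram)
  next
    fix gs :: "'a list" and vs :: "'m list"
    assume gs: "length gs = m" "set gs \<subseteq> gam M" and vs: "length vs = n"
    have d: "sat M (diagram A m) (gs, vs) \<longleftrightarrow> partial_embedding A G ((!) gs) {..<m}"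
      using sat_diagram[OF A(2), of m "(gs, vs)" M] gs
      by (simp add: graph_of_module_structure bipartite_G subset_eq)
    have e: "map ((!) gs) [0..<m] = gs" "map ((!) vs) [0..<n] = vs" using gs vs map_nth by metis+
    show "sat M ?\<phi> (gs, vs)" using assms(2)[of "(!) gs" "(!) vs"] d unfolding e by simp
  qed (use assms(3,4) emb_in_gam in auto)
  moreover have "sat N (diagram A m) (map \<alpha> [0..<m], map v [0..<n])"
  proof -
    have "partial_embedding A B \<alpha> {..<m}"
      using assms(3) partial_embedding_subset unfolding emb_def by blast
    then have "partial_embedding A B ((!) (map \<alpha> [0..<m])) {..<m}"
      by (rule partial_embedding_cong[rotated]) simp
    then show ?thesis
      using sat_diagram[OF A(2), of m "(map \<alpha> [0..<m], map v [0..<n])" N] assms(3) emb_in_gam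
      by (simp add: B_def)
  qed
  ultimately show ?thesis by simp
qed

lemma coef_homogeneous_G:
  assumes "partial_embedding A G \<beta> {..<m}" "gset t \<subseteq> {..<m}"
  shows "coef (X \<circ> \<beta>) t k = 0 \<longleftrightarrow> coef Y t k = 0"
proof -
  have "partial_embedding A G \<gamma> {..<m}" using A(4) partial_embedding_subset by blast
  then show ?thesis using coef_homogeneous assms unfolding Y_def by blast
qed

lemma bound_nat: "finite S \<Longrightarrow> \<exists>m::nat. S \<subseteq> {..<m}"
  by (metis finite_nat_iff_bounded)

text \<open>In \<open>M\<close> a term is a linear combination whose coefficients are evaluated at
  the given vertices, and by homogeneity these agree for two terms as soon as they agree at
  \<open>\<gamma>\<close>. Thus Q_G governs identities in \<open>N\<close> without acting on
  \<open>N\<close>.\<close>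

lemma tv_eqI:
  assumes \<alpha>: "emb \<alpha>" and v: "\<And>k. v k \<in> vec N" and eq: "\<And>k. coef Y t k = coef Y u k"
  shows "tv N t \<alpha> v = tv N u \<alpha> v"
proof -
  obtain m where m: "gset t \<union> gset u \<subseteq> {..<m}" using bound_nat finite_gset by (metis finite_UnI)
  obtain n where n: "vset t \<union> vset u \<subseteq> {..<n}" using bound_nat finite_vset by (metis finite_UnI)
  have "sat N (EqV t u) (map \<alpha> [0..<m], map v [0..<n])"
  proof (rule transfer_emb)
    fix \<beta> :: "nat \<Rightarrow> 'a" and v :: "nat \<Rightarrow> 'm"
    assume \<beta>: "partial_embedding A G \<beta> {..<m}"
    \<comment> \<open>Homogeneity speaks of vanishing only, so it is applied to the difference of
      the two terms.\<close>
    have "coef (X \<circ> \<beta>) t k = coef (X \<circ> \<beta>) u k" for k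
      using coef_homogeneous_G[OF \<beta>, of "Plus t (Scale (-1) u)" k] m eq by simp
    then have "tv M t \<beta> v = tv M u \<beta> v" using n by (simp add: tv_M[of t n] tv_M[of u n])
    then show "sat M (EqV t u) (map \<beta> [0..<m], map v [0..<n])" using m n by (simp add: tval_map)
  qed (use m n \<alpha> v in \<open>auto simp: scoped_trm_iff\<close>)
  then show ?thesis using m n by (simp add: tval_map)
qed

text \<open>A nonzero coefficient stays nonzero at all vertices of the same isomorphism type, so it
  can be cancelled in \<open>M\<close>, and the cancellation law transfers.\<close>

lemma tv_inj:
  assumes \<alpha>: "emb \<alpha>" and v: "\<And>k. v k \<in> vec N" "x \<in> vec N" "y \<in> vec N"
    and t: "coef Y t n \<noteq> 0" "vset t \<subseteq> {..<Suc n}"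
    and eq: "tv N t \<alpha> (v(n := x)) = tv N t \<alpha> (v(n := y))"
  shows "x = y"
proof -
  obtain m where m: "gset t \<subseteq> {..<m}" using bound_nat finite_gset by metis
  \<comment> \<open>The second vector goes into the extra variable \<open>Suc n\<close>, so that one
    formula can speak of both.\<close>
  let ?\<sigma> = "\<lambda>k. if k = n then Var (Suc n) else Var k"
  let ?\<phi> = "Neg (Conj (EqV t (tsub ?\<sigma> t)) (Neg (EqV (Var n) (Var (Suc n)))))"
  let ?w = "v(n := x, Suc n := y)"
  have vs: "gset (tsub ?\<sigma> t) \<subseteq> {..<m}" "vset (tsub ?\<sigma> t) \<subseteq> {..<Suc (Suc n)}"
    "vset t \<subseteq> {..<Suc (Suc n)}"
    using t m by (auto simp: gset_tsub vset_tsub split: if_splits)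
  have "sat N ?\<phi> (map \<alpha> [0..<m], map ?w [0..<Suc (Suc n)])"
  proof (rule transfer_emb)
    show "scoped ?\<phi> (m, Suc (Suc n))" using m vs by (simp add: scoped_trm_iff)
  next
    fix \<beta> :: "nat \<Rightarrow> 'a" and v :: "nat \<Rightarrow> 'm"
    assume \<beta>: "partial_embedding A G \<beta> {..<m}"
    have c: "coef (X \<circ> \<beta>) t n \<noteq> 0" using coef_homogeneous_G[OF \<beta> m] t by simp
    have "v n = v (Suc n)" if e: "tv M t \<beta> v = tv M t \<beta> (\<lambda>k. if k = n then v (Suc n) else v k)"
    proof -
      have "(\<Sum>k<n. scale (coef (X \<circ> \<beta>) t k) (if k = n then v (Suc n) else v k)) =
          (\<Sum>k<n. scale (coef (X \<circ> \<beta>) t k) (v k))" by (intro sum.cong) auto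
      then have "scale (coef (X \<circ> \<beta>) t n) (v n) = scale (coef (X \<circ> \<beta>) t n) (v (Suc n))"
        using e t by (simp add: tv_M[of t "Suc n"])
      then have "scale (inverse (coef (X \<circ> \<beta>) t n) * coef (X \<circ> \<beta>) t n) (v n) =
          scale (inverse (coef (X \<circ> \<beta>) t n) * coef (X \<circ> \<beta>) t n) (v (Suc n))"
        by (simp flip: scale_scale)
      then show ?thesis using c by (simp add: scale_one)
    qed
    moreover have "tv M (tsub ?\<sigma> t) \<beta> v = tv M t \<beta> (\<lambda>k. if k = n then v (Suc n) else v k)"
      unfolding tv_tsub by (rule tv_cong) auto
    ultimately show "sat M ?\<phi> (map \<beta> [0..<m], map v [0..<Suc (Suc n)])"
      using m vs by (simp add: tval_map del: upt_Suc)
  qed (use \<alpha> v in auto)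
  moreover have "tv N t \<alpha> ?w = tv N t \<alpha> (v(n := x))"
    by (rule tv_cong) (use t in auto)
  moreover have "tv N (tsub ?\<sigma> t) \<alpha> ?w = tv N t \<alpha> (v(n := y))"
    unfolding tv_tsub by (rule tv_cong) (use t in auto)
  ultimately show ?thesis using eq m vs by (simp add: tval_map del: upt_Suc)
qed

lemma tv_surj:
  assumes \<alpha>: "emb \<alpha>" and x: "x \<in> vec N" and s: "coef Y s 0 \<noteq> 0" "vset s = {0}"
  shows "\<exists>y\<in>vec N. tv N s \<alpha> (\<lambda>_. y) = x"
proof -
  obtain m where m: "gset s \<subseteq> {..<m}" using bound_nat finite_gset by metis
  let ?\<phi> = "ExV (EqV s (Var 1))"
  have "sat N ?\<phi> (map \<alpha> [0..<m], map (\<lambda>_. x) [0..<1])"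
  proof (rule transfer_emb)
    show "scoped ?\<phi> (m, 1)" using m s by (simp add: scoped_trm_iff)
  next
    fix \<beta> :: "nat \<Rightarrow> 'a" and v :: "nat \<Rightarrow> 'm"
    assume \<beta>: "partial_embedding A G \<beta> {..<m}"
    have c: "coef (X \<circ> \<beta>) s 0 \<noteq> 0" using coef_homogeneous_G[OF \<beta> m] s by simp
    let ?y = "scale (inverse (coef (X \<circ> \<beta>) s 0)) (v 0)"
    have "tval M s (map \<beta> [0..<m], [?y, v 0]) = tv M s \<beta> (\<lambda>_. ?y)"
      unfolding tval_eq_tv by (rule tv_cong) (use m s in auto)
    also have "\<dots> = v 0" using c s by (simp add: tv_M[of s 1] scale_scale scale_one)
    finally show "sat M ?\<phi> (map \<beta> [0..<m], map v [0..<1])" by auto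
  qed (use \<alpha> x in auto)
  then obtain y where "y \<in> vec N" "tval N s (map \<alpha> [0..<m], [y, x]) = x" by auto
  moreover have "tval N s (map \<alpha> [0..<m], [y, x]) = tv N s \<alpha> (\<lambda>_. y)"
    unfolding tval_eq_tv by (rule tv_cong) (use m s in auto)
  ultimately show ?thesis by auto
qed

section \<open>Linear independence over all vertices\<close>

text \<open>The zero vector. The language has no symbol for it, but every vector multiplied by the
  rational 0 gives it (\<open>ratV_0\<close>).\<close>

definition z :: 'v where "z = ratV N 0 (SOME x. x \<in> vec N)"

lemma emb_exists: obtains \<alpha> where "emb \<alpha>"
  using emb_extend[of undefined "{}"] by (auto simp: partial_embedding_def)

lemma some_vec: "(SOME x. x \<in> vec N) \<in> vec N"
  using N by (auto simp: lstructure_def some_in_eq)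

lemma z_vec: "z \<in> vec N"
  using N some_vec by (auto simp: lstructure_def z_def)

lemma ratV_0: "x \<in> vec N \<Longrightarrow> ratV N 0 x = z"
proof -
  assume x: "x \<in> vec N"
  obtain \<alpha> where "emb \<alpha>" by (rule emb_exists)
  then have "tv N (Scale 0 (Var 0)) \<alpha> (\<lambda>k. if k = 0 then x else SOME x. x \<in> vec N) =
      tv N (Scale 0 (Var 1)) \<alpha> (\<lambda>k. if k = 0 then x else SOME x. x \<in> vec N)"
    by (rule tv_eqI) (use x some_vec in auto)
  then show ?thesis by (simp add: z_def)
qed

lemma tv_vec: "emb \<alpha> \<Longrightarrow> (\<And>k. v k \<in> vec N) \<Longrightarrow> tv N t \<alpha> v \<in> vec N"
  by (rule tv_closed[OF N]) (auto simp: emb_in_gam)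

lemma tv_zero:
  assumes "emb \<alpha>" "\<And>k. v k \<in> vec N" "\<And>k. coef Y t k = 0"
  shows "tv N t \<alpha> v = z"
proof -
  have "tv N t \<alpha> v = tv N (Scale 0 (Var 0)) \<alpha> v"
    by (rule tv_eqI) (use assms in auto)
  then show ?thesis using assms by (simp add: ratV_0)
qed

lemma tv_const_z:
  assumes "emb \<alpha>"
  shows "tv N t \<alpha> (\<lambda>_. z) = z"
proof -
  have "coef Y (tsub (\<lambda>_. Scale 0 (Var 0)) t) k = 0" for k
    by (induction t) auto
  from tv_zero[OF assms _ this, of "\<lambda>_. z"] show ?thesis
    unfolding tv_tsub by (simp add: z_vec ratV_0)
qed

text \<open>Linear independence over the division ring generated by all vertices of \<open>N\<close>: every finite
  set of vertices is covered by an embedding of \<open>A\<close>.\<close>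

definition indep :: "nat \<Rightarrow> (nat \<Rightarrow> 'v) \<Rightarrow> bool" where
  "indep n v \<longleftrightarrow> (\<forall>k. v k \<in> vec N) \<and>
    (\<forall>\<alpha> t. emb \<alpha> \<and> vset t \<subseteq> {..<n} \<and> tv N t \<alpha> v = z \<longrightarrow> (\<forall>k. coef Y t k = 0))"

text \<open>This is membership of \<open>x\<close> in the span of the first \<open>n\<close>
  vectors. The relation is not solved for \<open>x\<close>, since the inverse of its coefficient at
  \<open>x\<close> need not come from a term.\<close>

definition dep :: "nat \<Rightarrow> (nat \<Rightarrow> 'v) \<Rightarrow> 'v \<Rightarrow> bool" where
  "dep n v x \<longleftrightarrow> (\<exists>\<alpha> t. emb \<alpha> \<and> vset t \<subseteq> {..<Suc n} \<and> tv N t \<alpha> (v(n := x)) = z \<and> coef Y t n \<noteq> 0)"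

lemma indep_vec: "indep n v \<Longrightarrow> v k \<in> vec N" by (simp add: indep_def)

lemma indepD: "indep n v \<Longrightarrow> emb \<alpha> \<Longrightarrow> vset t \<subseteq> {..<n} \<Longrightarrow> tv N t \<alpha> v = z \<Longrightarrow> coef Y t k = 0"
  by (simp add: indep_def)

lemma indep_0: "(\<And>k. v k \<in> vec N) \<Longrightarrow> indep 0 v"
  using vset_nonempty by (auto simp: indep_def)

lemma indep_cong:
  assumes "indep n v" "\<And>k. k < n \<Longrightarrow> w k = v k" "\<And>k. w k \<in> vec N"
  shows "indep n w"
proof -
  have "tv N t \<alpha> w = tv N t \<alpha> v" if "vset t \<subseteq> {..<n}" for t \<alpha>
    by (rule tv_cong) (use that assms in auto)
  then show ?thesis using assms unfolding indep_def by metis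
qed

lemma indep_eqD:
  assumes v: "indep n v" and \<alpha>: "emb \<alpha>" and t: "vset t \<subseteq> {..<n}" "vset u \<subseteq> {..<n}"
    and eq: "tv N t \<alpha> v = tv N u \<alpha> v"
  shows "coef Y t k = coef Y u k"
proof -
  have "tv N (Plus t (Scale (-1) u)) \<alpha> v = tv N (Plus t (Scale (-1) t)) \<alpha> v" using eq by simp
  also have "\<dots> = z" by (rule tv_zero[OF \<alpha>]) (use v indep_vec in auto)
  finally have "coef Y (Plus t (Scale (-1) u)) k = 0" by (rule indepD[OF v \<alpha>, rotated]) (use t in simp)
  then show ?thesis by simp
qed

lemma indep_extend:
  assumes v: "indep n v" and x: "x \<in> vec N" "\<not> dep n v x"
  shows "indep (Suc n) (v(n := x))"
  unfolding indep_def
proof (intro conjI allI impI; (elim conjE)?)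
  show "(v(n := x)) k \<in> vec N" for k using v x indep_vec by simp
next
  fix \<alpha> t k
  assume \<alpha>: "emb \<alpha>" and t: "vset t \<subseteq> {..<Suc n}" "tv N t \<alpha> (v(n := x)) = z"
  then have tn: "coef Y t n = 0" using x by (auto simp: dep_def)
  show "coef Y t k = 0"
  proof (cases "n = 0")
    case True
    then show ?thesis using t tn coef_eq_0[of k t] by (cases "k = 0") auto
  next
    case False
    \<comment> \<open>As its coefficient vanishes, variable \<open>n\<close> may be replaced by
      zero, written as a multiple of variable 0; that variable is among the first \<open>n\<close>
      because \<open>n\<close> is positive.\<close>
    let ?\<sigma> = "\<lambda>k. if k = n then Scale 0 (Var 0) else Var k"
    have vs: "vset (tsub ?\<sigma> t) \<subseteq> {..<n}" using t False by (auto simp: vset_tsub split: if_splits)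
    have c: "coef Y (tsub ?\<sigma> t) k = coef Y t k" for k
    proof -
      have "coef Y (tsub ?\<sigma> t) k = (\<Sum>l<n. coef Y t l * coef Y (?\<sigma> l) k)"
        unfolding coef_tsub[OF t(1)] by simp
      also have "\<dots> = (\<Sum>l<n. if l = k then coef Y t k else 0)"
        by (intro sum.cong) auto
      finally show ?thesis using tn coef_eq_0[of k t, where Y = Y] subsetD[OF t(1), of k]
        by (cases k n rule: linorder_cases) auto
    qed
    have vx: "(v(n := x)) k \<in> vec N" for k using v x indep_vec by simp
    have "tv N (tsub ?\<sigma> t) \<alpha> v = tv N (tsub ?\<sigma> t) \<alpha> (v(n := x))"
      by (rule tv_cong) (use vs in auto)
    also have "\<dots> = tv N t \<alpha> (v(n := x))" by (rule tv_eqI[OF \<alpha> vx c])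
    finally show ?thesis using indepD[OF v \<alpha> vs, of k] t c by simp
  qed
qed

text \<open>Brings vertices named by two embeddings into one frame. Terms over
  \<open>\<beta>\<close> are renamed along \<open>j\<close>; as \<open>j\<close> is a partial
  embedding, the same coefficients vanish after renaming
  (\<open>coef_homogeneous_A\<close>).\<close>

lemma absorb:
  assumes "emb \<alpha>" "emb \<beta>" "finite S" "finite T"
  obtains \<alpha>' j where "emb \<alpha>'" "\<And>i. i \<in> S \<Longrightarrow> \<alpha>' i = \<alpha> i" "\<And>i. i \<in> T \<Longrightarrow> \<alpha>' (j i) = \<beta> i"
    "partial_embedding A A j T"
proof -
  obtain \<alpha>' j where g: "emb \<alpha>'" "\<forall>i\<in>S. \<alpha>' i = \<alpha> i" "\<forall>i\<in>T. \<alpha>' (j i) = \<beta> i"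
    using embedding_absorb[of A B \<alpha> S T \<beta>] assms A B_extension emb_in_gam verts_B
    unfolding emb_def by metis
  have "partial_embedding A A j T"
    by (rule partial_embedding_factor[of A B \<beta> T A \<alpha>' UNIV])
      (use assms(2) g partial_embedding_subset[OF _ subset_UNIV] in \<open>auto simp: emb_def\<close>)
  then show thesis using that g by blast
qed

text \<open>Substitute the terms \<open>\<tau>\<close> into the relation for \<open>x\<close> over
  \<open>w\<close>. The relation and the terms may use different vertices, so they are first moved
  into a common frame.\<close>

lemma dep_mono:
  assumes \<alpha>: "emb \<alpha>" and v: "\<And>k. v k \<in> vec N" and x: "x \<in> vec N"
    and \<tau>: "\<And>k. k < l \<Longrightarrow> vset (\<tau> k) \<subseteq> {..<n}" "\<And>k. k < l \<Longrightarrow> w k = tv N (\<tau> k) \<alpha> v"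
    and dep: "dep l w x"
  shows "dep n v x"
proof -
  obtain \<beta> t where t: "emb \<beta>" "vset t \<subseteq> {..<Suc l}" "tv N t \<beta> (w(l := x)) = z" "coef Y t l \<noteq> 0"
    using dep unfolding dep_def by blast
  obtain \<alpha>' j where a: "emb \<alpha>'" "\<And>i. i \<in> (\<Union>k<l. gset (\<tau> k)) \<Longrightarrow> \<alpha>' i = \<alpha> i"
    "\<And>i. i \<in> gset t \<Longrightarrow> \<alpha>' (j i) = \<beta> i" "partial_embedding A A j (gset t)"
    using absorb[OF \<alpha> t(1), of "\<Union>k<l. gset (\<tau> k)" "gset t"] by auto
  \<comment> \<open>Position \<open>l\<close>, which holds \<open>x\<close>, is moved to position
    \<open>n\<close>.\<close>
  let ?\<sigma> = "\<lambda>k. if k < l then \<tau> k else Var n"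
  let ?t = "tsub ?\<sigma> (tren j t)"
  have "vset ?t \<subseteq> {..<Suc n}"
    using \<tau> t(2) by (fastforce simp: vset_tsub split: if_splits)
  moreover have "tv N ?t \<alpha>' (v(n := x)) = z"
  proof -
    have "tv N (\<tau> k) \<alpha>' (v(n := x)) = w k" if "k < l" for k
      unfolding \<tau>(2)[OF that] by (rule tv_cong) (use a \<tau> that in force)+
    then have "tv N ?t \<alpha>' (v(n := x)) = tv N t \<beta> (w(l := x))"
      unfolding tv_tsub tv_tren by (intro tv_cong) (use a t in auto)
    then show ?thesis using t by simp
  qed
  moreover have "coef Y ?t n \<noteq> 0"
  proof -
    have "coef Y (\<tau> k) n = 0" if "k < l" for k using \<tau>(1)[OF that] by (intro coef_eq_0) auto
    then have "coef Y ?t n = coef Y (tren j t) l" using t(2) by (subst coef_tsub[of _ "Suc l"]) auto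
    then show ?thesis using coef_homogeneous_A[OF a(4) subset_refl, of l] t by simp
  qed
  ultimately show ?thesis using a(1) unfolding dep_def by blast
qed

lemma dep_mono_var:
  assumes "\<And>k. v k \<in> vec N" "x \<in> vec N" "\<And>k. k < l \<Longrightarrow> \<pi> k < n" "\<And>k. k < l \<Longrightarrow> w k = v (\<pi> k)"
    "dep l w x"
  shows "dep n v x"
proof -
  obtain \<alpha> where "emb \<alpha>" by (rule emb_exists)
  then show ?thesis by (rule dep_mono[where \<tau> = "\<lambda>k. Var (\<pi> k)"]) (use assms in auto)
qed

lemma indep_subfamily:
  assumes v: "indep n v" and \<pi>: "inj_on \<pi> {..<l}" "\<And>k. k < l \<Longrightarrow> \<pi> k < n"
    and w: "\<And>k. k < l \<Longrightarrow> w k = v (\<pi> k)" "\<And>k. w k \<in> vec N"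
  shows "indep l w"
  unfolding indep_def
proof (intro conjI allI impI; (elim conjE)?)
  show "w k \<in> vec N" for k using w by simp
next
  fix \<alpha> t k
  assume \<alpha>: "emb \<alpha>" and t: "vset t \<subseteq> {..<l}" "tv N t \<alpha> w = z"
  let ?t = "tsub (\<lambda>k. Var (\<pi> k)) t"
  have "tv N ?t \<alpha> v = tv N t \<alpha> w" unfolding tv_tsub by (rule tv_cong) (use t w in auto)
  moreover have "vset ?t \<subseteq> {..<n}" using t \<pi> by (auto simp: vset_tsub)
  ultimately have 0: "coef Y ?t (\<pi> k) = 0" using indepD[OF v \<alpha>] t by simp
  show "coef Y t k = 0"
  proof (cases "k < l")
    case True
    have "coef Y ?t (\<pi> k) = (\<Sum>i<l. if i = k then coef Y t k else 0)"
      unfolding coef_tsub[OF t(1)] using \<pi>(1) True by (intro sum.cong) (auto dest: inj_onD)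
    then show ?thesis using 0 True by simp
  next
    case False
    then show ?thesis using t by (intro coef_eq_0) auto
  qed
qed

text \<open>Each \<open>w k\<close> is \<open>v k\<close> divided by the scalar of \<open>s\<close>.
  A relation with coefficients c_k among the \<open>w k\<close> is one with coefficients c_k s^-1
  among the \<open>v k\<close>; a common left denominator brings these into \<open>P\<close>, where
  independence of \<open>v\<close> applies.\<close>

lemma indep_divide:
  assumes v: "indep n v" "0 < n" and \<alpha>: "emb \<alpha>" and s: "vset s = {0}" "coef Y s 0 \<noteq> 0"
    and w: "\<And>k. w k \<in> vec N" "\<And>k. k < n \<Longrightarrow> tv N s \<alpha> (\<lambda>_. w k) = v k"
  shows "indep n w"
  unfolding indep_def
proof (intro conjI allI impI; (elim conjE)?)
  show "w k \<in> vec N" for k using w by simp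
next
  fix \<beta> t k
  assume \<beta>: "emb \<beta>" and t: "vset t \<subseteq> {..<n}" "tv N t \<beta> w = z"
  obtain \<alpha>' j where a: "emb \<alpha>'" "\<And>i. i \<in> gset s \<Longrightarrow> \<alpha>' i = \<alpha> i"
    "\<And>i. i \<in> gset t \<Longrightarrow> \<alpha>' (j i) = \<beta> i" "partial_embedding A A j (gset t)"
    using absorb[OF \<alpha> \<beta>, of "gset s" "gset t"] by auto
  let ?t = "tren j t"
  obtain a where a_P: "a \<in> P" "a \<noteq> 0" "\<And>k. k < n \<Longrightarrow> a * (coef Y ?t k * inverse (coef Y s 0)) \<in> P"
    using left_common_denominator[of n "\<lambda>k. coef Y ?t k * inverse (coef Y s 0)"] by blast
  obtain ta where ta: "vset ta = {0}" "\<And>k. coef Y ta k = (if k = 0 then a else 0)"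
    using P_term1[OF a_P(1), of 0] by blast
  obtain tb where tb: "vset tb \<subseteq> {..<n}"
    "\<And>k. coef Y tb k = (if k < n then a * (coef Y ?t k * inverse (coef Y s 0)) else 0)"
    using P_term[OF v(2), of "\<lambda>k. a * (coef Y ?t k * inverse (coef Y s 0))"] a_P(3) by blast
  have sv: "tv N s \<alpha>' (\<lambda>_. w k) = v k" if "k < n" for k
    unfolding w(2)[OF that, symmetric] by (rule tv_cong) (use a in auto)
  have t': "tv N ?t \<alpha>' w = z"
    unfolding tv_tren t(2)[symmetric] by (rule tv_cong) (use a in auto)
  have "tv N tb \<alpha>' v = tv N (tsub (\<lambda>k. tsub (\<lambda>_. Var k) s) tb) \<alpha>' w"
    unfolding tv_tsub tv.simps by (rule tv_cong) (use sv tb in auto)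
  also have "\<dots> = tv N (tsub (\<lambda>_. ?t) ta) \<alpha>' w"
  proof (rule tv_eqI[OF a(1) w(1)])
    fix k
    have s1: "coef Y (tsub (\<lambda>_. Var l) s) k = (if k = l then coef Y s 0 else 0)" for l
      using s by (subst coef_tsub[of s 1]) auto
    have "coef Y (tsub (\<lambda>k. tsub (\<lambda>_. Var k) s) tb) k =
        (\<Sum>l<n. if l = k then coef Y tb l * coef Y s 0 else 0)"
      unfolding coef_tsub[OF tb(1)] s1 by (intro sum.cong) auto
    also have "\<dots> = a * coef Y ?t k"
      using s t coef_eq_0[of k ?t] by (auto simp: tb mult.assoc)
    also have "\<dots> = coef Y (tsub (\<lambda>_. ?t) ta) k"
      using ta by (subst coef_tsub[of ta 1]) auto
    finally show "coef Y (tsub (\<lambda>k. tsub (\<lambda>_. Var k) s) tb) k = coef Y (tsub (\<lambda>_. ?t) ta) k" .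
  qed
  also have "\<dots> = z" unfolding tv_tsub t' by (rule tv_const_z[OF a(1)])
  finally have b0: "coef Y tb k = 0" using indepD[OF v(1) a(1) tb(1)] by blast
  have "coef Y ?t k = 0"
  proof (cases "k < n")
    case True
    then show ?thesis using b0 a_P s by (simp add: tb)
  next
    case False
    then show ?thesis using t by (intro coef_eq_0) auto
  qed
  then show "coef Y t k = 0" using coef_homogeneous_A[OF a(4) subset_refl] by simp
qed

section \<open>Existence of independent vectors by saturation\<close>

lemma exists_vector_outside_span:
  fixes v :: "nat \<Rightarrow> 'm"
  obtains x where "\<And>d. x \<noteq> (\<Sum>k<n. scale (d k) (v k))"
proof -
  obtain x where x: "\<And>c. x \<noteq> (\<Sum>s\<in>v ` {..<n}. scale (c s) s)"
    using infinite_dim unfolding finitely_spanned_def by (metis finite_imageI finite_lessThan)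
  have "x \<noteq> (\<Sum>k<n. scale (d k) (v k))" for d
  proof -
    have sum_left: "scale (sum d K) y = (\<Sum>k\<in>K. scale (d k) y)" for K and y
      by (induction K rule: infinite_finite_induct) (simp_all add: scale_left_distrib)
    \<comment> \<open>\<open>finitely_spanned\<close> has one scalar for each element of a set, so
      the scalars at repeated entries of the family are added up.\<close>
    have "(\<Sum>k<n. scale (d k) (v k)) =
        (\<Sum>s\<in>v ` {..<n}. \<Sum>k\<in>{k. k \<in> {..<n} \<and> v k = s}. scale (d k) (v k))"
      by (rule sum.image_gen) simp
    also have "\<dots> = (\<Sum>s\<in>v ` {..<n}. scale (sum d {k. k \<in> {..<n} \<and> v k = s}) s)"
      unfolding sum_left by (intro sum.cong) auto
    finally show ?thesis using x[of "\<lambda>s. sum d {k. k \<in> {..<n} \<and> v k = s}"] by simp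
  qed
  then show thesis by (rule that)
qed

text \<open>\<open>no_relation m t\<close> says that no vertices of the isomorphism type of the first \<open>m\<close> vertices of
  \<open>A\<close> make \<open>t\<close> vanish.\<close>

definition no_relation :: "nat \<Rightarrow> trm \<Rightarrow> form" where
  "no_relation m t = Neg ((ExG ^^ m) (Conj (diagram A m) (EqV t (Scale 0 t))))"

lemma scoped_no_relation:
  "gset t \<subseteq> {..<m} \<Longrightarrow> vset t \<subseteq> {..<snd s} \<Longrightarrow> scoped (no_relation m t) s"
  by (auto simp: no_relation_def scoped_trm_iff scoped_diagram)

text \<open>Quantifying over \<open>m\<close> vertices with the right diagram amounts to quantifying
  over all embeddings, because a finite partial embedding extends. Vanishing of \<open>t\<close> is
  expressed as equality with 0 times \<open>t\<close>.\<close>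

lemma sat_no_relation:
  assumes "gset t \<subseteq> {..<m}" "vset t \<subseteq> {..<length (snd e)}" "set (snd e) \<subseteq> vec N"
  shows "sat N (no_relation m t) e \<longleftrightarrow> (\<forall>\<alpha>. emb \<alpha> \<longrightarrow> tv N t \<alpha> ((!) (snd e)) \<noteq> z)"
proof -
  have val: "sat N (EqV t (Scale 0 t)) (gs @ fst e, snd e) \<longleftrightarrow> tv N t \<alpha> ((!) (snd e)) = z"
    if \<alpha>: "emb \<alpha>" "\<And>i. i < m \<Longrightarrow> gs ! i = \<alpha> i" "length gs = m" for gs \<alpha>
  proof -
    have tv: "tval N t (gs @ fst e, snd e) = tv N t \<alpha> ((!) (snd e))"
      unfolding tval_eq_tv by (rule tv_cong) (use assms that in \<open>auto simp: nth_append\<close>)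
    have "tv N t \<alpha> ((!) (snd e)) \<in> vec N"
      by (rule tv_closed[OF N])
        (use assms emb_in_gam[OF \<alpha>(1)] in \<open>auto simp: subset_iff intro!: nth_mem\<close>)
    then show ?thesis using tv by (simp add: ratV_0)
  qed
  show ?thesis
  proof
    assume no: "sat N (no_relation m t) e"
    show "\<forall>\<alpha>. emb \<alpha> \<longrightarrow> tv N t \<alpha> ((!) (snd e)) \<noteq> z"
    proof (intro allI impI notI)
      fix \<alpha> assume \<alpha>: "emb \<alpha>" and 0: "tv N t \<alpha> ((!) (snd e)) = z"
      let ?gs = "map \<alpha> [0..<m]"
      have "partial_embedding A B \<alpha> {..<m}" using \<alpha> partial_embedding_subset unfolding emb_def by blast
      then have "partial_embedding A B ((!) (?gs @ fst e)) {..<m}"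
        by (rule partial_embedding_cong[rotated]) (simp add: nth_append)
      then have "sat N (diagram A m) (?gs @ fst e, snd e)"
        using emb_in_gam[OF \<alpha>] by (subst sat_diagram[OF A(2)]) (auto simp: B_def nth_append)
      moreover have "sat N (EqV t (Scale 0 t)) (?gs @ fst e, snd e)" using val[OF \<alpha>, of ?gs] 0 by simp
      moreover have "set ?gs \<subseteq> gam N" using emb_in_gam[OF \<alpha>] by auto
      ultimately show False using no unfolding no_relation_def sat.simps(6,7) sat_ExGs
        by (metis fst_conv length_map length_upt minus_nat.diff_0 snd_conv)
    qed
  next
    assume no: "\<forall>\<alpha>. emb \<alpha> \<longrightarrow> tv N t \<alpha> ((!) (snd e)) \<noteq> z"
    show "sat N (no_relation m t) e"
      unfolding no_relation_def sat.simps(6,7) sat_ExGs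
    proof (intro notI, elim exE conjE)
      fix gs assume gs: "length gs = m" "set gs \<subseteq> gam N" "sat N (diagram A m) (gs @ fst e, snd e)"
        "sat N (EqV t (Scale 0 t)) (gs @ fst e, snd e)"
      then have "partial_embedding A B ((!) (gs @ fst e)) {..<m}"
        by (subst (asm) sat_diagram[OF A(2)]) (auto simp: B_def nth_append subset_iff)
      then obtain \<alpha> where "emb \<alpha>" "\<And>i. i < m \<Longrightarrow> \<alpha> i = (gs @ fst e) ! i"
        using emb_extend[of "(!) (gs @ fst e)" "{..<m}"] by (metis finite_lessThan lessThan_iff)
      then show False using val[of \<alpha> gs] gs no by (simp add: nth_append)
    qed
  qed
qed

text \<open>Any vector outside the span of the first \<open>n\<close> works for all terms and all
  vertices at once: a vanishing term with nonzero coefficient at \<open>n\<close> could be solved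
  for it in Q_G.\<close>

lemma M_avoids_relations:
  assumes "finite L" and L: "\<And>m t. (m, t) \<in> L \<Longrightarrow> gset t \<subseteq> {..<m} \<and> vset t \<subseteq> {..<Suc n} \<and> coef Y t n \<noteq> 0"
  shows "\<exists>x. \<forall>m t \<beta>. (m, t) \<in> L \<longrightarrow> partial_embedding A G \<beta> {..<m} \<longrightarrow> tv M t \<beta> (v(n := x)) \<noteq> 0"
proof -
  obtain x where x: "\<And>d. x \<noteq> (\<Sum>k<n. scale (d k) (v k))" using exists_vector_outside_span by blast
  have "tv M t \<beta> (v(n := x)) \<noteq> 0" if mt: "(m, t) \<in> L" and \<beta>: "partial_embedding A G \<beta> {..<m}" for m t \<beta>
  proof
    assume 0: "tv M t \<beta> (v(n := x)) = 0"
    let ?c = "coef (X \<circ> \<beta>) t"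
    have c: "?c n \<noteq> 0" using coef_homogeneous_G[OF \<beta>] L[OF mt] by simp
    have "(\<Sum>k<n. scale (?c k) (v k)) + scale (?c n) x = 0"
      using 0 tv_M[of t "Suc n" \<beta> "v(n := x)"] L[OF mt] by simp
    then have "scale (inverse (?c n)) ((\<Sum>k<n. scale (?c k) (v k)) + scale (?c n) x) = 0" by simp
    then have "(\<Sum>k<n. scale (inverse (?c n) * ?c k) (v k)) + x = 0"
      using c by (simp add: scale_right_distrib scale_sum scale_scale scale_one)
    then have "x = (\<Sum>k<n. scale (- (inverse (?c n) * ?c k)) (v k))"
      by (simp add: scale_minus_left sum_negf eq_neg_iff_add_eq_0 add.commute)
    then show False using x[of "\<lambda>k. - (inverse (?c n) * ?c k)"] by simp
  qed
  then show ?thesis by blast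
qed

text \<open>Avoiding all relations with the first \<open>n\<close> vectors is a set of formulas with
  finitely many parameters. Finite parts are satisfiable by transfer from \<open>M\<close>, which
  has infinite dimension, and saturation gives the rest.\<close>

lemma not_dep_exists:
  assumes v: "\<And>k. v k \<in> vec N"
  obtains x where "x \<in> vec N" "\<not> dep n v x"
proof -
  let ?b = "([], map v [0..<n]) :: ('g, 'v) tuple"
  \<comment> \<open>\<open>dep\<close> keeps the new vector in position \<open>n\<close>, whereas a
    realization precedes its parameters; \<open>r\<close> moves position \<open>n\<close> to the
    front.\<close>
  define r where "r k = (if k = n then Var 0 else Var (Suc k))" for k
  define D where "D = {(m, t). gset t \<subseteq> {..<m} \<and> vset t \<subseteq> {..<Suc n} \<and> coef Y t n \<noteq> 0}"
  define f where "f = (\<lambda>(m, t). (no_relation m (tsub r t), ?b))"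
  have D: "gset t \<subseteq> {..<m}" "vset t \<subseteq> {..<Suc n}" "coef Y t n \<noteq> 0" if "(m, t) \<in> D" for m t
    using that by (auto simp: D_def)
  have vr: "vset (tsub r t) \<subseteq> {..<Suc n}" "gset (tsub r t) = gset t" if "vset t \<subseteq> {..<Suc n}" for t
    using that by (auto simp: vset_tsub gset_tsub r_def split: if_splits)
  have sc: "scoped (no_relation m (tsub r t)) (0, Suc n)" if "(m, t) \<in> D" for m t
    using D[OF that] vr[of t] by (intro scoped_no_relation) auto
  have tvr: "tv K (tsub r t) \<alpha> ((!) (x # map u [0..<n])) = tv K t \<alpha> (u(n := x))"
    if "vset t \<subseteq> {..<Suc n}" for K :: "('c, 'd) lstr" and t \<alpha> x u
    unfolding tv_tsub by (rule tv_cong) (use that in \<open>auto simp: less_Suc_eq r_def\<close>)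
  have "\<exists>x. realizes N (0, 1) (f ` D) x"
  proof (rule saturated[unfolded aleph1_saturated_def, rule_format, of "({}, v ` {..<n})"], intro conjI ballI allI impI)
    fix g assume "g \<in> f ` D"
    then obtain m t where "g = f (m, t)" "(m, t) \<in> D" by auto
    then show "formula_over ({}, v ` {..<n}) (0, 1) g"
      using sc by (auto simp: formula_over_def tuples_def f_def)
  next
    fix p0 assume p0: "finite p0 \<and> p0 \<subseteq> f ` D"
    then obtain L where L: "L \<subseteq> D" "finite L" "p0 = f ` L" by (meson finite_subset_image)
    obtain l where l: "set l = L" using finite_list[OF L(2)] by blast
    let ?\<phi> = "ExV (conjs (map (fst \<circ> f) l))"
    have "sat N ?\<phi> ?b"
    proof (rule transfer[OF model, of ?\<phi> 0 n])
      show "scoped ?\<phi> (0, n)" using l L sc by (auto simp: f_def)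
    next
      fix gs :: "'a list" and vs :: "'m list"
      assume gs: "length gs = 0" and vs: "length vs = n"
      have "\<exists>x. \<forall>m t \<beta>. (m, t) \<in> L \<longrightarrow> partial_embedding A G \<beta> {..<m} \<longrightarrow> tv M t \<beta> (((!) vs)(n := x)) \<noteq> 0"
      proof (rule M_avoids_relations[OF L(2)])
        fix m t assume "(m, t) \<in> L"
        then show "gset t \<subseteq> {..<m} \<and> vset t \<subseteq> {..<Suc n} \<and> coef Y t n \<noteq> 0" using D[of m t] L(1) by auto
      qed
      then obtain x where x: "\<And>m t \<beta>. (m, t) \<in> L \<Longrightarrow> partial_embedding A G \<beta> {..<m} \<Longrightarrow>
          tv M t \<beta> (((!) vs)(n := x)) \<noteq> 0" by blast
      have "sat M (no_relation m (tsub r t)) ([], x # vs)" if mt: "(m, t) \<in> L" for m t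
        unfolding no_relation_def sat.simps(6,7) sat_ExGs
      proof (intro notI, elim exE conjE)
        fix gs assume gs: "length gs = m" "set gs \<subseteq> gam M"
          "sat M (diagram A m) (gs @ fst ([], x # vs), snd ([], x # vs))"
          "sat M (EqV (tsub r t) (Scale 0 (tsub r t))) (gs @ fst ([], x # vs), snd ([], x # vs))"
        have mt': "gset t \<subseteq> {..<m}" "vset t \<subseteq> {..<Suc n}" using D[of m t] mt L(1) by auto
        have "partial_embedding A G ((!) gs) {..<m}"
          using gs by (subst (asm) sat_diagram[OF A(2)])
            (auto simp: graph_of_module_structure bipartite_G subset_iff)
        then have "tv M t ((!) gs) (((!) vs)(n := x)) \<noteq> 0" using x[OF mt] by simp
        moreover have "map ((!) vs) [0..<n] = vs" using vs map_nth[of vs] by simp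
        ultimately have "tval M (tsub r t) (gs, x # vs) \<noteq> 0"
          using tvr[OF mt'(2), of M "(!) gs" x "(!) vs"] by (simp add: tval_eq_tv)
        then show False using gs by simp
      qed
      then show "sat M ?\<phi> (gs, vs)" using gs l
        by (auto simp: f_def intro!: exI[of _ x])
    qed (use v in auto)
    then obtain x where x: "x \<in> vec N" "\<And>g. g \<in> L \<Longrightarrow> sat N (fst (f g)) ([], x # map v [0..<n])"
      using l by auto
    have "snd (f g) = ?b" for g by (cases g) (simp add: f_def)
    then have "sat N (fst (f g)) (([], [x]) \<frown> snd (f g))" if "g \<in> L" for g
      using x(2)[OF that] by (simp add: tapp_def)
    then have "\<forall>(\<phi>, b)\<in>p0. sat N \<phi> (([], [x]) \<frown> b)"
      unfolding L(3) case_prod_beta by blast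
    then show "\<exists>x. realizes N (0, 1) p0 x"
      using x(1) by (intro exI[of _ "([], [x])"])
        (auto simp: realizes_def tuples_def carriers_def shape_def)
  qed (use v in auto)
  then obtain x where x: "realizes N (0, 1) (f ` D) x" by blast
  then obtain y where y: "x = ([], [y])" "y \<in> vec N"
    by (cases x) (auto simp: realizes_def shape_def tuples_def carriers_def length_Suc_conv)
  have "\<not> dep n v y"
  proof
    assume "dep n v y"
    then obtain \<alpha> t where t: "emb \<alpha>" "vset t \<subseteq> {..<Suc n}" "tv N t \<alpha> (v(n := y)) = z" "coef Y t n \<noteq> 0"
      unfolding dep_def by blast
    obtain m where m: "gset t \<subseteq> {..<m}" using bound_nat finite_gset by metis
    have "sat N (no_relation m (tsub r t)) ([], y # map v [0..<n])"
      using x t m y by (auto simp: realizes_def tapp_def f_def D_def)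
    moreover have "v ` {0..<n} \<subseteq> vec N" using v by blast
    ultimately have "tv N (tsub r t) \<alpha> ((!) (y # map v [0..<n])) \<noteq> z"
      using sat_no_relation[of "tsub r t" m "([], y # map v [0..<n])"] vr[OF t(2)] t m v y by auto
    then show False using tvr[OF t(2), of N \<alpha> y v] t by simp
  qed
  then show thesis using that y by blast
qed

lemma indep_sequence: obtains f where "\<And>n. indep n f"
proof -
  have "\<exists>h. \<forall>n. indep n (h n) \<and> (\<forall>k<n. h (Suc n) k = h n k)"
  proof (rule dependent_nat_choice)
    show "\<exists>h. indep 0 h" using indep_0[of "\<lambda>_. z"] z_vec by blast
  next
    fix h n assume h: "indep n h"
    then obtain x where "x \<in> vec N" "\<not> dep n h x" using not_dep_exists[of h n] indep_vec by blast
    then show "\<exists>h'. indep (Suc n) h' \<and> (\<forall>k<n. h' k = h k)"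
      using indep_extend[OF h] by (intro exI[of _ "h(n := x)"]) auto
  qed
  then obtain h where h: "\<And>n. indep n (h n)" "\<And>n k. k < n \<Longrightarrow> h (Suc n) k = h n k" by blast
  have hm: "h (m + i) k = h m k" if "k < m" for m i k using that by (induction i) (auto simp: h)
  have eq: "h (Suc k) k = h n k" if "k < n" for n k using hm[of k "Suc k" "n - Suc k"] that by simp
  have "indep n (\<lambda>k. h (Suc k) k)" for n
    by (rule indep_cong[OF h(1)[of n]]) (use eq h(1) indep_vec in blast)+
  then show thesis by (rule that)
qed

section \<open>Types of tuples\<close>

text \<open>A coordinate description \<open>(idx, ts, n)\<close> of a tuple: its vertices are \<open>\<alpha> (idx ! i)\<close> and its
  vectors are the values of the terms \<open>ts\<close> at independent vectors \<open>v\<^sub>0, \<dots>, v\<^bsub>n-1\<^esub>\<close>. It determines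
  the type of the tuple, and conversely.\<close>

definition rep :: "nat list \<Rightarrow> trm list \<Rightarrow> nat \<Rightarrow> ('g, 'v) tuple \<Rightarrow> bool" where
  "rep idx ts n e \<longleftrightarrow> 0 < n \<and> (\<forall>t\<in>set ts. vset t \<subseteq> {..<n}) \<and>
    (\<exists>\<alpha> v. emb \<alpha> \<and> indep n v \<and> e = (map \<alpha> idx, map (\<lambda>t. tv N t \<alpha> v) ts))"

lemma repI:
  assumes "0 < n" "\<And>t. t \<in> set ts \<Longrightarrow> vset t \<subseteq> {..<n}" "emb \<alpha>" "indep n v"
    "fst e = map \<alpha> idx" "snd e = map (\<lambda>t. tv N t \<alpha> v) ts"
  shows "rep idx ts n e"
  using assms unfolding rep_def by (metis prod.collapse)

lemma repE:
  assumes "rep idx ts n e"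
  obtains \<alpha> v where "0 < n" "\<And>t. t \<in> set ts \<Longrightarrow> vset t \<subseteq> {..<n}" "emb \<alpha>" "indep n v"
    "fst e = map \<alpha> idx" "snd e = map (\<lambda>t. tv N t \<alpha> v) ts"
  using assms unfolding rep_def by auto

lemma rep_length: "rep idx ts n e \<Longrightarrow> length (fst e) = length idx \<and> length (snd e) = length ts"
  by (auto simp: rep_def)

lemma rep_tuples: "rep idx ts n e \<Longrightarrow> e \<in> tuples (carriers N)"
  using emb_in_gam tv_vec indep_vec by (fastforce simp: rep_def tuples_def carriers_def)

lemma rep_subtuple:
  assumes "rep idx ts n e" "\<forall>i\<in>set is. i < length idx" "\<forall>k\<in>set ks. k < length ts"
  shows "rep (map ((!) idx) is) (map ((!) ts) ks) n (map ((!) (fst e)) is, map ((!) (snd e)) ks)"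
proof -
  obtain \<alpha> v where r: "0 < n" "\<And>t. t \<in> set ts \<Longrightarrow> vset t \<subseteq> {..<n}" "emb \<alpha>" "indep n v"
    "fst e = map \<alpha> idx" "snd e = map (\<lambda>t. tv N t \<alpha> v) ts" using assms(1) by (rule repE) blast
  have "vset (ts ! k) \<subseteq> {..<n}" if "k \<in> set ks" for k using assms(3) that by (intro r(2)) simp
  then show ?thesis by (intro repI[of n _ \<alpha> v]) (use r(1,3-6) assms in auto)
qed

lemma list_positions:
  assumes "set xs \<subseteq> set ys"
  obtains ks where "xs = map ((!) ys) ks" "\<forall>k\<in>set ks. k < length ys"
  using assms
proof (induction xs arbitrary: thesis)
  case (Cons x xs)
  obtain k where k: "k < length ys" "x = ys ! k" using Cons.prems(2) by (auto simp: in_set_conv_nth)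
  obtain ks where "xs = map ((!) ys) ks" "\<forall>k\<in>set ks. k < length ys" using Cons by auto
  then show ?case using Cons.prems(1)[of "k # ks"] k by auto
qed simp

definition comp :: "nat list \<Rightarrow> trm list \<Rightarrow> trm \<Rightarrow> trm" where
  "comp idx ts t = tsub ((!) ts) (tren ((!) idx) t)"

lemma tval_rep:
  assumes "scoped_trm t (length idx, length ts)"
  shows "tval N t (map \<alpha> idx, map (\<lambda>t. tv N t \<alpha> v) ts) = tv N (comp idx ts t) \<alpha> v"
  unfolding comp_def tv_tsub tv_tren tval_eq_tv
  by (rule tv_cong) (use assms in \<open>auto simp: scoped_trm_iff subset_iff\<close>)

lemma vset_comp:
  assumes "scoped_trm t (length idx, length ts)" "\<And>t. t \<in> set ts \<Longrightarrow> vset t \<subseteq> {..<n}"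
  shows "vset (comp idx ts t) \<subseteq> {..<n}"
proof -
  have "vset (ts ! k) \<subseteq> {..<n}" if "k \<in> vset t" for k
    using assms that by (intro assms(2) nth_mem) (auto simp: scoped_trm_iff subset_iff)
  then show ?thesis by (auto simp: comp_def vset_tsub)
qed

section \<open>Extension steps of the back-and-forth argument\<close>

lemma rep_add_vertex:
  assumes "rep idx ts n e" "g \<in> gam N"
  shows "\<exists>j. rep (j # idx) ts n (g # fst e, snd e) \<and>
    (\<forall>e'. rep idx ts n e' \<longrightarrow> (\<exists>g'\<in>gam N. rep (j # idx) ts n (g' # fst e', snd e')))"
proof -
  obtain \<alpha> v where r: "0 < n" "\<And>t. t \<in> set ts \<Longrightarrow> vset t \<subseteq> {..<n}" "emb \<alpha>" "indep n v"
    "fst e = map \<alpha> idx" "snd e = map (\<lambda>t. tv N t \<alpha> v) ts" using assms(1) by (rule repE) blast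
  let ?S = "set idx \<union> (\<Union>t\<in>set ts. gset t)"
  obtain \<alpha>' j where a: "emb \<alpha>'" "\<forall>i\<in>?S. \<alpha>' i = \<alpha> i" "\<alpha>' j = g"
    using embedding_reach[of A B \<alpha> ?S g] r A B_extension assms(2) verts_B unfolding emb_def by auto
  have "tv N t \<alpha>' v = tv N t \<alpha> v" if "t \<in> set ts" for t
    by (rule tv_cong) (use a that in auto)
  then have "rep (j # idx) ts n (g # fst e, snd e)"
    by (intro repI[of n ts \<alpha>' v]) (use r a in auto)
  \<comment> \<open>The index \<open>j\<close> was chosen in \<open>A\<close>, so every tuple with
    the same description has a matching vertex, namely the one named \<open>j\<close> in its own
    frame.\<close>
  moreover have "\<exists>g'\<in>gam N. rep (j # idx) ts n (g' # fst e', snd e')" if "rep idx ts n e'" for e'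
  proof -
    obtain \<alpha> v where r: "0 < n" "\<And>t. t \<in> set ts \<Longrightarrow> vset t \<subseteq> {..<n}" "emb \<alpha>" "indep n v"
      "fst e' = map \<alpha> idx" "snd e' = map (\<lambda>t. tv N t \<alpha> v) ts" using \<open>rep idx ts n e'\<close> by (rule repE) blast
    then have "rep (j # idx) ts n (\<alpha> j # fst e', snd e')"
      by (intro repI[of n ts \<alpha> v]) auto
    then show ?thesis using emb_in_gam r by blast
  qed
  ultimately show ?thesis by blast
qed

lemma rep_outside:
  assumes "0 < n" "\<And>t. t \<in> set ts \<Longrightarrow> vset t \<subseteq> {..<n}" "emb \<alpha>" "indep n v" "x \<in> vec N" "\<not> dep n v x"
    "fst e = map \<alpha> idx" "snd e = map (\<lambda>t. tv N t \<alpha> v) ts"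
  shows "rep idx (Var n # ts) (Suc n) (fst e, x # snd e)"
proof (rule repI)
  show "vset t \<subseteq> {..<Suc n}" if "t \<in> set (Var n # ts)" for t using assms(2) that by fastforce
  have "tv N t \<alpha> (v(n := x)) = tv N t \<alpha> v" if "t \<in> set ts" for t
    by (rule tv_cong) (use assms(2)[OF that] in auto)
  then show "snd (fst e, x # snd e) = map (\<lambda>t. tv N t \<alpha> (v(n := x))) (Var n # ts)"
    using assms(8) by simp
  show "indep (Suc n) (v(n := x))" by (rule indep_extend[OF assms(4-6)])
  show "0 < Suc n" "emb \<alpha>" "fst (fst e, x # snd e) = map \<alpha> idx" using assms(3,7) by simp_all
qed

lemma rep_add_independent:
  assumes "rep idx ts n e"
  obtains x where "x \<in> vec N" "rep idx (Var n # ts) (Suc n) (fst e, x # snd e)"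
proof -
  obtain \<alpha> v where r: "0 < n" "\<And>t. t \<in> set ts \<Longrightarrow> vset t \<subseteq> {..<n}" "emb \<alpha>" "indep n v"
    "fst e = map \<alpha> idx" "snd e = map (\<lambda>t. tv N t \<alpha> v) ts" using assms(1) by (rule repE) blast
  obtain x where x: "x \<in> vec N" "\<not> dep n v x"
    using not_dep_exists[of v n, OF indep_vec[OF r(4)]] by blast
  show thesis by (rule that[OF x(1) rep_outside[OF r(1-4) x r(5,6)]])
qed

text \<open>Replacing the basis \<open>v\<close> by \<open>s\<inverse> v\<close> clears the denominators in the coordinates of a new vector.\<close>

lemma rep_divide:
  assumes v: "indep n v" "0 < n" and \<alpha>: "emb \<alpha>" and s: "vset s = {0}" "coef Y s 0 \<noteq> 0"
  obtains w where "indep n w" "\<And>k. tv N s \<alpha> (\<lambda>_. w k) = v k"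
proof -
  have "\<forall>k. \<exists>y. y \<in> vec N \<and> tv N s \<alpha> (\<lambda>_. y) = v k"
    using tv_surj[OF \<alpha> indep_vec[OF v(1)] s(2,1)] by blast
  then obtain w where w: "\<And>k. w k \<in> vec N" "\<And>k. tv N s \<alpha> (\<lambda>_. w k) = v k" by metis
  show thesis by (rule that[OF indep_divide[OF v \<alpha> s w] w(2)])
qed

text \<open>A vector outside the span becomes a new basis vector. A vector in the span has
  coordinates in Q_G, which turn into elements of \<open>P\<close> when the basis is divided by a
  common denominator. The new description is built from the old one and the relation alone, so it
  serves every tuple with the old description.\<close>

lemma rep_add_vector:
  assumes rep: "rep idx ts n e" and x: "x \<in> vec N"
  shows "\<exists>t ts' n'. rep idx (t # ts') n' (fst e, x # snd e) \<and>
    (\<forall>e'. rep idx ts n e' \<longrightarrow> (\<exists>x'\<in>vec N. rep idx (t # ts') n' (fst e', x' # snd e')))"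
proof -
  obtain \<alpha> v where r: "0 < n" "\<And>t. t \<in> set ts \<Longrightarrow> vset t \<subseteq> {..<n}" "emb \<alpha>" "indep n v"
    "fst e = map \<alpha> idx" "snd e = map (\<lambda>t. tv N t \<alpha> v) ts" using assms(1) by (rule repE) blast
  show ?thesis
  proof (cases "dep n v x")
    case False
    then have "rep idx (Var n # ts) (Suc n) (fst e, x # snd e)"
      using rep_outside[OF r(1-4) x _ r(5,6)] by simp
    then show ?thesis using rep_add_independent by metis
  next
    case True
    then obtain \<beta> t where t: "emb \<beta>" "vset t \<subseteq> {..<Suc n}" "tv N t \<beta> (v(n := x)) = z" "coef Y t n \<noteq> 0"
      unfolding dep_def by blast
    let ?S = "set idx \<union> (\<Union>t\<in>set ts. gset t)"
    obtain \<alpha>' j where a: "emb \<alpha>'" "\<And>i. i \<in> ?S \<Longrightarrow> \<alpha>' i = \<alpha> i"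
      "\<And>i. i \<in> gset t \<Longrightarrow> \<alpha>' (j i) = \<beta> i" "partial_embedding A A j (gset t)"
      using absorb[OF r(3) t(1), of ?S "gset t"] by auto
    let ?t = "tren j t"
    have t': "tv N ?t \<alpha>' (v(n := x)) = z" unfolding t(3)[symmetric] tv_tren
      by (rule tv_cong) (use a in auto)
    define d where "d = coef Y ?t n"
    have d: "d \<noteq> 0" using coef_homogeneous_A[OF a(4) subset_refl, of n] t by (simp add: d_def)
    \<comment> \<open>The coordinates of \<open>x\<close> with respect to \<open>v\<close>. Since
      \<open>v k\<close> will be \<open>s\<close> times \<open>w k\<close>, the denominator
      multiplies them on the right.\<close>
    let ?q = "\<lambda>k. inverse d * (- coef Y ?t k)"
    obtain s where s: "s \<in> P" "s \<noteq> 0" "\<And>k. k < n \<Longrightarrow> ?q k * s \<in> P"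
      using right_common_denominator[of n ?q] by blast
    obtain \<sigma> where \<sigma>: "vset \<sigma> = {0}" "\<And>k. coef Y \<sigma> k = (if k = 0 then s else 0)"
      using P_term1[OF s(1), of 0] by blast
    obtain \<rho> where \<rho>: "vset \<rho> \<subseteq> {..<n}" "\<And>k. coef Y \<rho> k = (if k < n then ?q k * s else 0)"
      using P_term[OF r(1), of "\<lambda>k. ?q k * s"] s(3) by blast
    have \<sigma>0: "coef Y \<sigma> 0 \<noteq> 0" using s \<sigma> by simp
    let ?\<sigma> = "\<lambda>k. tsub (\<lambda>_. Var k) \<sigma>"
    let ?ts = "map (tsub ?\<sigma>) ts"
    have vs: "vset u \<subseteq> {..<n}" if "u \<in> set (\<rho> # ?ts)" for u
      using that \<rho>(1) \<sigma>(1) subsetD[OF r(2)] by (auto simp: vset_tsub)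
    have ts: "map (\<lambda>t. tv N t \<alpha> w) ?ts = map (\<lambda>t. tv N t \<alpha> v) ts"
      if "\<And>k. tv N \<sigma> \<alpha> (\<lambda>_. w k) = v k" for \<alpha> w v
      using that by (auto simp: tv_tsub)
    obtain w where w: "indep n w" "\<And>k. tv N \<sigma> \<alpha>' (\<lambda>_. w k) = v k"
      using rep_divide[OF r(4,1) a(1) \<sigma>(1) \<sigma>0] by blast
    let ?y = "tv N \<rho> \<alpha>' w"
    have wv: "w k \<in> vec N" for k using indep_vec[OF w(1)] .
    let ?\<tau> = "\<lambda>k. if k = n then \<rho> else ?\<sigma> k"
    have "tv N ?t \<alpha>' (v(n := ?y)) = tv N (tsub ?\<tau> ?t) \<alpha>' w"
      unfolding tv_tsub by (rule tv_cong) (auto simp: tv_tsub w)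
    also have "\<dots> = z"
    proof (rule tv_zero[OF a(1) wv])
      fix l
      have s1: "coef Y (?\<sigma> k) l = (if l = k then s else 0)" for k
        using \<sigma> by (subst coef_tsub[of \<sigma> 1]) auto
      have "coef Y (tsub ?\<tau> ?t) l = (\<Sum>k<n. coef Y ?t k * coef Y (?\<tau> k) l) + d * coef Y \<rho> l"
        using t(2) by (subst coef_tsub[of _ "Suc n"]) (auto simp: d_def)
      also have "(\<Sum>k<n. coef Y ?t k * coef Y (?\<tau> k) l) = (\<Sum>k<n. if k = l then coef Y ?t l * s else 0)"
        by (intro sum.cong) (auto simp: s1)
      also have "\<dots> = (if l < n then coef Y ?t l * s else 0)" by simp
      also have "d * coef Y \<rho> l = (if l < n then - (coef Y ?t l * s) else 0)"
        unfolding \<rho>(2) using d by (simp flip: mult.assoc)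
      finally show "coef Y (tsub ?\<tau> ?t) l = 0" by simp
    qed
    finally have y: "tv N ?t \<alpha>' (v(n := x)) = tv N ?t \<alpha>' (v(n := ?y))" using t' by simp
    have "vset ?t \<subseteq> {..<Suc n}" "coef Y ?t n \<noteq> 0" using t(2) d unfolding d_def by simp_all
    \<comment> \<open>Both vectors solve the same relation, whose coefficient at position
      \<open>n\<close> is nonzero.\<close>
    then have "x = ?y"
      using tv_inj[OF a(1) _ x tv_vec[OF a(1) wv] _ _ y] indep_vec[OF r(4)] by blast
    moreover have "tv N u \<alpha>' v = tv N u \<alpha> v" if "u \<in> set ts" for u
      by (rule tv_cong) (use a that in auto)
    ultimately have "rep idx (\<rho> # ?ts) n (fst e, x # snd e)"
      using ts[of \<alpha>' w v, OF w(2)]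
      by (intro repI[of _ _ \<alpha>' w]) (use r a w vs in auto)
    moreover have "\<exists>x'\<in>vec N. rep idx (\<rho> # ?ts) n (fst e', x' # snd e')" if "rep idx ts n e'" for e'
    proof -
      obtain \<alpha> v where r: "0 < n" "\<And>t. t \<in> set ts \<Longrightarrow> vset t \<subseteq> {..<n}" "emb \<alpha>" "indep n v"
        "fst e' = map \<alpha> idx" "snd e' = map (\<lambda>t. tv N t \<alpha> v) ts" using \<open>rep idx ts n e'\<close> by (rule repE) blast
      obtain w where w: "indep n w" "\<And>k. tv N \<sigma> \<alpha> (\<lambda>_. w k) = v k"
        using rep_divide[OF r(4,1,3) \<sigma>(1) \<sigma>0] by blast
      have "rep idx (\<rho> # ?ts) n (fst e', tv N \<rho> \<alpha> w # snd e')"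
        using ts[of \<alpha> w v, OF w(2)]
        by (intro repI[of _ _ \<alpha> w]) (use r w vs in auto)
      moreover have "tv N \<rho> \<alpha> w \<in> vec N" by (rule tv_vec[OF r(3)]) (rule indep_vec[OF w(1)])
      ultimately show ?thesis by blast
    qed
    ultimately show ?thesis by blast
  qed
qed

lemma rep_exists:
  assumes "set gs \<subseteq> gam N" "set vs \<subseteq> vec N"
  shows "\<exists>idx ts n. rep idx ts n (gs, vs)"
  using assms
proof (induction gs)
  case Nil
  then show ?case
  proof (induction vs)
    case Nil
    obtain \<alpha> where \<alpha>: "emb \<alpha>" by (rule emb_exists)
    obtain f where "\<And>n. indep n f" by (rule indep_sequence) blast
    \<comment> \<open>The description starts with one basis vector because \<open>rep\<close>
      demands \<open>0 < n\<close>.\<close>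
    then have "rep [] [] 1 ([], [])" using \<alpha> by (intro repI[of _ _ \<alpha> f]) auto
    then show ?case by blast
  next
    case (Cons x vs)
    then show ?case using rep_add_vector[of _ _ _ "([], vs)" x] by fastforce
  qed
next
  case (Cons g gs)
  then show ?case using rep_add_vertex[of _ _ _ "(gs, vs)" g] by fastforce
qed

text \<open>Vertex atoms are read off from \<open>idx\<close> and \<open>A\<close>. By independence,
  an equation between vectors holds exactly when the coefficients agree, a condition free of
  \<open>\<alpha>\<close> and \<open>v\<close>. Quantifiers extend both tuples by the same
  coordinates; since the basis may change there, the induction is over all descriptions.\<close>

lemma rep_same_formulas:
  assumes "rep idx ts n e" "rep idx ts n e'" "scoped \<phi> (length idx, length ts)"
  shows "sat N \<phi> e \<longleftrightarrow> sat N \<phi> e'"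
  using assms
proof (induction \<phi> arbitrary: idx ts n e e')
  case (EqG k l)
  have "fst e ! k = fst e ! l \<longleftrightarrow> idx ! k = idx ! l" if e: "rep idx ts n e" for e
  proof -
    obtain \<alpha> v where "emb \<alpha>" "fst e = map \<alpha> idx" using e by (rule repE) blast
    then show ?thesis using EqG.prems(3) partial_embeddingD(6)[of A B \<alpha> UNIV] by (auto simp: emb_def)
  qed
  then show ?case using EqG by simp
next
  case (EqV t u)
  have "sat N (EqV t u) e \<longleftrightarrow> (\<forall>k. coef Y (comp idx ts t) k = coef Y (comp idx ts u) k)"
    if e: "rep idx ts n e" for e
  proof -
    obtain \<alpha> v where r: "\<And>t. t \<in> set ts \<Longrightarrow> vset t \<subseteq> {..<n}" "emb \<alpha>" "indep n v"
      "fst e = map \<alpha> idx" "snd e = map (\<lambda>t. tv N t \<alpha> v) ts" using e by (rule repE) blast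
    have sc: "scoped_trm t (length idx, length ts)" "scoped_trm u (length idx, length ts)"
      using EqV.prems by auto
    have e': "e = (map \<alpha> idx, map (\<lambda>t. tv N t \<alpha> v) ts)" using r by (metis prod.collapse)
    have "sat N (EqV t u) e \<longleftrightarrow> tv N (comp idx ts t) \<alpha> v = tv N (comp idx ts u) \<alpha> v"
      unfolding sat.simps e' tval_rep[OF sc(1)] tval_rep[OF sc(2)] ..
    moreover have "vset (comp idx ts t) \<subseteq> {..<n}" "vset (comp idx ts u) \<subseteq> {..<n}"
      using vset_comp[OF _ r(1)] sc by blast+
    ultimately show ?thesis
      using indep_eqD[OF r(3,2)] tv_eqI[OF r(2), of v] indep_vec[OF r(3)] by metis
  qed
  then show ?case using EqV by blast
next
  case (InI k)
  have "predI N (fst e ! k) \<longleftrightarrow> idx ! k \<in> left A" if e: "rep idx ts n e" for e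
  proof -
    obtain \<alpha> v where "emb \<alpha>" "fst e = map \<alpha> idx" using e by (rule repE) blast
    then show ?thesis using InI.prems(3) emb_in_gam partial_embeddingD(1)[of A B \<alpha> UNIV]
      by (auto simp: emb_def B_simps)
  qed
  then show ?case using InI by simp
next
  case (InJ k)
  have "predJ N (fst e ! k) \<longleftrightarrow> idx ! k \<in> right A" if e: "rep idx ts n e" for e
  proof -
    obtain \<alpha> v where "emb \<alpha>" "fst e = map \<alpha> idx" using e by (rule repE) blast
    then show ?thesis using InJ.prems(3) emb_in_gam partial_embeddingD(2)[of A B \<alpha> UNIV]
      by (auto simp: emb_def B_simps)
  qed
  then show ?case using InJ by simp
next
  case (Edge k l)
  have "relE N (fst e ! k) (fst e ! l) \<longleftrightarrow> edge A (idx ! k) (idx ! l)" if e: "rep idx ts n e" for e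
  proof -
    obtain \<alpha> v where "emb \<alpha>" "fst e = map \<alpha> idx" using e by (rule repE) blast
    then show ?thesis using Edge.prems(3) emb_in_gam partial_embeddingD(3)[of A B \<alpha> UNIV]
      by (auto simp: emb_def B_simps)
  qed
  then show ?case using Edge by simp
next
  case (Neg \<phi>)
  show ?case using Neg.IH[OF Neg.prems(1,2)] Neg.prems(3) by simp
next
  case (Conj \<phi> \<psi>)
  show ?case using Conj.IH(1)[OF Conj.prems(1,2)] Conj.IH(2)[OF Conj.prems(1,2)] Conj.prems(3) by simp
next
  case (ExG \<phi>)
  have "sat N (ExG \<phi>) e'" if e: "rep idx ts n e" "rep idx ts n e'" "sat N (ExG \<phi>) e" for e e'
  proof -
    obtain g where g: "g \<in> gam N" "sat N \<phi> (g # fst e, snd e)" using e by auto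
    obtain j g' where g': "rep (j # idx) ts n (g # fst e, snd e)" "g' \<in> gam N"
      "rep (j # idx) ts n (g' # fst e', snd e')" using rep_add_vertex[OF e(1) g(1)] e(2) by blast
    have "sat N \<phi> (g' # fst e', snd e')"
      using ExG.IH[OF g'(1,3)] ExG.prems(3) g by simp
    then show ?thesis using g' by auto
  qed
  then show ?case using ExG.prems by blast
next
  case (ExV \<phi>)
  have "sat N (ExV \<phi>) e'" if e: "rep idx ts n e" "rep idx ts n e'" "sat N (ExV \<phi>) e" for e e'
  proof -
    obtain x where x: "x \<in> vec N" "sat N \<phi> (fst e, x # snd e)" using e by auto
    obtain t ts' n' x' where x': "rep idx (t # ts') n' (fst e, x # snd e)" "x' \<in> vec N"
      "rep idx (t # ts') n' (fst e', x' # snd e')" using rep_add_vector[OF e(1) x(1)] e(2) by blast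
    have "length ts' = length ts" using rep_length[OF x'(1)] rep_length[OF e(1)] by simp
    then have "sat N \<phi> (fst e', x' # snd e')"
      using ExV.IH[OF x'(1,3)] ExV.prems(3) x by simp
    then show ?thesis using x' by auto
  qed
  then show ?case using ExV.prems by blast
qed

lemma rep_same_type:
  assumes "rep idx ts n e" "rep idx ts n e'"
  shows "same_type N ({}, {}) e e'"
  unfolding same_type_def
proof (intro conjI ballI allI impI)
  show "shape e = shape e'" using rep_length[OF assms(1)] rep_length[OF assms(2)] by (simp add: shape_def)
next
  fix b \<phi> assume "b \<in> tuples ({} :: 'g set, {} :: 'v set)" "scoped \<phi> (shape (e \<frown> b))"
  then show "sat N \<phi> (e \<frown> b) = sat N \<phi> (e' \<frown> b)"
    using rep_same_formulas[OF assms] rep_length[OF assms(1)]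
    by (cases b) (simp add: tuples_def tapp_def shape_def)
qed

lemma tv_append:
  assumes "gset t \<subseteq> {..<m}" "vset t \<subseteq> {..<n}"
  shows "tv N t ((!) (map \<alpha> [0..<m] @ gs)) ((!) (map v [0..<n] @ vs)) = tv N t \<alpha> v"
  by (rule tv_cong) (use assms in \<open>auto simp: nth_append subset_iff\<close>)

text \<open>That a frame and a basis describe \<open>c\<close> is expressed by a set of formulas
  over \<open>c\<close>. The existence of a solution of finitely many of them is part of the type of
  \<open>c\<close>, hence holds for \<open>c'\<close> as well, and saturation yields a frame and a
  basis for \<open>c'\<close>.\<close>

lemma rep_transfer:
  assumes rep: "rep idx ts n c" and c': "c' \<in> tuples (carriers N)" and same: "same_type N ({}, {}) c' c"
  shows "rep idx ts n c'"
proof -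
  obtain \<alpha> v where r: "0 < n" "\<And>t. t \<in> set ts \<Longrightarrow> vset t \<subseteq> {..<n}" "emb \<alpha>" "indep n v"
    "fst c = map \<alpha> idx" "snd c = map (\<lambda>t. tv N t \<alpha> v) ts" using rep by (rule repE) blast
  have len: "length (fst c) = length idx" "length (snd c) = length ts" using r by auto
  have len': "length (fst c') = length idx" "length (snd c') = length ts"
    using same len by (auto simp: same_type_def shape_def)
  have sub: "set (fst c) \<subseteq> gam N" "set (snd c) \<subseteq> vec N" "set (fst c') \<subseteq> gam N" "set (snd c') \<subseteq> vec N"
    using rep_tuples[OF rep] c' by (auto simp: tuples_def carriers_def in_lists_conv_set)
  have vv: "v k \<in> vec N" for k using r(4) by (rule indep_vec)
  obtain m where m: "set idx \<union> (\<Union>t\<in>set ts. gset t) \<subseteq> {..<m}" using bound_nat by (metis List.finite_set finite_UN finite_UnI finite_gset)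
  have ts_m: "gset (ts ! k) \<subseteq> {..<m}" "vset (ts ! k) \<subseteq> {..<n}" if "k < length ts" for k
    using m r(2)[OF nth_mem[OF that]] nth_mem[OF that] by blast+
  have idx_m: "idx ! i < m" if "i < length idx" for i using m nth_mem[OF that] by blast
  define R where "R = {no_relation l u | l u. gset u \<subseteq> {..<l} \<and> vset u \<subseteq> {..<n} \<and> (\<exists>k. coef Y u k \<noteq> 0)}"
  \<comment> \<open>The first \<open>m\<close> vertex variables and the first \<open>n\<close>
    vector variables are the sought frame and basis; the entries of the tuple follow them.
    \<open>R\<close> expresses independence.\<close>
  define \<Phi> where "\<Phi> = {diagram A m} \<union> (\<lambda>i. EqG (idx ! i) (m + i)) ` {..<length idx} \<union>
    (\<lambda>k. EqV (ts ! k) (Var (n + k))) ` {..<length ts} \<union> R"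
  have sc: "scoped \<phi> (m + length idx, n + length ts)" if "\<phi> \<in> \<Phi>" for \<phi>
    using that unfolding \<Phi>_def R_def
  proof (elim UnE)
    assume "\<phi> \<in> (\<lambda>k. EqV (ts ! k) (Var (n + k))) ` {..<length ts}"
    then obtain k where "k < length ts" "\<phi> = EqV (ts ! k) (Var (n + k))" by auto
    then show ?thesis using ts_m[of k] by (auto simp: scoped_trm_iff)
  next
    assume "\<phi> \<in> {no_relation l u | l u. gset u \<subseteq> {..<l} \<and> vset u \<subseteq> {..<n} \<and> (\<exists>k. coef Y u k \<noteq> 0)}"
    then show ?thesis by (auto intro!: scoped_no_relation)
  qed (auto simp: scoped_diagram trans_less_add1[OF idx_m])
  let ?x = "(map \<alpha> [0..<m], map v [0..<n])"
  have sat_c: "sat N \<phi> (?x \<frown> c)" if "\<phi> \<in> \<Phi>" for \<phi>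
    using that unfolding \<Phi>_def
  proof (elim UnE)
    assume "\<phi> \<in> {diagram A m}"
    moreover have "partial_embedding A B ((!) (map \<alpha> [0..<m] @ fst c)) {..<m}"
      by (rule partial_embedding_cong[of _ \<alpha>])
        (use r(3) partial_embedding_subset[OF _ subset_UNIV] in \<open>auto simp: emb_def nth_append\<close>)
    ultimately show ?thesis using emb_in_gam[OF r(3)]
      by (simp add: sat_diagram[OF A(2)] tapp_def B_def nth_append)
  next
    assume "\<phi> \<in> (\<lambda>i. EqG (idx ! i) (m + i)) ` {..<length idx}"
    then show ?thesis using idx_m r(5) by (auto simp: tapp_def nth_append)
  next
    assume "\<phi> \<in> (\<lambda>k. EqV (ts ! k) (Var (n + k))) ` {..<length ts}"
    then obtain k where k: "k < length ts" "\<phi> = EqV (ts ! k) (Var (n + k))" by auto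
    show ?thesis using tv_append[OF ts_m[OF k(1)], of \<alpha> "fst c" v "snd c"] k r(6)
      by (simp add: tval_eq_tv tapp_def nth_append)
  next
    assume "\<phi> \<in> R"
    then obtain l u k where u: "\<phi> = no_relation l u" "gset u \<subseteq> {..<l}" "vset u \<subseteq> {..<n}" "coef Y u k \<noteq> 0"
      unfolding R_def by blast
    have eq: "tv N u \<beta> ((!) (map v [0..<n] @ snd c)) = tv N u \<beta> v" for \<beta>
      by (rule tv_cong) (use u in \<open>auto simp: nth_append\<close>)
    have "vset u \<subseteq> {..<length (snd (?x \<frown> c))}" using u(3) by (auto simp: tapp_def)
    moreover have "set (snd (?x \<frown> c)) \<subseteq> vec N" using vv sub by (auto simp: tapp_def)
    moreover have "tv N u \<beta> ((!) (snd (?x \<frown> c))) \<noteq> z" if "emb \<beta>" for \<beta>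
      using eq[of \<beta>] indepD[OF r(4) that u(3), of k] u(4) by (auto simp: tapp_def)
    ultimately show ?thesis unfolding u(1) using sat_no_relation[OF u(2)] by blast
  qed
  let ?p = "(\<lambda>\<phi>. (\<phi>, c')) ` \<Phi>"
  have "\<exists>x. realizes N (m, n) ?p x"
  proof (rule saturated[unfolded aleph1_saturated_def, rule_format, of "(set (fst c'), set (snd c'))"],
      intro conjI ballI allI impI)
    fix g assume "g \<in> ?p"
    then show "formula_over (set (fst c'), set (snd c')) (m, n) g"
      using sc len' by (cases c') (auto simp: formula_over_def tuples_def)
  next
    fix p0 assume "finite p0 \<and> p0 \<subseteq> ?p"
    then obtain F where F: "F \<subseteq> \<Phi>" "finite F" "p0 = (\<lambda>\<phi>. (\<phi>, c')) ` F" by (meson finite_subset_image)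
    obtain l where l: "set l = F" using finite_list[OF F(2)] by blast
    let ?\<chi> = "(ExG ^^ m) ((ExV ^^ n) (conjs l))"
    have "sat N (conjs l) (?x \<frown> c)" using sat_c F(1) l by auto
    moreover have "set (map \<alpha> [0..<m]) \<subseteq> gam N" "set (map v [0..<n]) \<subseteq> vec N"
      using emb_in_gam[OF r(3)] vv by auto
    ultimately have "sat N ?\<chi> c" unfolding sat_ExGs sat_ExVs
      by (intro exI[of _ "map \<alpha> [0..<m]"] exI[of _ "map v [0..<n]"] conjI) (simp_all add: tapp_def)
    moreover have "scoped ?\<chi> (shape c')" using sc F(1) l len' by (auto simp: shape_def)
    moreover have "(c' \<frown> ([], [])) = c'" "(c \<frown> ([], [])) = c" by (simp_all add: tapp_def)
    moreover have "([], []) \<in> tuples ({} :: 'g set, {} :: 'v set)" by (simp add: tuples_def)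
    ultimately have "sat N ?\<chi> c'" using same unfolding same_type_def by metis
    then obtain gs vs where g: "length gs = m" "set gs \<subseteq> gam N" "length vs = n" "set vs \<subseteq> vec N"
      "sat N (conjs l) (gs @ fst c', vs @ snd c')" unfolding sat_ExGs sat_ExVs by auto
    then show "\<exists>x. realizes N (m, n) p0 x" using l F(3)
      by (intro exI[of _ "(gs, vs)"]) (auto simp: realizes_def tuples_def carriers_def shape_def tapp_def)
  qed (use sub in \<open>auto intro: countable_finite\<close>)
  then obtain gs vs where g: "length gs = m" "set gs \<subseteq> gam N" "length vs = n" "set vs \<subseteq> vec N"
    and sat: "\<And>\<phi>. \<phi> \<in> \<Phi> \<Longrightarrow> sat N \<phi> (gs @ fst c', vs @ snd c')"
    by (fastforce simp: realizes_def tuples_def carriers_def shape_def tapp_def)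
  have "sat N (diagram A m) (gs @ fst c', vs @ snd c')" by (rule sat) (simp add: \<Phi>_def)
  then have "partial_embedding A B ((!) (gs @ fst c')) {..<m}"
    using g by (subst (asm) sat_diagram[OF A(2)]) (auto simp: B_def nth_append subset_iff)
  then obtain \<alpha>' where \<alpha>': "emb \<alpha>'" "\<And>i. i < m \<Longrightarrow> \<alpha>' i = gs ! i"
    using emb_extend[of "(!) (gs @ fst c')" "{..<m}"] g(1) by (metis finite_lessThan lessThan_iff nth_append)
  \<comment> \<open>\<open>indep\<close> asks that all values lie in \<open>vec N\<close>, so the
    sequence is padded by the zero vector.\<close>
  define v' where "v' k = (if k < n then vs ! k else z)" for k
  have v': "v' k \<in> vec N" for k using g z_vec by (auto simp: v'_def subset_iff)
  have gs: "gs = map \<alpha>' [0..<m]" using \<alpha>' g by (intro nth_equalityI) auto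
  have vs: "vs = map v' [0..<n]" using g by (intro nth_equalityI) (auto simp: v'_def)
  have "indep n v'" unfolding indep_def
  proof (intro conjI allI impI; (elim conjE)?)
    fix \<beta> u k assume u: "emb \<beta>" "vset u \<subseteq> {..<n}" "tv N u \<beta> v' = z"
    show "coef Y u k = 0"
    proof (rule ccontr)
      assume "coef Y u k \<noteq> 0"
      obtain l where l: "gset u \<subseteq> {..<l}" using bound_nat finite_gset by metis
      have "sat N (no_relation l u) (gs @ fst c', vs @ snd c')"
        using l u(2) \<open>coef Y u k \<noteq> 0\<close> by (intro sat) (auto simp: \<Phi>_def R_def)
      moreover have "vset u \<subseteq> {..<length (snd (gs @ fst c', vs @ snd c'))}" using u(2) g by auto
      moreover have "set (snd (gs @ fst c', vs @ snd c')) \<subseteq> vec N" using g sub by auto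
      ultimately have "tv N u \<beta> ((!) (vs @ snd c')) \<noteq> z" using sat_no_relation[OF l] u(1) by fastforce
      moreover have "tv N u \<beta> ((!) (vs @ snd c')) = tv N u \<beta> v'"
        unfolding vs by (rule tv_cong) (use u in \<open>auto simp: nth_append\<close>)
      ultimately show False using u by simp
    qed
  qed (rule v')
  moreover have "fst c' = map \<alpha>' idx"
  proof (rule nth_equalityI)
    fix i assume "i < length (fst c')"
    then have i: "i < length idx" using len' by simp
    have "sat N (EqG (idx ! i) (m + i)) (gs @ fst c', vs @ snd c')" by (rule sat) (use i in \<open>auto simp: \<Phi>_def\<close>)
    then show "fst c' ! i = map \<alpha>' idx ! i" using i idx_m[OF i] \<alpha>' g by (simp add: nth_append)
  qed (simp add: len')
  moreover have "snd c' = map (\<lambda>t. tv N t \<alpha>' v') ts"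
  proof (rule nth_equalityI)
    fix k assume "k < length (snd c')"
    then have k: "k < length ts" using len' by simp
    have "sat N (EqV (ts ! k) (Var (n + k))) (gs @ fst c', vs @ snd c')" by (rule sat) (use k in \<open>auto simp: \<Phi>_def\<close>)
    then show "snd c' ! k = map (\<lambda>t. tv N t \<alpha>' v') ts ! k"
      using tv_append[OF ts_m[OF k], of \<alpha>' "fst c'" v' "snd c'"] k g unfolding gs vs
      by (simp add: tval_eq_tv nth_append)
  qed (simp add: len')
  ultimately show ?thesis using r(1,2) \<alpha>'(1) by (intro repI[of n ts \<alpha>' v'])
qed

text \<open>Reduces independence of combinations of a basis to left linear independence over Q_G of
  the rows of their coefficient matrix.\<close>

lemma indep_terms:
  assumes v: "indep n v" and \<alpha>: "emb \<alpha>" and \<tau>: "\<And>m. m < l \<Longrightarrow> vset (\<tau> m) \<subseteq> {..<n}"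
    and c: "\<And>c :: nat \<Rightarrow> 'q. (\<And>k. k < n \<Longrightarrow> (\<Sum>m<l. c m * coef Y (\<tau> m) k) = 0) \<Longrightarrow> \<forall>m<l. c m = 0"
  shows "indep l (\<lambda>m. tv N (\<tau> m) \<alpha> v)"
  unfolding indep_def
proof (intro conjI allI impI; (elim conjE)?)
  show "tv N (\<tau> m) \<alpha> v \<in> vec N" for m by (rule tv_vec[OF \<alpha>]) (rule indep_vec[OF v])
next
  fix \<beta> t k assume t: "emb \<beta>" "vset t \<subseteq> {..<l}" "tv N t \<beta> (\<lambda>m. tv N (\<tau> m) \<alpha> v) = z"
  obtain \<alpha>' j where a: "emb \<alpha>'" "\<And>i. i \<in> (\<Union>m<l. gset (\<tau> m)) \<Longrightarrow> \<alpha>' i = \<alpha> i"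
    "\<And>i. i \<in> gset t \<Longrightarrow> \<alpha>' (j i) = \<beta> i" "partial_embedding A A j (gset t)"
    using absorb[OF \<alpha> t(1), of "\<Union>m<l. gset (\<tau> m)" "gset t"] by auto
  let ?t = "tren j t"
  have tl: "vset ?t \<subseteq> {..<l}" using t by simp
  have eq: "tv N (\<tau> m) \<alpha>' v = tv N (\<tau> m) \<alpha> v" if "m < l" for m
    by (rule tv_cong) (use a(2) that in auto)
  have "tv N (tsub \<tau> ?t) \<alpha>' v = z"
    unfolding tv_tsub tv_tren t(3)[symmetric] by (rule tv_cong) (use a(3) eq t(2) in auto)
  moreover have "vset (tsub \<tau> ?t) \<subseteq> {..<n}" using t(2) \<tau> by (auto simp: vset_tsub)
  ultimately have "coef Y (tsub \<tau> ?t) k = 0" for k using indepD[OF v a(1)] by blast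
  then have "\<forall>m<l. coef Y ?t m = 0" by (intro c) (simp add: coef_tsub[OF tl])
  then have "coef Y ?t k = 0" using tl by (cases "k < l") (auto intro!: coef_eq_0)
  then show "coef Y t k = 0" using coef_homogeneous_A[OF a(4) subset_refl] by simp
qed

section \<open>Generic extensions of a tuple\<close>

lemma partial_embedding_isolated:
  assumes f: "partial_embedding A' B' f S" and bi: "bipartite A'" "bipartite B'"
    and x: "x \<in> left A'" "x \<notin> S" "\<And>s. s \<in> S \<Longrightarrow> \<not> edge A' x s"
    and y: "y \<in> left B'" "y \<notin> f ` S" "\<And>s. s \<in> S \<Longrightarrow> \<not> edge B' y (f s)"
  shows "partial_embedding A' B' (f(x := y)) (insert x S)"
  unfolding partial_embedding_def
proof (intro conjI ballI)
  show "insert x S \<subseteq> verts A'" using f x by (auto simp: partial_embedding_def verts_def)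
  show "inj_on (f(x := y)) (insert x S)" using f x y by (auto simp: partial_embedding_def inj_on_def)
next
  fix u assume "u \<in> insert x S"
  then show "(u \<in> left A') = ((f(x := y)) u \<in> left B')" "(u \<in> right A') = ((f(x := y)) u \<in> right B')"
    using f x y bi by (auto simp: partial_embedding_def bipartite_def)
next
  have e: "\<not> edge A' u x" "\<not> edge B' w y" for u w using bi x y by (auto simp: bipartite_def)
  fix u w assume "u \<in> insert x S" "w \<in> insert x S"
  then show "edge A' u w = edge B' ((f(x := y)) u) ((f(x := y)) w)"
    using e f x y by (auto simp: partial_embedding_def)
qed

text \<open>A vertex without neighbours in \<open>S\<close> and two successively independent vectors
  always have the same description over \<open>c\<close>. Used for the parameters of a dividing
  formula and for their conjugates, this equates the types over both.\<close>

lemma rep_generic: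
  assumes \<beta>: "emb \<beta>" and b: "indep n b" "0 < n" and ts: "\<And>t. t \<in> set ts \<Longrightarrow> vset t \<subseteq> {..<n}"
    and S: "finite S" "set idx \<subseteq> S" "\<And>t. t \<in> set ts \<Longrightarrow> gset t \<subseteq> S"
    and i: "i \<in> left A" "i \<notin> S" "\<And>s. s \<in> S \<Longrightarrow> \<not> edge A i s"
    and h: "h \<in> left B" "h \<notin> \<beta> ` S" "\<And>s. s \<in> S \<Longrightarrow> \<not> edge B h (\<beta> s)"
    and x: "x1 \<in> vec N" "\<not> dep n b x1" "x2 \<in> vec N" "\<not> dep (Suc n) (b(n := x1)) x2"
    and c: "fst c = map \<beta> idx" "snd c = map (\<lambda>t. tv N t \<beta> b) ts"
  shows "rep (i # idx) (Var n # Var (Suc n) # ts) (Suc (Suc n)) (([h], [x1, x2]) \<frown> c)"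
proof -
  have "partial_embedding A B \<beta> S" using \<beta> partial_embedding_subset[OF _ subset_UNIV] by (auto simp: emb_def)
  then have "partial_embedding A B (\<beta>(i := h)) (insert i S)"
    by (rule partial_embedding_isolated) (use A(3) bipartite_B i h in auto)
  then obtain \<alpha> where \<alpha>: "emb \<alpha>" "\<And>s. s \<in> insert i S \<Longrightarrow> \<alpha> s = (\<beta>(i := h)) s"
    using emb_extend[of "\<beta>(i := h)" "insert i S"] S(1) by blast
  have \<alpha>S: "\<alpha> s = \<beta> s" if "s \<in> S" for s using \<alpha>(2)[of s] that i by auto
  let ?b = "b(n := x1, Suc n := x2)"
  have "indep (Suc (Suc n)) ?b" by (intro indep_extend b x)
  moreover have "tv N t \<alpha> ?b = tv N t \<beta> b" if "t \<in> set ts" for t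
  proof (rule tv_cong)
    show "\<And>i. i \<in> gset t \<Longrightarrow> \<alpha> i = \<beta> i" using \<alpha>S S(3)[OF that] by blast
    fix k assume "k \<in> vset t"
    then have "k < n" using ts[OF that] by blast
    then show "?b k = b k" by simp
  qed
  moreover have "vset t \<subseteq> {..<Suc (Suc n)}" if "t \<in> set (Var n # Var (Suc n) # ts)" for t
    using that ts by fastforce
  moreover have "map \<alpha> idx = map \<beta> idx" using \<alpha>S S(2) by auto
  ultimately show ?thesis using \<alpha> c
    by (intro repI[of _ _ \<alpha> ?b]) (simp_all add: tapp_def)
qed

section \<open>Forking\<close>

text \<open>A realization of the type that is generic over all parameters of the dividing formulas
  satisfies one of them, say \<open>\<phi>\<close> with parameters \<open>c\<close>. For any
  \<open>k\<close> conjugates of \<open>c\<close>, a vertex and two vectors generic over all of them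
  together satisfy the corresponding \<open>k\<close> instances, so \<open>\<phi>\<close> cannot
  divide.\<close>

lemma independent_pair:
  assumes \<alpha>: "emb \<alpha>" and ij: "i \<in> left A" "j \<in> right A" "\<not> edge A i j" and v: "indep 4 v"
  shows "\<not> forks N ([\<alpha> i], [v 2, v 3]) (entries ([\<alpha> j], [v 0, v 1])) ({}, {})"
proof
  let ?a = "([\<alpha> i], [v 2, v 3])"
  assume "forks N ?a (entries ([\<alpha> j], [v 0, v 1])) ({}, {})"
  then obtain F where F: "finite F" "\<And>f. f \<in> F \<Longrightarrow> formula_over (carriers N) (1, 2) f"
      "\<And>f. f \<in> F \<Longrightarrow> divides N ({}, {}) (1, 2) f"
    and cover: "\<And>x. x \<in> tuples (carriers N) \<Longrightarrow> same_type N (entries ([\<alpha> j], [v 0, v 1])) x ?a \<Longrightarrow>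
      \<exists>(\<phi>, c)\<in>F. sat N \<phi> (x \<frown> c)"
    unfolding forks_def by (auto simp: shape_def numeral_2_eq_2)
  have vv: "v k \<in> vec N" for k by (rule indep_vec[OF v])
  \<comment> \<open>One description is to cover \<open>b\<close> together with the parameters of all
    formulas in \<open>F\<close>.\<close>
  let ?PG = "insert (\<alpha> j) (\<Union>f\<in>F. set (fst (snd f)))" and ?PV = "{v 0, v 1} \<union> (\<Union>f\<in>F. set (snd (snd f)))"
  obtain gs where gs: "set gs = ?PG" using F(1) finite_list[of ?PG] by auto
  obtain vs where vs: "set vs = ?PV" using F(1) finite_list[of ?PV] by auto
  have par: "set (fst (snd f)) \<subseteq> gam N" "set (snd (snd f)) \<subseteq> vec N" if "f \<in> F" for f
    using F(2)[OF that] by (auto simp: formula_over_def tuples_def carriers_def in_lists_conv_set split: prod.splits)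
  then have "(\<Union>f\<in>F. set (fst (snd f))) \<subseteq> gam N" "(\<Union>f\<in>F. set (snd (snd f))) \<subseteq> vec N" by blast+
  then have "?PG \<subseteq> gam N" "?PV \<subseteq> vec N" using emb_in_gam[OF \<alpha>] vv by simp_all
  then obtain idx ts n where rep: "rep idx ts n (gs, vs)" using rep_exists[of gs vs] gs vs by auto
  obtain \<beta> b where r: "0 < n" "\<And>t. t \<in> set ts \<Longrightarrow> vset t \<subseteq> {..<n}" "emb \<beta>" "indep n b"
    "gs = map \<beta> idx" "vs = map (\<lambda>t. tv N t \<beta> b) ts" using rep by (rule repE) auto
  let ?S = "set idx \<union> (\<Union>t\<in>set ts. gset t)"
  have S: "finite ?S" by simp
  \<comment> \<open>A vertex without neighbours in \<open>?S\<close> agrees with the type of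
    \<open>\<alpha> i\<close> over \<open>\<alpha> j\<close> precisely because \<open>i\<close> and
    \<open>j\<close> are not adjacent.\<close>
  obtain i' where i': "i' \<in> left A" "i' \<notin> ?S" "\<forall>w\<in>?S \<inter> right A. \<not> edge A i' w"
    using extension_avoiding_left[OF A(1), of "{}" "?S \<inter> right A" ?S] by auto
  have i'S: "\<not> edge A i' s" if "s \<in> ?S" for s using i'(3) that A(3) by (auto simp: bipartite_def)
  have bb: "b k \<in> vec N" for k by (rule indep_vec[OF r(4)])
  obtain x1 where x1: "x1 \<in> vec N" "\<not> dep n b x1" using not_dep_exists[of b n, OF bb] by blast
  have bb1: "(b(n := x1)) k \<in> vec N" for k using bb x1 by simp
  obtain x2 where x2: "x2 \<in> vec N" "\<not> dep (Suc n) (b(n := x1)) x2"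
    using not_dep_exists[of "b(n := x1)" "Suc n", OF bb1] by blast
  let ?a' = "([\<beta> i'], [x1, x2])"
  note pe\<alpha> = partial_embeddingD[OF \<alpha>[unfolded emb_def], OF UNIV_I]
  note pe\<beta> = partial_embeddingD[OF r(3)[unfolded emb_def], OF UNIV_I]
  have a': "?a' \<in> tuples (carriers N)"
    using emb_in_gam[OF r(3)] x1 x2 by (simp add: tuples_def carriers_def)
  have "same_type N (entries ([\<alpha> j], [v 0, v 1])) ?a' ?a"
  proof -
    have "\<alpha> j \<in> set gs" "v 0 \<in> set vs" "v 1 \<in> set vs" using gs vs by auto
    then obtain j' t0 t1 where j': "j' \<in> set idx" "\<alpha> j = \<beta> j'" and t0: "t0 \<in> set ts" "v 0 = tv N t0 \<beta> b"
      and t1: "t1 \<in> set ts" "v 1 = tv N t1 \<beta> b" unfolding r(5,6) by auto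
    let ?w = "v(2 := x1, 3 := x2)"
    have "indep 2 v" by (rule indep_subfamily[OF v, of id]) (use vv in auto)
    moreover have "\<not> dep 2 v x1"
    proof
      assume "dep 2 v x1"
      have "dep n b x1"
        by (rule dep_mono[OF r(3) bb x1(1) _ _ \<open>dep 2 v x1\<close>, of "\<lambda>k. if k = 0 then t0 else t1"])
          (use t0 t1 r(2) in \<open>auto simp: less_2_cases_iff\<close>)
      then show False using x1 by simp
    qed
    ultimately have i3: "indep 3 (v(2 := x1))"
      using indep_extend[of 2 v x1] x1(1) by (simp add: numeral_2_eq_2 numeral_3_eq_3)
    have "\<not> dep 3 (v(2 := x1)) x2"
    proof
      assume d: "dep 3 (v(2 := x1)) x2"
      have e: "tv N t \<beta> (b(n := x1)) = tv N t \<beta> b" if "t \<in> set ts" for t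
        by (rule tv_cong) (use r(2)[OF that] in auto)
      let ?\<tau> = "\<lambda>k. if k = 0 then t0 else if k = 1 then t1 else Var n"
      have "dep (Suc n) (b(n := x1)) x2"
      proof (rule dep_mono[OF r(3) bb1 x2(1) _ _ d, of ?\<tau>])
        fix k :: nat assume "k < 3"
        then have k: "k = 0 \<or> k = 1 \<or> k = 2" by linarith
        have "vset t0 \<subseteq> {..<Suc n}" "vset t1 \<subseteq> {..<Suc n}"
          using r(2)[OF t0(1)] r(2)[OF t1(1)] by (auto simp: less_Suc_eq)
        then show "vset (?\<tau> k) \<subseteq> {..<Suc n}" by simp
        show "(v(2 := x1)) k = tv N (?\<tau> k) \<beta> (b(n := x1))"
          using k e[OF t0(1)] e[OF t1(1)] t0(2) t1(2) by auto
      qed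
      then show False using x2 by simp
    qed
    then have w: "indep 4 ?w" using indep_extend[OF i3 x2(1)] by (simp add: numeral_3_eq_3 eval_nat_numeral)
    have jA: "j' \<in> right A" using ij(2) pe\<alpha>(2)[of j] pe\<beta>(2)[of j'] j' by simp
    have nij: "i \<noteq> j" "i' \<noteq> j'" using ij i' jA A(3) by (auto simp: bipartite_def)
    have parts: "left A \<inter> right A = {}" using A(3) by (simp add: bipartite_def)
    have "\<not> edge A j w" "\<not> edge A j' w" "\<not> edge A w i" "\<not> edge A w i'" for w
      using ij(1,2) i'(1) jA A(3) unfolding bipartite_def by blast+
    then have "partial_embedding A A (\<lambda>x. if x = i then i' else j') {i, j}"
      unfolding partial_embedding_def
      using ij i'(1) i'S[of j'] j'(1) jA A(2) nij parts by (auto simp: inj_on_def)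
    then have "partial_embedding A B (\<beta> \<circ> (\<lambda>x. if x = i then i' else j')) {i, j}"
      by (rule partial_embedding_compose)
        (use r(3) partial_embedding_subset[OF _ subset_UNIV] in \<open>auto simp: emb_def\<close>)
    then obtain \<alpha>' where \<alpha>': "emb \<alpha>'" "\<And>x. x \<in> {i, j} \<Longrightarrow> \<alpha>' x = (\<beta> \<circ> (\<lambda>x. if x = i then i' else j')) x"
      using emb_extend by (metis finite.emptyI finite_insert)
    have \<alpha>'ij: "\<alpha>' i = \<beta> i'" "\<alpha>' j = \<alpha> j" using \<alpha>'(2)[of i] \<alpha>'(2)[of j] nij j' by auto
    let ?I = "[i, j]" and ?T = "[Var 0, Var 1, Var 2, Var 3]"
    have e1: "rep ?I ?T 4 ([\<alpha> i, \<alpha> j], [v 0, v 1, v 2, v 3])"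
      by (rule repI[OF _ _ \<alpha> v]) auto
    have e2: "rep ?I ?T 4 ([\<beta> i', \<alpha> j], [v 0, v 1, x1, x2])"
      by (rule repI[OF _ _ \<alpha>'(1) w]) (auto simp: \<alpha>'ij)
    show ?thesis
      unfolding same_type_def
    proof (intro conjI ballI allI impI)
      fix p \<phi> assume p: "p \<in> tuples (entries ([\<alpha> j], [v 0, v 1]))" and \<phi>: "scoped \<phi> (shape (?a' \<frown> p))"
      obtain "is" where "is": "fst p = map ((!) [\<alpha> j]) is" "\<forall>k\<in>set is. k < length [\<alpha> j]"
        by (rule list_positions[of "fst p" "[\<alpha> j]"])
          (use p in \<open>auto simp: tuples_def entries_def\<close>)
      obtain ks where ks: "snd p = map ((!) [v 0, v 1]) ks" "\<forall>k\<in>set ks. k < length [v 0, v 1]"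
        by (rule list_positions[of "snd p" "[v 0, v 1]"])
          (use p in \<open>auto simp: tuples_def entries_def\<close>)
      \<comment> \<open>In the joint description the entries of \<open>b\<close> occupy vertex
        position 1 and vector positions 0 and 1; the entries of \<open>?a\<close> or
        \<open>?a'\<close> occupy 0, and 2 and 3, but precede \<open>p\<close> in the tuple.\<close>
      let ?is = "0 # map Suc is" and ?ks = "2 # 3 # ks"
      have b: "\<forall>i\<in>set ?is. i < length ?I" "\<forall>k\<in>set ?ks. k < length ?T" using "is" ks by auto
      have sub: "(map ((!) [g, \<alpha> j]) ?is, map ((!) [v 0, v 1, y1, y2]) ?ks) = ([g], [y1, y2]) \<frown> p" for g y1 y2
      proof -
        have "[v 0, v 1, y1, y2] ! k = [v 0, v 1] ! k" if "k \<in> set ks" for k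
        proof -
          have "k = 0 \<or> k = 1" using ks(2) that by fastforce
          then show ?thesis by auto
        qed
        then show ?thesis using "is" ks by (cases p) (simp add: tapp_def)
      qed
      have "rep (map ((!) ?I) ?is) (map ((!) ?T) ?ks) 4 (?a \<frown> p)"
        using rep_subtuple[OF e1 b] sub by simp
      moreover have "rep (map ((!) ?I) ?is) (map ((!) ?T) ?ks) 4 (?a' \<frown> p)"
        using rep_subtuple[OF e2 b] sub by simp
      moreover have "scoped \<phi> (length (map ((!) ?I) ?is), length (map ((!) ?T) ?ks))"
        using \<phi> "is" ks by (simp add: shape_def tapp_def)
      ultimately show "sat N \<phi> (?a' \<frown> p) = sat N \<phi> (?a \<frown> p)" using rep_same_formulas by blast
    qed (simp add: shape_def)
  qed
  then obtain \<phi> c where f: "(\<phi>, c) \<in> F" "sat N \<phi> (?a' \<frown> c)" using cover[OF a'] by auto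
  obtain "is" where "is": "fst c = map ((!) gs) is" "\<forall>k\<in>set is. k < length gs"
    by (rule list_positions[of "fst c" gs]) (use gs f in force)+
  obtain ks where ks: "snd c = map ((!) vs) ks" "\<forall>k\<in>set ks. k < length vs"
    by (rule list_positions[of "snd c" vs]) (use vs f in force)+
  define idxc where "idxc = map ((!) idx) is"
  define tsc where "tsc = map ((!) ts) ks"
  have sub: "set idxc \<subseteq> set idx" "set tsc \<subseteq> set ts"
    using "is" ks r(5,6) by (auto simp: idxc_def tsc_def)
  have c: "fst c = map \<beta> idxc" "snd c = map (\<lambda>t. tv N t \<beta> b) tsc"
    using "is" ks r(5,6) by (auto simp: idxc_def tsc_def)
  have tsc: "vset t \<subseteq> {..<n}" if "t \<in> set tsc" for t using sub(2) that by (auto intro!: r(2))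
  have Sc: "set idxc \<subseteq> ?S" "\<And>t. t \<in> set tsc \<Longrightarrow> gset t \<subseteq> ?S" using sub by auto
  have repc: "rep idxc tsc n c" by (rule repI[OF r(1) tsc r(3,4) c])
  have iB: "\<beta> i' \<in> left B" "\<beta> i' \<notin> \<beta> ` ?S" "\<And>s. s \<in> ?S \<Longrightarrow> \<not> edge B (\<beta> i') (\<beta> s)"
    using i' i'S pe\<beta>(1)[of i'] pe\<beta>(3)[OF UNIV_I] pe\<beta>(6)[OF UNIV_I] by auto
  have repa: "rep (i' # idxc) (Var n # Var (Suc n) # tsc) (Suc (Suc n)) (?a' \<frown> c)"
    by (rule rep_generic[OF r(3,4,1) tsc S Sc i'(1,2) i'S iB x1 x2 c])
  have "\<exists>k (b' :: nat \<Rightarrow> _). (\<forall>l. b' l \<in> tuples (carriers N) \<and> same_type N ({}, {}) (b' l) c) \<and>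
      (\<forall>K. finite K \<and> card K = k \<longrightarrow> \<not> (\<exists>x. realizes N (1, 2) ((\<lambda>l. (\<phi>, b' l)) ` K) x))"
    using F(3)[OF f(1)] unfolding divides_def prod.case .
  then obtain k and b' :: "nat \<Rightarrow> ('g, 'v) tuple" where 1: "\<forall>l. b' l \<in> tuples (carriers N) \<and> same_type N ({}, {}) (b' l) c"
    and incons: "\<forall>K. finite K \<and> card K = k \<longrightarrow> \<not> (\<exists>x. realizes N (1, 2) ((\<lambda>l. (\<phi>, b' l)) ` K) x)"
    by (elim exE conjE)
  have b': "b' l \<in> tuples (carriers N)" "same_type N ({}, {}) (b' l) c" for l using 1 by auto
  have "\<exists>\<alpha> v. emb \<alpha> \<and> indep n v \<and> fst (b' l) = map \<alpha> idxc \<and> snd (b' l) = map (\<lambda>t. tv N t \<alpha> v) tsc" for l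
    using rep_transfer[OF repc b'] by (rule repE) blast
  then obtain \<alpha>s ws where l: "\<And>l. emb (\<alpha>s l)" "\<And>l. indep n (ws l)" "\<And>l. fst (b' l) = map (\<alpha>s l) idxc"
    "\<And>l. snd (b' l) = map (\<lambda>t. tv N t (\<alpha>s l) (ws l)) tsc" by metis
  \<comment> \<open>All vertices used by the first \<open>k\<close> conjugates, each in its own
    frame.\<close>
  let ?Z = "\<Union>l<k. \<alpha>s l ` ?S"
  obtain h where h: "h \<in> left B" "h \<notin> ?Z" "\<forall>w\<in>?Z \<inter> right B. \<not> edge B h w"
    using extension_avoiding_left[OF B_extension, of "{}" "?Z \<inter> right B" ?Z] by auto
  have hZ: "\<not> edge B h w" if "w \<in> ?Z" for w using h(3) that bipartite_B by (auto simp: bipartite_def)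
  \<comment> \<open>The bases of the conjugates are concatenated into one sequence in blocks of
    length \<open>n\<close>. It need not be independent: the new vectors only have to avoid its
    span.\<close>
  define V where "V q = ws (q div n) (q mod n)" for q
  have V: "V q \<in> vec N" for q unfolding V_def by (rule indep_vec[OF l(2)])
  have wV: "ws m q = V (m * n + q)" if "q < n" for m q using that by (simp add: V_def)
  have bound: "m * n + q < k * n" if "m < k" "q < n" for m q
  proof -
    have "m * n + q < Suc m * n" using that by simp
    also have "\<dots> \<le> k * n" using that by (intro mult_right_mono) auto
    finally show ?thesis .
  qed
  obtain y1 where y1: "y1 \<in> vec N" "\<not> dep (k * n) V y1" using not_dep_exists[of V "k * n", OF V] by blast
  have V1: "(V(k * n := y1)) q \<in> vec N" for q using V y1 by simp
  obtain y2 where y2: "y2 \<in> vec N" "\<not> dep (Suc (k * n)) (V(k * n := y1)) y2"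
    using not_dep_exists[of "V(k * n := y1)" "Suc (k * n)", OF V1] by blast
  let ?x = "([h], [y1, y2])"
  have "sat N \<phi> (?x \<frown> b' m)" if m: "m < k" for m
  proof -
    have d1: "\<not> dep n (ws m) y1"
      using dep_mono_var[of V y1 n "\<lambda>q. m * n + q" "k * n" "ws m", OF V y1(1)] bound[OF m] wV y1(2) by blast
    have d2: "\<not> dep (Suc n) ((ws m)(n := y1)) y2"
    proof
      assume "dep (Suc n) ((ws m)(n := y1)) y2"
      then have "dep (Suc (k * n)) (V(k * n := y1)) y2"
        by (rule dep_mono_var[of "V(k * n := y1)" y2 "Suc n" "\<lambda>q. if q = n then k * n else m * n + q" _ _,
              OF V1 y2(1), rotated 2])
          (use bound[OF m] less_imp_neq[OF bound[OF m]] wV[of _ m] in \<open>auto simp: less_Suc_eq\<close>)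
      then show False using y2 by simp
    qed
    have hB: "h \<notin> \<alpha>s m ` ?S" "\<And>s. s \<in> ?S \<Longrightarrow> \<not> edge B h (\<alpha>s m s)" using h(2) hZ m by blast+
    have "rep (i' # idxc) (Var n # Var (Suc n) # tsc) (Suc (Suc n)) (?x \<frown> b' m)"
      by (rule rep_generic[OF l(1) l(2) r(1) tsc S Sc i'(1,2) i'S h(1) hB y1(1) d1 y2(1) d2 l(3,4)])
    moreover have "scoped \<phi> (length (i' # idxc), length (Var n # Var (Suc n) # tsc))"
      using F(2)[OF f(1)] c by (simp add: formula_over_def)
    ultimately show ?thesis using rep_same_formulas[OF repa] f(2) by blast
  qed
  then have "realizes N (1, 2) ((\<lambda>l. (\<phi>, b' l)) ` {..<k}) ?x"
    using h(1) y1(1) y2(1) by (auto simp: realizes_def tuples_def carriers_def shape_def B_simps)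
  then show False using spec[OF incons, of "{..<k}"] by (simp del: split_paired_Ex)
qed

section \<open>The square configuration and its dependence on the edge\<close>

definition U1 :: "nat \<Rightarrow> trm" where "U1 i = Plus (Var 1) (Scale (-1) (Act i (Var 0)))"
definition U2 :: "nat \<Rightarrow> trm" where "U2 i = Plus (Var 3) (Scale (-1) (Act i (Var 2)))"
definition W1 :: "nat \<Rightarrow> trm" where "W1 j = Plus (Var 2) (Scale (-1) (Act j (Var 0)))"
definition W2 :: "nat \<Rightarrow> trm" where "W2 j = Plus (Var 3) (Scale (-1) (Act j (Var 1)))"

lemmas UW_defs = U1_def U2_def W1_def W2_def

definition left_tuple :: "(nat \<Rightarrow> 'g) \<Rightarrow> (nat \<Rightarrow> 'v) \<Rightarrow> nat \<Rightarrow> ('g, 'v) tuple" where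
  "left_tuple \<alpha> e i = ([\<alpha> i], [tv N (U1 i) \<alpha> e, tv N (U2 i) \<alpha> e])"

definition right_tuple :: "(nat \<Rightarrow> 'g) \<Rightarrow> (nat \<Rightarrow> 'v) \<Rightarrow> nat \<Rightarrow> ('g, 'v) tuple" where
  "right_tuple \<alpha> e j = ([\<alpha> j], [tv N (W1 j) \<alpha> e, tv N (W2 j) \<alpha> e])"

lemma independent_tuples:
  assumes \<alpha>: "emb \<alpha>" and ij: "i \<in> left A" "j \<in> right A" "\<not> edge A i j" and e: "indep 4 e"
  shows "forking_independent N (left_tuple \<alpha> e i) (right_tuple \<alpha> e j)"
proof -
  \<comment> \<open>The entries of \<open>b\<close> come first, to match positions 0 and 1 in
    \<open>independent_pair\<close>.\<close>
  let ?\<tau> = "\<lambda>m. if m = 0 then W1 j else if m = 1 then W2 j else if m = (2::nat) then U1 i else U2 i"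
  have anti: "Y i * Y j = - (Y j * Y i)" using Y_relations(2)[OF ij] .
  have "indep 4 (\<lambda>m. tv N (?\<tau> m) \<alpha> e)"
  proof (rule indep_terms[OF e \<alpha>])
    fix c :: "nat \<Rightarrow> 'q"
    assume c: "\<And>k. k < 4 \<Longrightarrow> (\<Sum>m<4. c m * coef Y (?\<tau> m) k) = 0"
    have s: "(\<Sum>m<4. f m) = f 0 + f 1 + f 2 + f (3::nat)" for f :: "nat \<Rightarrow> 'q"
      by (simp add: eval_nat_numeral)
    \<comment> \<open>One equation for each corner of the square. Corners 1 to 3 express everything
      through \<open>c 1\<close>, and corner 0 then says that \<open>c 1\<close> annihilates the
      commutator, which is twice a product by anticommutation and hence invertible.\<close>
    have c0: "- (c 0 * Y j) - c 2 * Y i = 0" using c[of 0] by (simp add: s UW_defs)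
    have c1: "- (c 1 * Y j) + c 2 = 0" using c[of 1] by (simp add: s UW_defs)
    have c2: "c 0 - c 3 * Y i = 0" using c[of 2] by (simp add: s UW_defs)
    have c3: "c 1 + c 3 = 0" using c[of 3] by (simp add: s UW_defs)
    have 3: "c 3 = - c 1" using c3 by (simp add: eq_neg_iff_add_eq_0 add.commute)
    have 2: "c 2 = c 1 * Y j" using c1 by simp
    have 0: "c 0 = - (c 1 * Y i)" using c2 3 by (simp add: eq_neg_iff_add_eq_0)
    have "c 1 * (Y i * Y j) - c 1 * (Y j * Y i) = 0" using c0 0 2 by (simp add: mult.assoc)
    then have "- (c 1 * (Y j * Y i)) = c 1 * (Y j * Y i)" unfolding anti by simp
    then have "c 1 * (Y j * Y i) + c 1 * (Y j * Y i) = 0" by (simp only: neg_eq_iff_add_eq_0)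
    then have "2 * (c 1 * (Y j * Y i)) = 0" by (simp only: mult_2)
    then have "c 1 = 0" using Y_nonzero by simp
    then show "\<forall>m<4. c m = 0" using 0 2 3 by (auto simp: less_Suc_eq numeral_eq_Suc)
  qed (auto simp: UW_defs)
  from independent_pair[OF \<alpha> ij this]
  show ?thesis by (simp add: forking_independent_def left_tuple_def right_tuple_def)
qed

lemma dependent_tuples:
  assumes \<alpha>: "emb \<alpha>" and ij: "i \<in> left A" "j \<in> right A" "edge A i j" and e: "indep 4 e"
  shows "\<not> forking_independent N (left_tuple \<alpha> e i) (right_tuple \<alpha> e j)"
proof -
  let ?a = "left_tuple \<alpha> e i" and ?b = "right_tuple \<alpha> e j"
  \<comment> \<open>Vertex variables 0 and 1 are x and y; vector variables 0 to 3 are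
    \<open>u\<^sub>1\<close>, \<open>u\<^sub>2\<close>, \<open>w\<^sub>1\<close>,
    \<open>w\<^sub>2\<close>.\<close>
  let ?l = "Plus (Var 1) (Scale (-1) (Act 1 (Var 0)))" and ?r = "Plus (Var 3) (Scale (-1) (Act 0 (Var 2)))"
  let ?\<phi> = "EqV ?l ?r"
  let ?I = "[i, j]" and ?T = "[U1 i, U2 i, W1 j, W2 j]"
  have comm: "Y i * Y j = Y j * Y i" using Y_relations(1)[OF ij] .
  have ee: "e k \<in> vec N" for k by (rule indep_vec[OF e])
  have ab: "?a \<frown> ?b = (map \<alpha> ?I, map (\<lambda>t. tv N t \<alpha> e) ?T)"
    by (simp add: left_tuple_def right_tuple_def tapp_def)
  have "coef Y (comp ?I ?T ?l) k = coef Y (comp ?I ?T ?r) k" for k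
    using comm by (simp add: comp_def UW_defs numeral_eq_Suc)
  then have "tv N (comp ?I ?T ?l) \<alpha> e = tv N (comp ?I ?T ?r) \<alpha> e" by (rule tv_eqI[OF \<alpha> ee])
  moreover have "scoped_trm ?l (length ?I, length ?T)" "scoped_trm ?r (length ?I, length ?T)" by auto
  ultimately have sat: "sat N ?\<phi> (?a \<frown> ?b)" unfolding ab sat.simps by (simp only: tval_rep)
  have bN: "?b \<in> tuples (carriers N)"
    using emb_in_gam[OF \<alpha>] tv_vec[of \<alpha> e, OF \<alpha> ee] by (simp add: right_tuple_def tuples_def carriers_def)
  have sh: "shape ?a = (1, 2)" by (simp add: left_tuple_def shape_def)
  have over: "formula_over (carriers N) (1, 2) (?\<phi>, ?b)"
    using bN by (simp add: formula_over_def right_tuple_def)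
  have cover: "sat N ?\<phi> (x \<frown> ?b)" if "same_type N (entries ?b) x ?a" for x
  proof -
    have "?b \<in> tuples (entries ?b)" by (simp add: tuples_def entries_def right_tuple_def)
    moreover have "scoped ?\<phi> (shape (x \<frown> ?b))"
      using that sh by (simp add: same_type_def shape_def tapp_def right_tuple_def)
    ultimately show ?thesis using that sat unfolding same_type_def by blast
  qed
  have "divides N ({}, {}) (1, 2) (?\<phi>, ?b)"
  proof -
    obtain f where f: "\<And>n. indep n f" using indep_sequence by blast
    have fv: "f k \<in> vec N" for k by (rule indep_vec[OF f])
    \<comment> \<open>The vertex y is kept and the pairs of vectors are disjoint segments of one
      independent sequence.\<close>
    define b' where "b' l = ([\<alpha> j], [f (2 * l), f (2 * l + 1)])" for l
    have "indep 2 (\<lambda>m. tv N (if m = 0 then W1 j else W2 j) \<alpha> e)"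
    proof (rule indep_terms[OF e \<alpha>])
      fix c :: "nat \<Rightarrow> 'q"
      assume c: "\<And>k. k < 4 \<Longrightarrow> (\<Sum>m<2. c m * coef Y (if m = 0 then W1 j else W2 j) k) = 0"
      have "c 0 = 0" "c 1 = 0" using c[of 2] c[of 3] by (simp_all add: UW_defs numeral_2_eq_2)
      then show "\<forall>m<2. c m = 0" by (auto simp: less_2_cases_iff)
    qed (auto simp: UW_defs)
    then have repb: "rep [j] [Var 0, Var 1] 2 ?b"
      by (intro repI[OF _ _ \<alpha>]) (auto simp: right_tuple_def)
    have repb': "rep [j] [Var 0, Var 1] 2 (b' l)" for l
    proof -
      have "indep 2 (\<lambda>m. f (2 * l + m))"
        by (rule indep_subfamily[OF f[of "2 * l + 2"], of "\<lambda>m. 2 * l + m"]) (use fv in auto)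
      then show ?thesis by (intro repI[OF _ _ \<alpha>]) (auto simp: b'_def)
    qed
    have incons: "\<not> (\<exists>x. realizes N (1, 2) ((\<lambda>l. (?\<phi>, b' l)) ` K) x)" if K: "card K = 2" for K
    proof
      assume "\<exists>x. realizes N (1, 2) ((\<lambda>l. (?\<phi>, b' l)) ` K) x"
      then obtain x where x: "realizes N (1, 2) ((\<lambda>l. (?\<phi>, b' l)) ` K) x" ..
      then obtain g u u' where xg: "x = ([g], [u, u'])" "g \<in> gam N"
        by (cases x) (auto simp: realizes_def shape_def tuples_def carriers_def length_Suc_conv numeral_2_eq_2)
      obtain l l' where ll: "l \<in> K" "l' \<in> K" "l \<noteq> l'" using K by (auto simp: card_2_iff)
      obtain \<alpha>' s where \<alpha>': "emb \<alpha>'" "\<alpha>' s = g"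
        using embedding_reach[of A B \<alpha> "{}" g] \<alpha> A B_extension xg verts_B unfolding emb_def by auto
      \<comment> \<open>As y is the same in all instances, so is the left side of the formula, and
        the right sides at \<open>l\<close> and \<open>l'\<close> agree. The vertex \<open>g\<close>
        is arbitrary, but independence is over all vertices, and \<open>f (2 * l + 1)\<close> has
        coefficient 1 on one side and 0 on the other.\<close>
      let ?t = "\<lambda>l. Plus (Var (2 * l + 1)) (Scale (-1) (Act s (Var (2 * l))))"
      have "tv N (?t m) \<alpha>' f = plusV N u' (ratV N (-1) (actV N (\<alpha> j) u))" if "m \<in> K" for m
      proof -
        have "sat N ?\<phi> (x \<frown> b' m)" using x that by (auto simp: realizes_def)
        then show ?thesis using \<alpha>' by (simp add: xg b'_def tapp_def)
      qed
      then have "tv N (?t l) \<alpha>' f = tv N (?t l') \<alpha>' f" using ll by metis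
      then have "coef Y (?t l) (2 * l + 1) = coef Y (?t l') (2 * l + 1)"
        by (rule indep_eqD[OF f[of "2 * (l + l') + 2"] \<alpha>'(1), rotated 2]) auto
      moreover have "2 * l + 1 \<noteq> 2 * l'" by presburger
      ultimately show False using ll(3) by simp
    qed
    show ?thesis unfolding divides_def prod.case
    proof (intro exI[of _ 2] exI[of _ b'] conjI allI impI)
      show "b' l \<in> tuples (carriers N)" for l by (rule rep_tuples[OF repb'])
      show "same_type N ({}, {}) (b' l) ?b" for l by (rule rep_same_type[OF repb' repb])
    qed (use incons in blast)
  qed
  then have "forks N ?a (entries ?b) ({}, {})"
    unfolding forks_def sh using over cover by (intro exI[of _ "{(?\<phi>, ?b)}"]) auto
  then show ?thesis by (simp add: forking_independent_def)
qed

section \<open>Indiscernibility of the half graph sequence\<close>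

lemma strict_sorted_map_exists:
  fixes xs ys :: "nat list"
  assumes "length xs = length ys" "sorted_wrt (<) xs" "sorted_wrt (<) ys"
  obtains \<theta> where "ys = map \<theta> xs" "\<And>x y. x \<in> set xs \<Longrightarrow> y \<in> set xs \<Longrightarrow> \<theta> x < \<theta> y \<longleftrightarrow> x < y"
proof -
  have d: "distinct xs" using assms(2) by (simp add: strict_sorted_iff)
  define \<theta> where "\<theta> x = the (map_of (zip xs ys) x)" for x
  have nth: "\<theta> (xs ! k) = ys ! k" if "k < length xs" for k
    using that assms(1) d by (simp add: \<theta>_def map_of_zip_nth)
  have lt: "\<theta> x < \<theta> y" if xy: "x \<in> set xs" "y \<in> set xs" "x < y" for x y
  proof -
    obtain k l where kl: "k < length xs" "l < length xs" "x = xs ! k" "y = xs ! l"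
      using xy(1,2) by (metis in_set_conv_nth)
    have "k < l" using xy kl assms(2)
      by (metis linorder_neqE_nat order_less_asym sorted_wrt_nth_less order_less_irrefl)
    then show ?thesis using kl nth assms sorted_wrt_nth_less[of "(<)" ys k l] by simp
  qed
  have "ys = map \<theta> xs" using assms(1) nth by (intro nth_equalityI) auto
  moreover have "\<theta> x < \<theta> y \<longleftrightarrow> x < y" if "x \<in> set xs" "y \<in> set xs" for x y
    using lt[of x y] lt[of y x] that by (cases x y rule: linorder_cases) auto
  ultimately show thesis using that by blast
qed

text \<open>An order preserving change of indices is a partial embedding of the half graph, so it is
  absorbed into a new frame \<open>\<beta>\<close>. The vectors \<open>e\<close> need not be moved,
  since they are independent over all vertices. The subsequence at \<open>ys\<close> for
  \<open>\<alpha>\<close> is then the one at \<open>xs\<close> for \<open>\<beta>\<close>, with the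
  same description as the one at \<open>xs\<close> for \<open>\<alpha>\<close>.\<close>

lemma indiscernible_half_graph:
  assumes f: "partial_embedding half_graph A f UNIV" and \<alpha>: "emb \<alpha>" and e: "indep 4 e"
  shows "indiscernible N (\<lambda>k. left_tuple \<alpha> e (f (2 * k)) \<frown> right_tuple \<alpha> e (f (2 * k + 1)))"
proof -
  let ?c = "\<lambda>\<alpha> k. left_tuple \<alpha> e (f (2 * k)) \<frown> right_tuple \<alpha> e (f (2 * k + 1))"
  let ?I = "\<lambda>xs. concat (map (\<lambda>k. [f (2 * k), f (2 * k + 1)]) xs)"
  let ?T = "\<lambda>xs. concat (map (\<lambda>k. [U1 (f (2 * k)), U2 (f (2 * k)), W1 (f (2 * k + 1)), W2 (f (2 * k + 1))]) xs)"
  have c: "?c \<alpha> k = (map \<alpha> [f (2 * k), f (2 * k + 1)],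
    map (\<lambda>t. tv N t \<alpha> e) [U1 (f (2 * k)), U2 (f (2 * k)), W1 (f (2 * k + 1)), W2 (f (2 * k + 1))])" for \<alpha> k
    by (simp add: left_tuple_def right_tuple_def tapp_def)
  have rep: "rep (?I xs) (?T xs) 4 (tconcat (map (?c \<alpha>) xs))" if "emb \<alpha>" for \<alpha> xs
  proof (rule repI[OF _ _ that e])
    show "fst (tconcat (map (?c \<alpha>) xs)) = map \<alpha> (?I xs)"
      by (induction xs) (simp_all add: tconcat_def left_tuple_def right_tuple_def tapp_def)
    show "snd (tconcat (map (?c \<alpha>) xs)) = map (\<lambda>t. tv N t \<alpha> e) (?T xs)"
      by (induction xs) (simp_all add: tconcat_def left_tuple_def right_tuple_def tapp_def)
  qed (auto simp: UW_defs)
  have "same_type N ({}, {}) (tconcat (map (?c \<alpha>) xs)) (tconcat (map (?c \<alpha>) ys))"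
    if len: "length xs = length ys" and xs: "sorted_wrt (<) xs" and ys: "sorted_wrt (<) ys" for xs ys
  proof -
    obtain \<theta> where \<theta>: "ys = map \<theta> xs" "\<And>x y. x \<in> set xs \<Longrightarrow> y \<in> set xs \<Longrightarrow> \<theta> x < \<theta> y \<longleftrightarrow> x < y"
      using strict_sorted_map_exists[OF len xs ys] by blast
    define D where "D = (\<lambda>k. 2 * k) ` set xs \<union> (\<lambda>k. 2 * k + 1) ` set xs"
    \<comment> \<open>Moves both vertices of the pair with index \<open>x div 2\<close>; the parity,
      and with it the part, is kept.\<close>
    define \<mu> where "\<mu> x = 2 * \<theta> (x div 2) + x mod 2" for x
    have D2: "x div 2 \<in> set xs" if "x \<in> D" for x using that by (auto simp: D_def)
    have "inj_on \<mu> D"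
    proof (rule inj_onI)
      fix x y assume x: "x \<in> D" and y: "y \<in> D" and eq: "\<mu> x = \<mu> y"
      have "\<mu> x div 2 = \<mu> y div 2" "\<mu> x mod 2 = \<mu> y mod 2" using eq by simp_all
      then have "\<theta> (x div 2) = \<theta> (y div 2)" and m: "x mod 2 = y mod 2" by (simp_all add: \<mu>_def)
      then have "x div 2 = y div 2"
        using \<theta>(2)[OF D2[OF x] D2[OF y]] \<theta>(2)[OF D2[OF y] D2[OF x]] by linarith
      with m show "x = y" by (metis mult_div_mod_eq)
    qed
    then have "partial_embedding half_graph half_graph \<mu> D"
      using \<theta>(2) D2 unfolding partial_embedding_def half_graph(2)
      by (auto simp: half_graph_def \<mu>_def)
    moreover have "inj_on f D" using f by (auto simp: partial_embedding_def inj_on_def)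
    then have inv: "inv_into D f (f x) = x" if "x \<in> D" for x using that by (simp add: inv_into_f_f)
    then have "inv_into D f ` f ` D = D" by force
    ultimately have 1: "partial_embedding A half_graph (\<mu> \<circ> inv_into D f) (f ` D)"
      using partial_embedding_inverse[OF partial_embedding_subset[OF f subset_UNIV, of D]]
      by (intro partial_embedding_compose) simp_all
    have "partial_embedding half_graph B (\<alpha> \<circ> f) UNIV"
      by (rule partial_embedding_compose[OF f])
        (use \<alpha> partial_embedding_subset[OF _ subset_UNIV] in \<open>auto simp: emb_def\<close>)
    then have "partial_embedding A B ((\<alpha> \<circ> f) \<circ> (\<mu> \<circ> inv_into D f)) (f ` D)"
      by (intro partial_embedding_compose[OF 1]) (rule partial_embedding_subset[OF _ subset_UNIV])
    then obtain \<beta> where \<beta>: "emb \<beta>" "\<And>x. x \<in> f ` D \<Longrightarrow> \<beta> x = ((\<alpha> \<circ> f) \<circ> (\<mu> \<circ> inv_into D f)) x"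
      using emb_extend[of _ "f ` D"] D_def by (metis List.finite_set finite_UnI finite_imageI)
    have \<beta>f: "\<beta> (f x) = \<alpha> (f (\<mu> x))" if "x \<in> D" for x using \<beta>(2)[of "f x"] inv[OF that] that by simp
    have "?c \<beta> k = ?c \<alpha> (\<theta> k)" if "k \<in> set xs" for k
    proof -
      have "2 * k \<in> D" "2 * k + 1 \<in> D" using that by (auto simp: D_def)
      then have "\<beta> (f (2 * k)) = \<alpha> (f (2 * \<theta> k))" "\<beta> (f (2 * k + 1)) = \<alpha> (f (2 * \<theta> k + 1))"
        using \<beta>f[of "2 * k"] \<beta>f[of "2 * k + 1"] by (simp_all add: \<mu>_def)
      then show ?thesis by (simp add: left_tuple_def right_tuple_def tapp_def UW_defs)
    qed
    then have "map (?c \<beta>) xs = map (?c \<alpha>) ys" unfolding \<theta>(1) by simp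
    then show ?thesis using rep_same_type[OF rep[OF \<alpha>] rep[OF \<beta>(1), of xs]] by metis
  qed
  moreover have "?c \<alpha> k \<in> tuples (carriers N)" for k
    using rep_tuples[OF rep[OF \<alpha>, of "[k]"]] by (simp add: tconcat_def)
  moreover have "shape (?c \<alpha> k) = shape (?c \<alpha> l)" for k l
    by (simp add: left_tuple_def right_tuple_def tapp_def shape_def)
  ultimately show ?thesis unfolding indiscernible_def by blast
qed

lemma forking_unstable:
  "\<exists>a b :: nat \<Rightarrow> ('g, 'v) tuple.
    (\<forall>i. a i \<in> tuples (carriers N) \<and> b i \<in> tuples (carriers N)) \<and>
    (\<forall>i j. shape (a i) = shape (a j) \<and> shape (b i) = shape (b j)) \<and>
    indiscernible N (\<lambda>i. a i \<frown> b i) \<and>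
    (\<forall>i j. \<not> forking_independent N (a i) (b j) \<longleftrightarrow> i < j)"
proof -
  have "partial_embedding half_graph A undefined {}" by (simp add: partial_embedding_def)
  then obtain f where f: "partial_embedding half_graph A f UNIV"
    using embedding_extend[OF _ _ half_graph A(1)] by blast
  obtain \<alpha> where \<alpha>: "emb \<alpha>" by (rule emb_exists)
  obtain e0 where "\<And>n. indep n e0" using indep_sequence by blast
  then have e: "indep 4 e0" .
  have ee: "e0 k \<in> vec N" for k by (rule indep_vec[OF e])
  let ?a = "\<lambda>k. left_tuple \<alpha> e0 (f (2 * k))" and ?b = "\<lambda>k. right_tuple \<alpha> e0 (f (2 * k + 1))"
  note fD = partial_embeddingD[OF f, OF UNIV_I]
  have i: "f (2 * k) \<in> left A" for k using fD(1)[of "2 * k"] by (simp add: half_graph_def)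
  have j: "f (2 * k + 1) \<in> right A" for k using fD(2)[of "2 * k + 1"] by (simp add: half_graph_def)
  have ij: "edge A (f (2 * k)) (f (2 * l + 1)) \<longleftrightarrow> k < l" for k l
    using fD(3)[OF UNIV_I, of "2 * k" "2 * l + 1"] by (simp add: half_graph_def)
  have "\<not> forking_independent N (?a k) (?b l) \<longleftrightarrow> k < l" for k l
    using independent_tuples[OF \<alpha> i j _ e] dependent_tuples[OF \<alpha> i j _ e] ij by blast
  moreover have "?a k \<in> tuples (carriers N)" "?b k \<in> tuples (carriers N)" for k
    using emb_in_gam[OF \<alpha>] tv_vec[of \<alpha> e0, OF \<alpha> ee]
    by (simp_all add: left_tuple_def right_tuple_def tuples_def carriers_def)
  moreover have "shape (?a k) = shape (?a l)" "shape (?b k) = shape (?b l)" for k l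
    by (simp_all add: left_tuple_def right_tuple_def shape_def)
  ultimately show ?thesis using indiscernible_half_graph[OF f \<alpha> e]
    by (intro exI[of _ ?a] exI[of _ ?b]) simp
qed

end

theorem mainTheorem3:
  fixes G :: "'a bigraph"
    and X :: "'a \<Rightarrow> 'q::{division_ring,ring_char_0}"
    and scale :: "'q \<Rightarrow> 'm::ab_group_add \<Rightarrow> 'm"
    and N :: "('g, 'v) lstr"
  assumes "random_bipartite G"
    and "division_ring_of_fractions G X"
    and "left_module scale"
    and "\<not> finitely_spanned scale"
    and "is_model N (complete_theory (module_structure G X scale))"
    and "aleph1_saturated N"
  shows "\<exists>a b :: nat \<Rightarrow> ('g, 'v) tuple.
    (\<forall>i. a i \<in> tuples (carriers N) \<and> b i \<in> tuples (carriers N)) \<and>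
    (\<forall>i j. shape (a i) = shape (a j) \<and> shape (b i) = shape (b j)) \<and>
    indiscernible N (\<lambda>i. a i \<frown> b i) \<and>
    (\<forall>i j. \<not> forking_independent N (a i) (b j) \<longleftrightarrow> i < j)"
proof -
  obtain \<gamma> :: "nat \<Rightarrow> 'a" where "bij_betw \<gamma> UNIV (verts G)" "extension_axioms G"
    using assms(1) by (rule random_bipartite_enumeration)
  then interpret model G X \<gamma> scale N
    using assms by (simp add: model_def model_axioms_def fractions_def)
  show ?thesis by (rule forking_unstable)
qed

end
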